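(* Let $f_0\in\mathcal M_+([0,\infty])$ with $\int_{[0,\infty]}f_0(V)dV=1$ and $f_0(\{\infty\})=0$. Let $f(V,t)$ be the unique weak solution of $$\partial_t f(V,t)=\int_0^V G(v)\big((V-v)^{1/3}+v^{1/3}\big)^2f(V-v,t)\,dv-\int_0^\infty G(v)\big(V^{1/3}+v^{1/3}\big)^2dv\,f(V,t),\qquad f(\cdot,0)=f_0 .$$ Then $$t^\mu f(t^\mu w,t)\rightharpoonup F(w)\qquad\text{as }t\to\infty$$ in the weak topology of $\mathcal M_+([0,\infty])$, where $F$ is the self-similar profile described in the context.
   Context: Standing assumptions: $\frac53<\sigma<2$, $\mu=(\sigma-\frac53)^{-1}$; $G:(0,\infty)\to[0,\infty)$ satisfies $G\in L^1(0,\infty)$, $G(v)\le C_0v^{-\sigma}$ for all $v>0$ (some $C_0>0$), and $\lim_{v\to\infty}v^\sigma G(v)=1$. $[0,\infty]$ is the compactified half-line. $\mathcal M_+([0,\infty])$ is the set of nonnegative Radon measures on $[0,\infty]$, with the weak topology given by duality with $C([0,\infty])$; $\int\psi(V)f(V)\,dV$ denotes integration against the measure $f$. $t^\mu f(t^\mu w,t)$ denotes the push-forward of the measure $f(\cdot,t)$ under $V\mapsto w=t^{-\mu}V$. For $M>0$ let $X_M=\{\varphi\in C([0,\infty]):\varphi\text{ is constant on }[M,\infty]\}$, $\mathcal X=\bigcup_{M>0}X_M$. $C^\infty([0,\infty])$ is the set of $\psi\in C^\infty([0,\infty))$ such that $\lim_{v\to\infty}\partial_v^k\psi(v)$ exists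 for every $k\ge0$. Weak solution: $f\in C([0,T];\mathcal M_+([0,\infty]))$ (for each $T>0$) with $f(\cdot,0)=f_0$ such that for every $\varphi\in C^1([0,T];C^\infty([0,\infty])\cap\mathcal X)$ (with $\varphi(\cdot,t)\in X_M$ for a common $M$) $$\int_{[0,\infty]}f(V,T)\varphi(V,T)dV-\int_{[0,\infty]}f(V,0)\varphi(V,0)dV-\int_0^T\!\!\int_{[0,\infty]}f\,\partial_t\varphi\,dV\,dt=\int_0^T\!\!\int_{[0,\infty]}\int_0^\infty G(v)(V^{1/3}+v^{1/3})^2f(V,t)\big(\varphi(V+v,t)-\varphi(V,t)\big)dv\,dV\,dt$$ (the $v$-integral is taken to be $0$ at $V=\infty$). Such a solution exists and is unique. Self-similar profile: $F$ is the unique element of $\mathcal M_+([0,\infty])$ with total mass $1$ and $F(\{\infty\})=0$ such that $$\mu\int_{[0,\infty]}\xi\varphi'(\xi)F(\xi)d\xi=\int_{[0,\infty]}\int_0^\infty F(\xi)\eta^{-\sigma}(\xi^{1/3}+\eta^{1/3})^2[\varphi(\xi+\eta)-\varphi(\xi)]\,d\eta\,d\xi\quad\text{for all }\varphi\in C^\infty([0,\infty])\cap\mathcal X .$$ *)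

theory Defs
  imports "HOL-Analysis.Analysis"
begin

text \<open>
  The compactified half-line \<open>[0,\<infinity>]\<close> is the type \<^typ>\<open>ennreal\<close> with its order topology.
  It is compact and metrizable, so its nonnegative Radon measures are exactly the finite
  Borel measures.
\<close>

definition radon_measures :: "ennreal measure set" where
  "radon_measures = {N. sets N = sets borel \<and> finite_measure N}"

definition weakly_tendsto ::
    "('b \<Rightarrow> ennreal measure) \<Rightarrow> ennreal measure \<Rightarrow> 'b filter \<Rightarrow> bool" where
  "weakly_tendsto N L \<F> \<longleftrightarrow>
     (\<forall>\<psi> :: ennreal \<Rightarrow> real. continuous_on UNIV \<psi> \<longrightarrow>
        ((\<lambda>t. LINT V|N t. \<psi> V) \<longlongrightarrow> (LINT V|L. \<psi> V)) \<F>)"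

definition weakly_continuous_on :: "real set \<Rightarrow> (real \<Rightarrow> ennreal measure) \<Rightarrow> bool" where
  "weakly_continuous_on S f \<longleftrightarrow> (\<forall>t\<in>S. weakly_tendsto f (f t) (at t within S))"

text \<open>
  The \<open>k\<close>-th derivative of \<open>\<psi>\<close> on \<open>[0,\<infinity>)\<close>, one-sided at \<open>0\<close>; it is meaningful only for
  arguments \<open>v \<ge> 0\<close>.
\<close>

primrec vderiv :: "nat \<Rightarrow> (ennreal \<Rightarrow> real) \<Rightarrow> real \<Rightarrow> real" where
  "vderiv 0 \<psi> = (\<lambda>v. \<psi> (ennreal v))"
| "vderiv (Suc k) \<psi> = (\<lambda>v. vector_derivative (vderiv k \<psi>) (at v within {0..}))"

text \<open>
  \<open>C\<^sup>\<infinity>([0,\<infinity>])\<close>: a function on \<open>[0,\<infinity>)\<close> with a limit at infinity is identified with its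
  continuous extension to \<open>[0,\<infinity>]\<close>.
\<close>

definition C_inf :: "(ennreal \<Rightarrow> real) set" where
  "C_inf = {\<psi>. continuous_on UNIV \<psi> \<and>
     (\<forall>k. \<forall>v\<ge>0. vderiv k \<psi> differentiable (at v within {0..})) \<and>
     (\<forall>k. \<exists>l. (vderiv k \<psi> \<longlongrightarrow> l) at_top)}"

definition X_space :: "real \<Rightarrow> (ennreal \<Rightarrow> real) set" where
  "X_space M = {\<phi>. continuous_on UNIV \<phi> \<and> \<phi> constant_on {ennreal M..}}"

definition X_union :: "(ennreal \<Rightarrow> real) set" where
  "X_union = (\<Union>M\<in>{0<..}. X_space M)"

text \<open>
  Convergence in the Frechet topology of \<open>C\<^sup>\<infinity>([0,\<infinity>])\<close>, given by the seminorms
  \<open>\<psi> \<mapsto> sup\<^sub>v |\<partial>\<^sub>v\<^sup>k \<psi>(v)|\<close>.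
\<close>

definition C_inf_tendsto ::
    "('b \<Rightarrow> ennreal \<Rightarrow> real) \<Rightarrow> (ennreal \<Rightarrow> real) \<Rightarrow> 'b filter \<Rightarrow> bool" where
  "C_inf_tendsto \<Psi> \<psi> \<F> \<longleftrightarrow>
     (\<forall>k. uniform_limit {0..} (\<lambda>s. vderiv k (\<Psi> s)) (vderiv k \<psi>) \<F>)"

text \<open>
  \<open>\<phi> \<in> C\<^sup>1([0,T]; C\<^sup>\<infinity>([0,\<infinity>]) \<inter> \<X>)\<close>, with all \<open>\<phi>(\<cdot>,t)\<close> in a common \<open>X\<^sub>M\<close> and with time derivative
  \<open>\<phi>'\<close> (which is determined by \<open>\<phi>\<close> on \<open>[0,T]\<close>). The time argument comes first.
\<close>

definition C1_test_function ::
    "real \<Rightarrow> (real \<Rightarrow> ennreal \<Rightarrow> real) \<Rightarrow> (real \<Rightarrow> ennreal \<Rightarrow> real) \<Rightarrow> bool" where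
  "C1_test_function T \<phi> \<phi>' \<longleftrightarrow>
     (\<exists>M>0. \<forall>t\<in>{0..T}. \<phi> t \<in> C_inf \<inter> X_space M \<and> \<phi>' t \<in> C_inf \<inter> X_space M) \<and>
     (\<forall>t\<in>{0..T}.
        C_inf_tendsto (\<lambda>s V. (\<phi> s V - \<phi> t V) / (s - t)) (\<phi>' t) (at t within {0..T}) \<and>
        C_inf_tendsto \<phi>' (\<phi>' t) (at t within {0..T}))"

text \<open>
  The value \<open>0\<close> at \<open>V = \<infinity>\<close> is the stated convention; it has to be explicit because
  \<^term>\<open>enn2real \<infinity>\<close> is \<open>0\<close>.
\<close>

definition growth_op :: "(real \<Rightarrow> real) \<Rightarrow> (ennreal \<Rightarrow> real) \<Rightarrow> ennreal \<Rightarrow> real" where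
  "growth_op G \<phi> V =
     (if V = \<infinity> then 0
      else LINT v:{0<..}|lebesgue.
             G v * (enn2real V powr (1/3) + v powr (1/3))\<^sup>2 * (\<phi> (V + ennreal v) - \<phi> V))"

definition weak_solution ::
    "(real \<Rightarrow> real) \<Rightarrow> ennreal measure \<Rightarrow> (real \<Rightarrow> ennreal measure) \<Rightarrow> bool" where
  "weak_solution G f\<^sub>0 f \<longleftrightarrow>
     (\<forall>t\<ge>0. f t \<in> radon_measures) \<and>
     (\<forall>T>0. weakly_continuous_on {0..T} f) \<and>
     f 0 = f\<^sub>0 \<and>
     (\<forall>T>0. \<forall>\<phi> \<phi>'. C1_test_function T \<phi> \<phi>' \<longrightarrow>
        (LINT V|f T. \<phi> T V) - (LINT V|f 0. \<phi> 0 V)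
          - (LINT t:{0..T}|lebesgue. (LINT V|f t. \<phi>' t V))
        = (LINT t:{0..T}|lebesgue. (LINT V|f t. growth_op G (\<phi> t) V)))"

definition self_similar_profile :: "real \<Rightarrow> real \<Rightarrow> ennreal measure \<Rightarrow> bool" where
  "self_similar_profile \<sigma> \<mu> F \<longleftrightarrow>
     F \<in> radon_measures \<and> emeasure F UNIV = 1 \<and> emeasure F {\<infinity>} = 0 \<and>
     (\<forall>\<phi> \<in> C_inf \<inter> X_union.
        \<mu> * (LINT \<xi>|F. enn2real \<xi> * vderiv 1 \<phi> (enn2real \<xi>))
        = (LINT \<xi>|F. growth_op (\<lambda>\<eta>. \<eta> powr (-\<sigma>)) \<phi> \<xi>))"

text \<open>
  \<open>t\<^sup>\<mu> f(t\<^sup>\<mu> w, t)\<close>, the push-forward of \<open>f(\<cdot>,t)\<close> under \<open>V \<mapsto> t\<^sup>-\<^sup>\<mu> V\<close>.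
\<close>

definition rescaled :: "real \<Rightarrow> (real \<Rightarrow> ennreal measure) \<Rightarrow> real \<Rightarrow> ennreal measure" where
  "rescaled \<mu> f t = distr (f t) borel (\<lambda>V. ennreal (t powr (-\<mu>)) * V)"

end

theory Submission
  imports Defs
begin

text \<open>
  The jump rate increases with the volume, so the equation is monotone: two evolutions that are
  ordered when tested against decreasing functions stay ordered. The laws of \<open>t\<^sup>\<mu> \<xi>\<close> with
  \<open>\<xi>\<close> distributed according to \<open>F\<close> solve the equation with kernel \<open>v\<^bsup>-\<sigma>\<^esup>\<close>. On decreasing test
  functions they also solve the equation with kernel \<open>G\<close> up to an error \<open>o(1/t)\<close>: the profile
  equation forces \<open>F[x, x + v] \<le> C v\<^sup>\<alpha>\<close> with \<open>\<alpha> > \<sigma> - 1\<close>, and then the average of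
  \<open>\<phi>(x) - \<phi>(x + v)\<close> under \<open>F\<close> is at most \<open>2 C v\<^sup>\<alpha>\<close> for every decreasing \<open>\<phi>\<close> with values in
  \<open>[0,1]\<close>, whatever its regularity. Hence \<open>f(\<cdot>, T)\<close> is squeezed between two slightly time-shifted
  copies of the self-similar solution: from one side \<open>f\<^sub>0\<close> is compared with the self-similar
  solution at time \<open>a T\<close>, from the other \<open>f(\<cdot>, s T)\<close> with the self-similar solution at time
  \<open>\<kappa> T\<close>, where \<open>a\<close> and \<open>s\<close> are small and \<open>\<kappa>\<close> is small compared with \<open>s\<close>.
\<close>

subsection \<open>Comparison along decreasing test functions\<close>

text \<open>The obstacle is uniformity in T. Test functions that see the scale T^\<mu> vanish only
  beyond \<open>M * T powr \<mu>\<close>, and up to there the bound C on the jump rate grows with T,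
  so a Gronwall factor exp(C T) would be useless. A maximum principle avoids it: the generator is C
  (U - 1) with U mapping the test class into itself, so the worst discrepancy over the class grows
  only through the consistency error, and C drops out.

  The price is that the consistency error has to be small for the whole class at once. Images under
  U need not be Lipschitz, because the cube root in the rate has infinite slope at 0, whereas
  v^(-\<sigma>) is not integrable at 0 and would ordinarily demand regularity of the test function.
  The regularity is taken from F instead: an averaged decrement of order v^\<alpha> is integrable
  against v^(-\<sigma>) near 0 exactly when \<alpha> > \<sigma> - 1. The rate o(1/t) of the error is
  the critical one, since it is accumulated over a time of order T. The time shifts are paid for by
  continuity of the self-similar solution in time.\<close>

lemma integral_diff_le_on_nonneg:
  fixes p q :: "real \<Rightarrow> real"
  assumes fin: "finite_measure N" and le1: "measure N (space N) \<le> 1" and pos: "AE x in N. 0 \<le> x"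
    and int: "integrable N p" "integrable N q" and le: "\<And>x. 0 \<le> x \<Longrightarrow> \<bar>p x - q x\<bar> \<le> e"
  shows "\<bar>(\<integral>x. p x \<partial>N) - (\<integral>x. q x \<partial>N)\<bar> \<le> e"
proof -
  interpret finite_measure N by fact
  have "0 \<le> e" using le[of 0] by simp
  have "\<bar>(\<integral>x. p x \<partial>N) - (\<integral>x. q x \<partial>N)\<bar> \<le> (\<integral>x. \<bar>p x - q x\<bar> \<partial>N)"
    using integral_abs_bound[of N "\<lambda>x. p x - q x"] by (simp add: Bochner_Integration.integral_diff[OF int])
  also have "\<dots> \<le> (\<integral>x. e \<partial>N)"
  proof (rule integral_mono_AE)
    show "integrable N (\<lambda>x. \<bar>p x - q x\<bar>)"
      by (intro integrable_abs Bochner_Integration.integrable_diff int)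
    show "AE x in N. \<bar>p x - q x\<bar> \<le> e" using pos by eventually_elim (rule le)
  qed simp
  also have "\<dots> \<le> e" using le1 \<open>0 \<le> e\<close> by (simp add: mult_left_le_one_le)
  finally show ?thesis .
qed

lemma continuous_on_of_DERIV:
  fixes f :: "real \<Rightarrow> real"
  assumes "\<And>x. (f has_real_derivative f' x) (at x)"
  shows "continuous_on A f" "f \<in> borel_measurable borel"
proof -
  show "continuous_on A f" for A
    using assms by (meson DERIV_isCont continuous_at_imp_continuous_on)
  then show "f \<in> borel_measurable borel" by (rule borel_measurable_continuous_onI)
qed

text \<open>The minus sign makes \<Phi> decreasing when g is nonnegative. Normalising at M lets
  \<Phi> vanish wherever g is known to vanish.\<close>

lemma antiderivative_vanishing:
  fixes g :: "real \<Rightarrow> real"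
  assumes "continuous_on UNIV g" and g0: "\<And>x. x \<ge> M \<Longrightarrow> g x = 0"
  obtains \<Phi> where "\<And>x. (\<Phi> has_real_derivative - g x) (at x)" "\<And>x. x \<ge> M \<Longrightarrow> \<Phi> x = 0"
proof -
  have "\<exists>F. \<forall>x::real. -\<infinity> < ereal x \<longrightarrow> ereal x < \<infinity> \<longrightarrow> (F has_vector_derivative g x) (at x)"
    by (rule einterval_antiderivative) (use assms in \<open>auto simp: continuous_on_eq_continuous_at\<close>)
  then obtain F where F: "\<And>x. (F has_real_derivative g x) (at x)"
    by (auto simp: has_real_derivative_iff_has_vector_derivative)
  have "F M - F x = 0" if "x \<ge> M" for x
  proof (cases "x = M")
    case False
    with that have "M < x" by simp
    then have "\<exists>z>M. z < x \<and> F x - F M = (x - M) * g z"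
      by (rule MVT2) (rule F)
    then obtain z where "z > M" "F x - F M = (x - M) * g z"
      by auto
    then show ?thesis using g0[of z] by simp
  qed simp
  moreover have "((\<lambda>x. F M - F x) has_real_derivative - g x) (at x)" for x
    using DERIV_diff[OF DERIV_const F, of "F M" x] by simp
  ultimately show ?thesis
    by (rule that[rotated])
qed

text \<open>The a priori bound 2 is improved to the remainder of the \<open>n\<close>-th Picard iterate.\<close>

lemma comparison_iterate:
  fixes d :: "'a \<Rightarrow> real \<Rightarrow> real" and U :: "'a \<Rightarrow> 'a"
  assumes "C \<ge> 0" "0 \<le> \<delta>" "0 \<le> \<delta>0"
    and U: "\<And>\<phi>. \<phi> \<in> S \<Longrightarrow> U \<phi> \<in> S"
    and cont: "\<And>\<phi>. \<phi> \<in> S \<Longrightarrow> continuous_on {0..T} (d \<phi>)"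
    and init: "\<And>\<phi>. \<phi> \<in> S \<Longrightarrow> d \<phi> 0 \<le> \<delta>0"
    and bd: "\<And>\<phi> t. \<phi> \<in> S \<Longrightarrow> 0 \<le> t \<Longrightarrow> t \<le> T \<Longrightarrow> d \<phi> t \<le> 2"
    and step: "\<And>\<phi> s t. \<phi> \<in> S \<Longrightarrow> 0 \<le> s \<Longrightarrow> s \<le> t \<Longrightarrow> t \<le> T \<Longrightarrow>
      d \<phi> t - d \<phi> s \<le> integral {s..t} (\<lambda>r. C * (d (U \<phi>) r - d \<phi> r)) + \<delta> * (t - s)"
    and "\<phi> \<in> S" "0 \<le> t" "t \<le> T"
  shows "d \<phi> t \<le> \<delta>0 + \<delta> * t + 2 * (C * t) ^ n / fact n"
  using \<open>\<phi> \<in> S\<close> \<open>0 \<le> t\<close> \<open>t \<le> T\<close>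
proof (induction n arbitrary: \<phi> t)
  case 0
  then show ?case using bd[of \<phi> t] \<open>0 \<le> \<delta>\<close> \<open>0 \<le> \<delta>0\<close> by (simp add: add_increasing)
next
  case (Suc n)
  define b where "b r = \<delta>0 + \<delta> * r + 2 * (C * r) ^ Suc n / fact (Suc n)" for r
  show ?case
  proof (rule ccontr)
    assume "\<not> ?thesis"
    then have neg: "d \<phi> t > b t" by (simp add: b_def)
    \<comment> \<open>The last time s up to t at which the bound holds is singled out. On [s, t] the
      function d \<phi> lies above b, so the loss term cancels the part \<delta>0 + \<delta> r of
      the bound that the induction hypothesis gives for d (U \<phi>).\<close>
    define Z where "Z = {s\<in>{0..t}. d \<phi> s \<le> b s}"
    have contd: "continuous_on {0..t} (d \<phi>)" "continuous_on {0..t} (d (U \<phi>))"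
      using cont[of \<phi>] cont[of "U \<phi>"] U Suc.prems by (auto intro: continuous_on_subset)
    have contb: "continuous_on A b" for A
      unfolding b_def by (intro continuous_intros) simp
    have "closed Z"
      unfolding Z_def by (intro continuous_on_closed_Collect_le contd contb) simp
    moreover have "bounded Z" unfolding Z_def by (rule bounded_subset[of "{0..t}"]) auto
    ultimately have "compact Z" by (simp add: compact_eq_bounded_closed)
    moreover have "0 \<in> Z"
      using init[OF Suc.prems(1)] Suc.prems by (simp add: Z_def b_def)
    ultimately obtain s where s: "s \<in> Z" "\<And>r. r \<in> Z \<Longrightarrow> r \<le> s"
      using compact_attains_sup[of Z] by blast
    have st: "0 \<le> s" "s \<le> t" "d \<phi> s \<le> b s" using s(1) by (auto simp: Z_def)
    have above: "b r \<le> d \<phi> r" if "s < r" "r \<le> t" for r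
      using s(2)[of r] that st by (force simp: Z_def)
    have cs: "continuous_on {s..t} (d \<phi>)" "continuous_on {s..t} (d (U \<phi>))"
      using contd st by (auto intro: continuous_on_subset)
    \<comment> \<open>The end point s is added by continuity from the right, since the integral
      comparison below runs over the closed interval [s, t].\<close>
    have above': "b r \<le> d \<phi> r" if "s \<le> r" "r \<le> t" "s < t" for r
    proof -
      have "continuous_on (closure {s<..t}) (\<lambda>r. d \<phi> r - b r)"
        using cs that by (auto intro!: continuous_intros contb)
      then have "0 \<le> d \<phi> r - b r"
        by (rule continuous_ge_on_closure) (use that above in auto)
      then show ?thesis by simp
    qed
    have "d \<phi> t \<le> b t"
    proof (cases "s < t")
      case True
      have "integral {s..t} (\<lambda>r. C * (d (U \<phi>) r - d \<phi> r))
          \<le> integral {s..t} (\<lambda>r. C * (2 * (C * r) ^ n / fact n))"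
      proof (rule integral_le)
        show "(\<lambda>r. C * (d (U \<phi>) r - d \<phi> r)) integrable_on {s..t}"
          by (intro integrable_continuous_real continuous_intros cs)
        show "(\<lambda>r. C * (2 * (C * r) ^ n / fact n)) integrable_on {s..t}"
          by (intro integrable_continuous_real continuous_intros) simp
        fix r assume r: "r \<in> {s..t}"
        have "d (U \<phi>) r \<le> \<delta>0 + \<delta> * r + 2 * (C * r) ^ n / fact n"
          using Suc.IH[OF U[OF Suc.prems(1)], of r] r st Suc.prems by simp
        moreover have "\<delta>0 + \<delta> * r \<le> b r"
          using r st \<open>C \<ge> 0\<close> by (simp add: b_def)
        ultimately have "d (U \<phi>) r - d \<phi> r \<le> 2 * (C * r) ^ n / fact n"
          using above'[of r] r True by simp
        then show "C * (d (U \<phi>) r - d \<phi> r) \<le> C * (2 * (C * r) ^ n / fact n)"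
          using \<open>C \<ge> 0\<close> by (rule mult_left_mono)
      qed
      \<comment> \<open>Integration turns the remainder of order n into the one of order n + 1, so d
        \<phi> grows over [s, t] by at most as much as b. This contradicts d \<phi> t > b t.\<close>
      also have "\<dots> = 2 * (C * t) ^ Suc n / fact (Suc n) - 2 * (C * s) ^ Suc n / fact (Suc n)"
      proof (rule integral_unique, rule fundamental_theorem_of_calculus)
        fix r assume "r \<in> {s..t}"
        have "((\<lambda>r. 2 * (C * r) ^ Suc n / fact (Suc n)) has_real_derivative
            2 * (real (Suc n) * (C * (C * r) ^ n)) / fact (Suc n)) (at r)"
          by (rule DERIV_cdivide DERIV_cmult DERIV_chain2[OF DERIV_pow] | rule derivative_eq_intros refl | simp)+
        also have "2 * (real (Suc n) * (C * (C * r) ^ n)) / fact (Suc n) = C * (2 * (C * r) ^ n / fact n)"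
          unfolding fact_Suc by (simp del: of_nat_Suc)
        finally have "((\<lambda>r. 2 * (C * r) ^ Suc n / fact (Suc n)) has_real_derivative
            C * (2 * (C * r) ^ n / fact n)) (at r)" .
        then show "((\<lambda>r. 2 * (C * r) ^ Suc n / fact (Suc n)) has_vector_derivative C * (2 * (C * r) ^ n / fact n))
            (at r within {s..t})"
          by (auto simp: has_real_derivative_iff_has_vector_derivative intro: has_vector_derivative_at_within)
      qed (use True in simp)
      finally have "d \<phi> t - d \<phi> s \<le> b t - b s"
        using step[OF Suc.prems(1), of s t] st Suc.prems by (simp add: b_def algebra_simps)
      then show ?thesis using st by simp
    next
      case False
      then show ?thesis using st by simp
    qed
    then show False using neg by simp
  qed
qed

text \<open>A maximum principle for the class S. Neither C nor the a priori bound 2 survives the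
  limit, since (C t)^n / n! tends to 0. This is decisive where C depends on the range of the tests
  and hence on the time horizon.\<close>

lemma comparison:
  fixes d :: "'a \<Rightarrow> real \<Rightarrow> real" and U :: "'a \<Rightarrow> 'a"
  assumes "C \<ge> 0" "0 \<le> \<delta>" "0 \<le> \<delta>0"
    and "\<And>\<phi>. \<phi> \<in> S \<Longrightarrow> U \<phi> \<in> S"
    and "\<And>\<phi>. \<phi> \<in> S \<Longrightarrow> continuous_on {0..T} (d \<phi>)"
    and "\<And>\<phi>. \<phi> \<in> S \<Longrightarrow> d \<phi> 0 \<le> \<delta>0"
    and "\<And>\<phi> t. \<phi> \<in> S \<Longrightarrow> 0 \<le> t \<Longrightarrow> t \<le> T \<Longrightarrow> d \<phi> t \<le> 2"
    and "\<And>\<phi> s t. \<phi> \<in> S \<Longrightarrow> 0 \<le> s \<Longrightarrow> s \<le> t \<Longrightarrow> t \<le> T \<Longrightarrow>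
      d \<phi> t - d \<phi> s \<le> integral {s..t} (\<lambda>r. C * (d (U \<phi>) r - d \<phi> r)) + \<delta> * (t - s)"
    and "\<phi> \<in> S" "0 \<le> t" "t \<le> T"
  shows "d \<phi> t \<le> \<delta>0 + \<delta> * t"
proof -
  have "(\<lambda>n. inverse (fact n) * (C * t) ^ n) \<longlonglongrightarrow> 0"
    by (rule summable_LIMSEQ_zero[OF summable_exp])
  then have "(\<lambda>n. \<delta>0 + \<delta> * t + 2 * (inverse (fact n) * (C * t) ^ n)) \<longlonglongrightarrow> \<delta>0 + \<delta> * t + 2 * 0"
    by (intro tendsto_intros)
  moreover have "d \<phi> t \<le> \<delta>0 + \<delta> * t + 2 * (inverse (fact n) * (C * t) ^ n)" for n
    using comparison_iterate[of C \<delta> \<delta>0 S U T d \<phi> t n, OF assms] by (simp add: field_simps)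
  ultimately show ?thesis
    by (intro LIMSEQ_le_const[of _ "\<delta>0 + \<delta> * t"]) auto
qed

text \<open>Testing against this class amounts to the usual stochastic order. No modulus of
  continuity is included: the cube root in \<open>rate\<close> has infinite slope at 0, so a
  Lipschitz bound would not be preserved by the jump chain.\<close>

definition decreasing_tests :: "real \<Rightarrow> (real \<Rightarrow> real) set" where
  "decreasing_tests M =
     {\<phi>. continuous_on UNIV \<phi> \<and> antimono \<phi> \<and> (\<forall>x. \<phi> x \<le> 1) \<and> (\<forall>x\<ge>M. \<phi> x = 0)}"

lemma decreasing_testsD:
  assumes "\<phi> \<in> decreasing_tests M"
  shows "continuous_on UNIV \<phi>" "x \<le> y \<Longrightarrow> \<phi> y \<le> \<phi> x" "\<phi> x \<le> 1" "0 \<le> \<phi> x" "x \<ge> M \<Longrightarrow> \<phi> x = 0"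
    "\<phi> \<in> borel_measurable borel"
proof -
  have "antimono \<phi>" "\<phi> (max x M) = 0"
    using assms by (auto simp: decreasing_tests_def)
  with antimonoD[of \<phi> x "max x M"] have "0 \<le> \<phi> x" by simp
  moreover have "\<phi> \<in> borel_measurable borel"
    using assms by (auto simp: decreasing_tests_def intro: borel_measurable_continuous_onI)
  ultimately show "continuous_on UNIV \<phi>" "x \<le> y \<Longrightarrow> \<phi> y \<le> \<phi> x" "\<phi> x \<le> 1" "0 \<le> \<phi> x"
    "x \<ge> M \<Longrightarrow> \<phi> x = 0" "\<phi> \<in> borel_measurable borel"
    using assms by (auto simp: decreasing_tests_def antimono_def)
qed

text \<open>On intervals of length \<open>\<eta>\<close> the decrements of \<open>\<phi>\<close> telescope, so no regularity of \<open>\<phi>\<close> is needed.\<close>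

lemma integral_decrement_le:
  fixes F :: "real measure"
  assumes fin: "finite_measure F" and sF: "sets F = sets borel" and F0: "AE x in F. 0 \<le> x"
    and \<phi>: "\<phi> \<in> decreasing_tests M" and "0 < \<eta>" "0 \<le> c"
    and conc: "\<And>x. 0 \<le> x \<Longrightarrow> x \<le> M \<Longrightarrow> measure F {x..x+\<eta>} \<le> c"
  shows "(\<integral>x. \<phi> x - \<phi> (x + \<eta>) \<partial>F) \<le> 2 * c"
proof -
  interpret finite_measure F by fact
  note [measurable_cong] = sF
  note D = decreasing_testsD[OF \<phi>]
  have [measurable]: "\<phi> \<in> borel_measurable borel" by (rule D)
  define N where "N = nat \<lceil>M / \<eta>\<rceil>"
  \<comment> \<open>Cells of length \<eta>: if x lies in cell j, then x + \<eta> lies in cell j + 1,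
    so the decrement is at most the drop of \<phi> over both cells. The double step is the origin of
    the factor 2 in the bound.\<close>
  define a where "a j = \<phi> (real j * \<eta>)" for j
  define I where "I j = {real j * \<eta>..real j * \<eta> + \<eta>}" for j
  have a: "0 \<le> a j - a (j + 2)" for j
    using D(2)[of "real j * \<eta>" "real (j+2) * \<eta>"] \<open>0 < \<eta>\<close> by (simp add: a_def)
  have pt: "\<phi> x - \<phi> (x + \<eta>) \<le> (\<Sum>j<N. indicator (I j) x * (a j - a (j + 2)))" if "x \<ge> 0" for x
  proof (cases "x < M")
    case False
    then have "\<phi> x - \<phi> (x + \<eta>) = 0" using D(5)[of x] D(5)[of "x + \<eta>"] \<open>0 < \<eta>\<close> by simp
    also have "\<dots> \<le> (\<Sum>j<N. indicator (I j) x * (a j - a (j + 2)))"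
      by (intro sum_nonneg mult_nonneg_nonneg a) simp
    finally show ?thesis .
  next
    case True
    define j where "j = nat \<lfloor>x / \<eta>\<rfloor>"
    have j: "real j = of_int \<lfloor>x / \<eta>\<rfloor>" using that \<open>0 < \<eta>\<close> by (simp add: j_def)
    have lo: "real j * \<eta> \<le> x"
      using of_int_floor_le[of "x/\<eta>"] unfolding j pos_le_divide_eq[OF \<open>0 < \<eta>\<close>] .
    have hi: "x \<le> real j * \<eta> + \<eta>"
      using real_of_int_floor_add_one_ge[of "x/\<eta>"]
      unfolding j pos_divide_le_eq[OF \<open>0 < \<eta>\<close>] by (simp add: algebra_simps)
    have "x / \<eta> < M / \<eta>" using True \<open>0 < \<eta>\<close> by (simp add: divide_strict_right_mono)
    then have "\<lfloor>x / \<eta>\<rfloor> < \<lceil>M / \<eta>\<rceil>" by linarith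
    then have jN: "j < N" using that \<open>0 < \<eta>\<close> using j unfolding N_def by linarith
    have "\<phi> x - \<phi> (x + \<eta>) \<le> indicator (I j) x * (a j - a (j + 2))"
      using lo hi D(2)[of "real j * \<eta>" x] D(2)[of "x + \<eta>" "real (j + 2) * \<eta>"]
      by (simp add: I_def a_def algebra_simps)
    also have "\<dots> \<le> (\<Sum>j<N. indicator (I j) x * (a j - a (j + 2)))"
      by (rule member_le_sum) (use jN a in auto)
    finally show ?thesis .
  qed
  have "\<bar>\<phi> x - \<phi> (x + \<eta>)\<bar> \<le> 1" for x
    using D(3,4)[of x] D(3,4)[of "x + \<eta>"] by linarith
  then have int: "integrable F (\<lambda>x. \<phi> x - \<phi> (x + \<eta>))"
    by (intro integrable_const_bound[where B=1]) auto
  have intj: "integrable F (\<lambda>x. indicator (I j) x * (a j - a (j + 2)))" for j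
    by (intro integrable_mult_left integrable_real_indicator) (auto simp: I_def sF less_top[symmetric])
  then have intI: "integrable F (\<lambda>x. \<Sum>j<N. indicator (I j) x * (a j - a (j + 2)))"
    by (intro Bochner_Integration.integrable_sum)
  have "(\<integral>x. \<phi> x - \<phi> (x + \<eta>) \<partial>F) \<le> (\<integral>x. (\<Sum>j<N. indicator (I j) x * (a j - a (j + 2))) \<partial>F)"
  proof (rule integral_mono_AE[OF int])
    show "integrable F (\<lambda>x. \<Sum>j<N. indicator (I j) x * (a j - a (j + 2)))"
      by (rule intI)
    show "AE x in F. \<phi> x - \<phi> (x + \<eta>) \<le> (\<Sum>j<N. indicator (I j) x * (a j - a (j + 2)))"
      using F0 by eventually_elim (rule pt)
  qed
  also have "\<dots> = (\<Sum>j<N. measure F (I j) * (a j - a (j + 2)))"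
    by (subst Bochner_Integration.integral_sum[OF intj]) (simp add: I_def sF)
  also have "\<dots> \<le> (\<Sum>j<N. c * (a j - a (j + 2)))"
  proof (intro sum_mono mult_right_mono a)
    fix j assume "j \<in> {..<N}"
    then have "real j \<le> M / \<eta>" unfolding N_def by simp linarith
    then show "measure F (I j) \<le> c"
      using conc[of "real j * \<eta>"] \<open>0 < \<eta>\<close> by (simp add: I_def field_simps)
  qed
  \<comment> \<open>Telescoping in steps of two leaves two values at each end, all of them between 0
    and 1.\<close>
  also have "\<dots> = c * (a 0 + a 1 - a N - a (N + 1))"
    unfolding sum_distrib_left[symmetric] by (induction N) (auto simp: algebra_simps)
  also have "\<dots> \<le> c * 2"
    using D(3)[of "real 0 * \<eta>"] D(3)[of "real 1 * \<eta>"] D(4)[of "real N * \<eta>"] D(4)[of "real (N+1) * \<eta>"] \<open>0 \<le> c\<close>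
    by (intro mult_left_mono) (auto simp: a_def)
  finally show ?thesis by simp
qed

subsection \<open>Jump kernels and the growth operator\<close>

lemma continuous_on_integral_param:
  fixes f :: "'a::metric_space \<Rightarrow> 'b \<Rightarrow> real"
  assumes "integrable N w"
    and "\<And>x. x \<in> A \<Longrightarrow> f x \<in> borel_measurable N"
    and "\<And>x. x \<in> A \<Longrightarrow> AE v in N. \<bar>f x v\<bar> \<le> w v"
    and "AE v in N. continuous_on A (\<lambda>x. f x v)"
  shows "continuous_on A (\<lambda>x. \<integral>v. f x v \<partial>N)"
  unfolding continuous_on_sequentially
proof (intro allI ballI impI, elim conjE)
  fix u a assume a: "a \<in> A" and u: "\<forall>n. u n \<in> A" "u \<longlonglongrightarrow> a"
  show "((\<lambda>x. \<integral>v. f x v \<partial>N) \<circ> u) \<longlonglongrightarrow> (\<integral>v. f a v \<partial>N)"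
    unfolding comp_def
  proof (rule integral_dominated_convergence[where w=w])
    show "AE v in N. (\<lambda>n. f (u n) v) \<longlonglongrightarrow> f a v"
      using assms(4)
    proof eventually_elim
      case (elim v)
      then show ?case
        using a u unfolding continuous_on_sequentially comp_def by blast
    qed
  qed (use assms a u in auto)
qed

text \<open>The factor (x^(1/3) + v^(1/3))^2 of the equation. Truncation at 0 makes it monotone on
  the whole line, while the measures charge only x \<ge> 0.\<close>

definition rate :: "real \<Rightarrow> real \<Rightarrow> real" where
  "rate x v = (max 0 x powr (1/3) + v powr (1/3))\<^sup>2"

lemma rate_nonneg [simp]: "0 \<le> rate x v"
  by (simp add: rate_def)

lemma rate_mono: "x \<le> y \<Longrightarrow> rate x v \<le> rate y v"
  unfolding rate_def by (intro power_mono add_right_mono powr_mono2) auto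

text \<open>The inequality a + b \<le> (a + 1) (1 + b) for nonnegative a, b separates the two
  variables; \<open>rate y 1\<close> is the factor left for the volume.\<close>

lemma rate_le: "x \<le> y \<Longrightarrow> rate x v \<le> rate y 1 * (1 + v powr (1/3))\<^sup>2"
proof -
  assume "x \<le> y"
  have "rate y v \<le> ((max 0 y powr (1/3) + 1) * (1 + v powr (1/3)))\<^sup>2"
    unfolding rate_def by (intro power_mono) (auto simp: algebra_simps)
  also have "\<dots> = rate y 1 * (1 + v powr (1/3))\<^sup>2"
    by (simp add: rate_def power_mult_distrib)
  finally show ?thesis using rate_mono[OF \<open>x \<le> y\<close>, of v] by linarith
qed

lemma rate_ge: "v powr (2/3) \<le> rate x v"
proof -
  have "v powr (2/3) = (v powr (1/3))\<^sup>2"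
    by (simp add: power2_eq_square flip: powr_add)
  also have "\<dots> \<le> rate x v"
    unfolding rate_def by (intro power_mono) auto
  finally show ?thesis .
qed

lemma rate_scale:
  assumes "0 < l" "0 \<le> v"
  shows "rate (l * x) (l * v) = l powr (2/3) * rate x v"
proof -
  have "max 0 (l * x) = l * max 0 x" using assms by (auto simp: max_def zero_le_mult_iff)
  moreover have "l powr (2/3) = (l powr (1/3))\<^sup>2"
    by (simp add: power2_eq_square flip: powr_add)
  ultimately show ?thesis
    using assms by (simp add: rate_def powr_mult power_mult_distrib flip: distrib_left)
qed

lemma continuous_on_rate: "continuous_on A (\<lambda>x. rate x v)"
  unfolding rate_def by (intro continuous_intros continuous_on_powr') auto

lemma rate_measurable [measurable]:
  assumes [measurable]: "f \<in> borel_measurable N" "g \<in> borel_measurable N"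
  shows "(\<lambda>x. rate (f x) (g x)) \<in> borel_measurable N"
  unfolding rate_def by measurable

text \<open>The real-line counterpart of \<open>growth_op\<close>. Integration runs over the whole
  line because all kernels used with it vanish for v \<le> 0.\<close>

definition growth :: "(real \<Rightarrow> real) \<Rightarrow> (real \<Rightarrow> real) \<Rightarrow> real \<Rightarrow> real" where
  "growth G \<phi> x = (\<integral>v. G v * rate x v * (\<phi> (x + v) - \<phi> x) \<partial>lborel)"

lemma growth_measurable [measurable]:
  assumes [measurable]: "G \<in> borel_measurable borel" "\<phi> \<in> borel_measurable borel"
  shows "growth G \<phi> \<in> borel_measurable borel"
  unfolding growth_def[abs_def] by measurable

definition power_kernel :: "real \<Rightarrow> real \<Rightarrow> real" where
  "power_kernel \<sigma> v = (if v > 0 then v powr (-\<sigma>) else 0)"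

text \<open>The basic dominating function of the kernel integrals: (1 + v^(1/3))^2 comes from
  \<open>rate_le\<close>, and min 1 (v^\<beta>) bounds increments of order v^\<beta>, with \<beta> =
  1 for Lipschitz test functions and other exponents for averaged decrements.\<close>

definition weight :: "real \<Rightarrow> real \<Rightarrow> real \<Rightarrow> real" where
  "weight \<sigma> \<beta> v = power_kernel \<sigma> v * (1 + v powr (1/3))\<^sup>2 * min 1 (v powr \<beta>)"

lemma power_kernel_measurable [measurable]: "power_kernel \<sigma> \<in> borel_measurable borel"
  unfolding power_kernel_def by measurable

lemma power_kernel_nonneg [simp]: "0 \<le> power_kernel \<sigma> v"
  by (simp add: power_kernel_def)

lemma weight_measurable [measurable]: "weight \<sigma> \<beta> \<in> borel_measurable borel"
  unfolding weight_def by measurable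

lemma weight_nonneg [simp]: "0 \<le> weight \<sigma> \<beta> v"
  by (simp add: weight_def)

lemma integrable_powr_unit:
  fixes a :: real
  assumes "a > -1"
  shows "integrable lborel (\<lambda>v. indicator {0<..1} v * v powr a)"
proof -
  have "(\<lambda>x. x powr a) absolutely_integrable_on {0<..1}"
    by (rule nonnegative_absolutely_integrable_1[OF integrable_on_powr_from_0'[of a 1]]) (use assms in auto)
  then have "integrable lebesgue (\<lambda>v. indicator {0<..1} v * v powr a)"
    by (simp add: set_integrable_def)
  then show ?thesis by (subst (asm) integrable_completion) auto
qed

lemma integrable_powr_tail:
  fixes a :: real
  assumes "a < -1"
  shows "integrable lborel (\<lambda>v. indicator {1..} v * v powr a)"
proof -
  have "(\<lambda>x. x powr a) integrable_on {1..}"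
    using has_integral_powr_to_inf[of a 1] assms by (auto simp: integrable_on_def)
  then have "(\<lambda>x. x powr a) absolutely_integrable_on {1..}"
    by (rule nonnegative_absolutely_integrable_1) auto
  then have "integrable lebesgue (\<lambda>v. indicator {1..} v * v powr a)"
    by (simp add: set_integrable_def)
  then show ?thesis by (subst (asm) integrable_completion) auto
qed

lemma one_plus_root_le:
  fixes v :: real
  assumes "0 \<le> v"
  shows "v \<le> 1 \<Longrightarrow> (1 + v powr (1/3))\<^sup>2 \<le> 4" "1 \<le> v \<Longrightarrow> (1 + v powr (1/3))\<^sup>2 \<le> 4 * v powr (2/3)"
proof -
  assume "v \<le> 1"
  then have "v powr (1/3) \<le> 1" using assms by (intro powr_le1) auto
  then have "(1 + v powr (1/3))\<^sup>2 \<le> 2\<^sup>2" by (intro power_mono) auto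
  then show "(1 + v powr (1/3))\<^sup>2 \<le> 4" by simp
next
  assume "1 \<le> v"
  then have "1 \<le> v powr (1/3)" by (intro ge_one_powr_ge_zero) auto
  then have "(1 + v powr (1/3))\<^sup>2 \<le> (2 * v powr (1/3))\<^sup>2" by (intro power_mono) auto
  also have "\<dots> = 4 * v powr (2/3)"
    by (simp add: power_mult_distrib) (simp add: power2_eq_square flip: powr_add)
  finally show "(1 + v powr (1/3))\<^sup>2 \<le> 4 * v powr (2/3)" .
qed

text \<open>At 0 the exponent is \<beta> - \<sigma> > -1, at infinity it is 2/3 - \<sigma> < -1; the
  second condition is \<sigma> > 5/3.\<close>

lemma integrable_weight:
  assumes "5/3 < \<sigma>" "\<sigma> - 1 < \<beta>"
  shows "integrable lborel (weight \<sigma> \<beta>)"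
proof (rule Bochner_Integration.integrable_bound)
  show "integrable lborel (\<lambda>v. 4 * (indicator {0<..1} v * v powr (\<beta> - \<sigma>)) + 4 * (indicator {1..} v * v powr (2/3 - \<sigma>)))"
    using assms by (intro Bochner_Integration.integrable_add integrable_mult_right integrable_powr_unit integrable_powr_tail) auto
  show "AE v in lborel. norm (weight \<sigma> \<beta> v) \<le>
      norm (4 * (indicator {0<..1} v * v powr (\<beta> - \<sigma>)) + 4 * (indicator {1..} v * v powr (2/3 - \<sigma>)))"
  proof (intro AE_I2)
    fix v :: real
    consider "v \<le> 0" | "0 < v" "v < 1" | "1 \<le> v" by linarith
    then show "norm (weight \<sigma> \<beta> v) \<le>
      norm (4 * (indicator {0<..1} v * v powr (\<beta> - \<sigma>)) + 4 * (indicator {1..} v * v powr (2/3 - \<sigma>)))"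
    proof cases
      case 1
      then show ?thesis by (simp add: weight_def power_kernel_def)
    next
      case 2
      have "weight \<sigma> \<beta> v \<le> v powr (-\<sigma>) * 4 * v powr \<beta>"
        unfolding weight_def power_kernel_def using 2 one_plus_root_le(1)[of v]
        by (intro mult_mono) (auto simp: min_def)
      also have "\<dots> = 4 * v powr (\<beta> - \<sigma>)"
        by (simp add: powr_diff powr_minus divide_simps)
      finally show ?thesis using 2 by simp
    next
      case 3
      have "weight \<sigma> \<beta> v \<le> v powr (-\<sigma>) * (4 * v powr (2/3)) * 1"
        unfolding weight_def power_kernel_def using 3 one_plus_root_le(2)[of v]
        by (intro mult_mono) (auto simp: min_def)
      also have "\<dots> = 4 * v powr (- \<sigma> + 2/3)"
        unfolding powr_add by simp
      also have "- \<sigma> + 2/3 = 2/3 - \<sigma>" by simp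
      finally have "weight \<sigma> \<beta> v \<le> 4 * v powr (2/3 - \<sigma>)" .
      then show ?thesis using 3 by (cases "v = 1") auto
    qed
  qed
qed simp

text \<open>The rate is homogeneous of degree 2/3 and dv contributes degree 1. The factor l^\<sigma>
  is kept with the kernel so that v^(-\<sigma>) is invariant under the rescaling. With l = t^\<mu>
  the prefactor becomes 1/t.\<close>

lemma growth_scale:
  assumes "0 < l" and G0: "\<And>v. v \<le> 0 \<Longrightarrow> G v = 0"
  shows "growth G \<phi> (l * x) =
    l powr (5/3 - \<sigma>) * growth (\<lambda>v. l powr \<sigma> * G (l * v)) (\<lambda>y. \<phi> (l * y)) x"
proof -
  have "growth G \<phi> (l * x) =
      l * (\<integral>v. G (l * v) * rate (l * x) (l * v) * (\<phi> (l * x + l * v) - \<phi> (l * x)) \<partial>lborel)"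
    unfolding growth_def
    by (subst lborel_integral_real_affine[of l _ 0]) (use assms in auto)
  also have "\<dots> = l * (\<integral>v. l powr (2/3) * (G (l * v) * rate x v * (\<phi> (l * (x + v)) - \<phi> (l * x))) \<partial>lborel)"
  proof (intro arg_cong[where f="\<lambda>z. l * z"] Bochner_Integration.integral_cong refl)
    fix v
    show "G (l * v) * rate (l * x) (l * v) * (\<phi> (l * x + l * v) - \<phi> (l * x)) =
      l powr (2/3) * (G (l * v) * rate x v * (\<phi> (l * (x + v)) - \<phi> (l * x)))"
    proof (cases "v \<le> 0")
      case True
      then have "l * v \<le> 0" using assms(1) by (simp add: mult_le_0_iff)
      then show ?thesis by (simp add: G0)
    next
      case False
      then show ?thesis using assms(1) by (simp add: rate_scale algebra_simps)
    qed
  qed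
  also have "\<dots> = l powr (1 + 2/3) * (\<integral>v. G (l * v) * rate x v * (\<phi> (l * (x + v)) - \<phi> (l * x)) \<partial>lborel)"
    using assms(1) powr_mult_base[of l "2/3"] by (subst integral_mult_right_zero) simp
  also have "\<dots> = l powr (5/3 - \<sigma>) * (\<integral>v. l powr \<sigma> * (G (l * v) * rate x v * (\<phi> (l * (x + v)) - \<phi> (l * x))) \<partial>lborel)"
    using assms(1) unfolding integral_mult_right_zero by (simp flip: powr_add mult.assoc)
  finally show ?thesis by (simp add: growth_def mult.assoc)
qed

section \<open>Integrable kernels and their growth operator\<close>

locale jump_kernel =
  fixes \<sigma> C\<^sub>0 :: real and G :: "real \<Rightarrow> real"
  assumes kernel_exponent: "5/3 < \<sigma>" "\<sigma> < 2"
    and G_measurable [measurable]: "G \<in> borel_measurable borel"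
    and G_zero: "\<And>v. v \<le> 0 \<Longrightarrow> G v = 0"
    and G_nonneg [simp]: "\<And>v. 0 \<le> G v"
    and G_le: "\<And>v. G v \<le> C\<^sub>0 * power_kernel \<sigma> v"

locale integrable_jump_kernel = jump_kernel +
  assumes G_integrable: "integrable lborel G"
begin

text \<open>The jump rate at volume 1, finite because G is integrable at 0, unlike v^(-\<sigma>). By
  \<open>rate_le\<close> the product \<open>rate M 1 * total\<close> bounds the jump rate at every x
  \<le> M.\<close>

definition total :: real where
  "total = (\<integral>v. G v * (1 + v powr (1/3))\<^sup>2 \<partial>lborel)"

text \<open>Integrability of G settles v \<le> 1. For v > 1 the bound by v^(-\<sigma>) takes over,
  where the min in \<open>weight\<close> equals 1.\<close>

lemma integrable_total: "integrable lborel (\<lambda>v. G v * (1 + v powr (1/3))\<^sup>2)"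
proof (rule Bochner_Integration.integrable_bound)
  show "integrable lborel (\<lambda>v. 4 * G v + C\<^sub>0 * weight \<sigma> 1 v)"
    using kernel_exponent by (intro Bochner_Integration.integrable_add integrable_mult_right G_integrable integrable_weight) auto
  have "G v * (1 + v powr (1/3))\<^sup>2 \<le> \<bar>4 * G v + C\<^sub>0 * weight \<sigma> 1 v\<bar>" for v
  proof (cases "v \<le> 0")
    case False
    have "0 \<le> C\<^sub>0 * power_kernel \<sigma> v" using G_nonneg[of v] G_le[of v] by linarith
    then have nn: "0 \<le> C\<^sub>0 * weight \<sigma> 1 v"
      unfolding weight_def by (simp flip: mult.assoc)
    show ?thesis
    proof (cases "v \<le> 1")
      case True
      have "G v * (1 + v powr (1/3))\<^sup>2 \<le> G v * 4"
        using one_plus_root_le(1)[of v] False True by (intro mult_left_mono) auto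
      then show ?thesis using nn by linarith
    next
      case v: False
      have "G v * (1 + v powr (1/3))\<^sup>2 \<le> C\<^sub>0 * power_kernel \<sigma> v * (1 + v powr (1/3))\<^sup>2"
        by (intro mult_right_mono G_le) auto
      also have "\<dots> = C\<^sub>0 * weight \<sigma> 1 v" using v by (simp add: weight_def min_def)
      finally show ?thesis using G_nonneg[of v] by linarith
    qed
  qed (simp add: G_zero)
  then show "AE v in lborel. norm (G v * (1 + v powr (1/3))\<^sup>2) \<le> norm (4 * G v + C\<^sub>0 * weight \<sigma> 1 v)"
    by simp
qed simp

lemma total_nonneg: "0 \<le> total"
  unfolding total_def by simp

text \<open>Jumps only increase the volume, so \<phi> enters only through its values to the right of
  x. The separate bound y yields one dominating function for all x \<le> y.\<close>

lemma growth_integrand_le: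
  assumes "x \<le> y" "\<And>z. x \<le> z \<Longrightarrow> \<bar>\<phi> z\<bar> \<le> B"
  shows "\<bar>G v * rate x v * (\<phi> (x + v) - \<phi> x)\<bar> \<le> 2 * B * rate y 1 * (G v * (1 + v powr (1/3))\<^sup>2)"
proof (cases "v \<le> 0")
  case False
  have r: "rate x v \<le> rate y 1 * (1 + v powr (1/3))\<^sup>2" by (rule rate_le) (rule assms)
  have "\<bar>\<phi> (x + v) - \<phi> x\<bar> \<le> 2 * B" using assms(2)[of "x+v"] assms(2)[of x] False by simp
  then have "\<bar>G v * rate x v * (\<phi> (x + v) - \<phi> x)\<bar> \<le> G v * (rate y 1 * (1 + v powr (1/3))\<^sup>2) * (2 * B)"
    unfolding abs_mult using r by (intro mult_mono) auto
  then show ?thesis by (simp add: mult_ac)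
qed (simp add: G_zero)

lemma growth_integrable:
  assumes [measurable]: "\<phi> \<in> borel_measurable borel" and "\<And>z. x \<le> z \<Longrightarrow> \<bar>\<phi> z\<bar> \<le> B"
  shows "integrable lborel (\<lambda>v. G v * rate x v * (\<phi> (x + v) - \<phi> x))"
  using growth_integrand_le[OF order_refl, of x \<phi> B] assms
  by (intro Bochner_Integration.integrable_bound[OF integrable_mult_right[OF integrable_total, of "2 * B * rate x 1"]])
    (auto intro!: AE_I2 intro: order_trans[OF _ abs_ge_self])

lemma growth_bound:
  assumes [measurable]: "\<phi> \<in> borel_measurable borel" and "x \<le> y" "\<And>z. x \<le> z \<Longrightarrow> \<bar>\<phi> z\<bar> \<le> B"
  shows "\<bar>growth G \<phi> x\<bar> \<le> 2 * B * rate y 1 * total"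
proof -
  have "\<bar>growth G \<phi> x\<bar> \<le> (\<integral>v. 2 * B * rate y 1 * (G v * (1 + v powr (1/3))\<^sup>2) \<partial>lborel)"
    unfolding growth_def using growth_integrand_le[OF assms(2,3)] growth_integrable[OF assms(1,3)]
    by (intro integral_abs_bound[THEN order_trans] integral_mono integrable_mult_right integrable_total) auto
  then show ?thesis by (simp add: total_def)
qed

lemma growth_diff:
  assumes [measurable]: "\<phi> \<in> borel_measurable borel" "\<psi> \<in> borel_measurable borel"
    and "\<And>z. x \<le> z \<Longrightarrow> \<bar>\<phi> z\<bar> \<le> B" "\<And>z. x \<le> z \<Longrightarrow> \<bar>\<psi> z\<bar> \<le> B'"
  shows "growth G (\<lambda>z. \<phi> z - \<psi> z) x = growth G \<phi> x - growth G \<psi> x"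
proof -
  have "growth G \<phi> x - growth G \<psi> x =
      (\<integral>v. G v * rate x v * (\<phi> (x + v) - \<phi> x) - G v * rate x v * (\<psi> (x + v) - \<psi> x) \<partial>lborel)"
    unfolding growth_def
    by (rule Bochner_Integration.integral_diff[symmetric]) (rule growth_integrable[OF assms(1,3)] growth_integrable[OF assms(2,4)]; assumption)+
  also have "\<dots> = growth G (\<lambda>z. \<phi> z - \<psi> z) x"
    unfolding growth_def by (intro Bochner_Integration.integral_cong refl) (simp add: algebra_simps)
  finally show ?thesis by simp
qed

lemma growth_eq_0:
  assumes "\<And>z. z \<ge> M \<Longrightarrow> \<phi> z = 0" "x \<ge> M"
  shows "growth G \<phi> x = 0"
proof -
  have "G v * rate x v * (\<phi> (x + v) - \<phi> x) = 0" for v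
    using assms by (cases "v \<le> 0") (auto simp: G_zero)
  then show ?thesis unfolding growth_def by (simp only:) simp
qed

text \<open>The jump rate is unbounded in x, but beyond M jumps no longer change \<phi>, so the rate
  at M suffices.\<close>

lemma growth_tests_bound:
  assumes "\<phi> \<in> borel_measurable borel" "\<And>z. x \<le> z \<Longrightarrow> \<bar>\<phi> z\<bar> \<le> B" "\<And>z. z \<ge> M \<Longrightarrow> \<phi> z = 0"
  shows "\<bar>growth G \<phi> x\<bar> \<le> 2 * B * rate M 1 * total"
proof (cases "x \<le> M")
  case True
  then show ?thesis using growth_bound[OF assms(1) True assms(2)] by simp
next
  case False
  moreover have "0 \<le> B" using assms(2)[of x] by simp
  ultimately show ?thesis using growth_eq_0[of M \<phi> x] assms(3) total_nonneg by simp
qed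

lemma continuous_on_growth:
  assumes "continuous_on UNIV \<phi>" and B: "\<And>z. \<bar>\<phi> z\<bar> \<le> B"
  shows "continuous_on UNIV (growth G \<phi>)"
proof -
  have [measurable]: "\<phi> \<in> borel_measurable borel"
    using assms(1) by (rule borel_measurable_continuous_onI)
  \<comment> \<open>The rate is unbounded, so a dominating function is available only on half-lines
    bounded above.\<close>
  have "continuous_on {..<a} (growth G \<phi>)" for a
    unfolding growth_def
  proof (rule continuous_on_integral_param)
    show "integrable lborel (\<lambda>v. 2 * B * rate a 1 * (G v * (1 + v powr (1/3))\<^sup>2))"
      by (intro integrable_mult_right integrable_total)
    show "AE v in lborel. \<bar>G v * rate x v * (\<phi> (x + v) - \<phi> x)\<bar> \<le> 2 * B * rate a 1 * (G v * (1 + v powr (1/3))\<^sup>2)"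
      if "x \<in> {..<a}" for x
      using growth_integrand_le[of x a \<phi> B] B that by simp
    show "AE v in lborel. continuous_on {..<a} (\<lambda>x. G v * rate x v * (\<phi> (x + v) - \<phi> x))"
      by (intro AE_I2 continuous_intros continuous_on_rate continuous_on_compose2[OF assms(1)]) auto
  qed simp
  then have "isCont (growth G \<phi>) x" for x
    using continuous_on_eq_continuous_at[OF open_lessThan, of "x+1" "growth G \<phi>"] by auto
  then show ?thesis by (simp add: continuous_on_eq_continuous_at)
qed

text \<open>
  One step of the uniformized jump chain: \<open>growth G \<phi> = C (smoothed C \<phi> - \<phi>)\<close>. It preserves
  decreasing functions because the jump rate increases with the volume.
\<close>

definition smoothed :: "real \<Rightarrow> (real \<Rightarrow> real) \<Rightarrow> real \<Rightarrow> real" where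
  "smoothed C \<phi> x = \<phi> x + growth G \<phi> x / C"

lemma smoothed_decreasing_tests:
  assumes \<phi>: "\<phi> \<in> decreasing_tests M" and C: "rate M 1 * total \<le> C" "0 < C"
  shows "smoothed C \<phi> \<in> decreasing_tests M"
proof -
  note D = decreasing_testsD[OF \<phi>]
  have [measurable]: "\<phi> \<in> borel_measurable borel" by (rule D)
  have B: "\<bar>\<phi> z\<bar> \<le> 1" for z using D(3,4)[of z] by simp
  note int = growth_integrable[OF D(6) B]
  have "growth G \<phi> y - growth G \<phi> x \<le> C * (\<phi> x - \<phi> y)" if "x \<le> y" "x \<le> M" for x y
  proof -
    \<comment> \<open>Three effects of moving from x to y: the larger rate at y multiplies a
      nonpositive increment; the value after the jump is smaller; only the change of the value
      before the jump acts in the other direction. It is weighted by at most the jump rate at x, and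
      this is what the lower bound on C absorbs.\<close>
    have pt: "G v * rate y v * (\<phi> (y + v) - \<phi> y) - G v * rate x v * (\<phi> (x + v) - \<phi> x)
        \<le> (\<phi> x - \<phi> y) * rate M 1 * (G v * (1 + v powr (1/3))\<^sup>2)" for v
    proof (cases "v \<le> 0")
      case False
      have "G v * rate y v * (\<phi> (y + v) - \<phi> y) \<le> G v * rate x v * (\<phi> (y + v) - \<phi> y)"
        using D(2)[of y "y+v"] False rate_mono[OF \<open>x \<le> y\<close>]
        by (intro mult_right_mono_neg mult_left_mono) auto
      moreover have "G v * rate x v * (\<phi> (y + v) - \<phi> y - (\<phi> (x + v) - \<phi> x)) \<le> G v * rate x v * (\<phi> x - \<phi> y)"
        using D(2)[of "x+v" "y+v"] that by (intro mult_left_mono) auto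
      moreover have "G v * rate x v * (\<phi> x - \<phi> y) \<le> G v * (rate M 1 * (1 + v powr (1/3))\<^sup>2) * (\<phi> x - \<phi> y)"
        using D(2)[OF \<open>x \<le> y\<close>] that by (intro mult_right_mono mult_left_mono rate_le) auto
      ultimately show ?thesis by (simp add: algebra_simps)
    qed (simp add: G_zero)
    have "growth G \<phi> y - growth G \<phi> x \<le> (\<integral>v. (\<phi> x - \<phi> y) * rate M 1 * (G v * (1 + v powr (1/3))\<^sup>2) \<partial>lborel)"
      unfolding growth_def
      by (subst Bochner_Integration.integral_diff[symmetric])
        (intro int integral_mono Bochner_Integration.integrable_diff integrable_mult_right integrable_total pt)+
    also have "\<dots> = (\<phi> x - \<phi> y) * (rate M 1 * total)" by (simp add: total_def)
    also have "\<dots> \<le> (\<phi> x - \<phi> y) * C"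
      using C D(2)[OF \<open>x \<le> y\<close>] by (intro mult_left_mono) auto
    finally show ?thesis by (simp add: mult.commute)
  qed
  then have "(growth G \<phi> y - growth G \<phi> x) / C \<le> \<phi> x - \<phi> y" if "x \<le> y" "x \<le> M" for x y
    using that C(2) by (simp add: pos_divide_le_eq mult.commute)
  then have le: "smoothed C \<phi> y \<le> smoothed C \<phi> x" if "x \<le> y" "x \<le> M" for x y
    using that unfolding smoothed_def diff_divide_distrib by fastforce
  have zero: "smoothed C \<phi> x = 0" if "x \<ge> M" for x
    using growth_eq_0[OF D(5) that] D(5)[OF that] by (simp add: smoothed_def)
  have "antimono (smoothed C \<phi>)"
  proof
    fix x y :: real assume "x \<le> y"
    then show "smoothed C \<phi> y \<le> smoothed C \<phi> x"
      using le[of x y] zero[of x] zero[of y] by (cases "x \<le> M") auto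
  qed
  moreover have "continuous_on UNIV (smoothed C \<phi>)"
    unfolding smoothed_def using C(2) by (intro continuous_intros continuous_on_growth[of _ 1] D B) auto
  moreover have "smoothed C \<phi> x \<le> 1" for x
  proof -
    have le0: "G v * rate x v * (\<phi> (x + v) - \<phi> x) \<le> 0" for v
      using D(2)[of x "x+v"] by (cases "v \<le> 0") (auto simp: G_zero intro!: mult_nonneg_nonpos)
    have "0 \<le> (\<integral>v. - (G v * rate x v * (\<phi> (x + v) - \<phi> x)) \<partial>lborel)"
      by (rule Bochner_Integration.integral_nonneg) (use le0 in simp)
    then have "growth G \<phi> x \<le> 0" by (simp add: growth_def)
    then have "growth G \<phi> x / C \<le> 0" using C(2) by (simp add: divide_nonpos_pos)
    then show ?thesis using D(3)[of x] by (simp add: smoothed_def)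
  qed
  ultimately show ?thesis using zero by (simp add: decreasing_tests_def)
qed

end

subsection \<open>Decay and concentration of the profile\<close>

text \<open>Tonelli: the F-average is bounded for each jump size v separately and then integrated
  against the kernel. W is the power kernel in the concentration estimate and the distance of two
  kernels in the stability estimate. Nonnegative integrals make the exchange unconditional.\<close>

lemma integral_growth_le:
  fixes F :: "real measure"
  assumes fin: "finite_measure F" and sF: "sets F = sets borel"
    and [measurable]: "\<Phi> \<in> borel_measurable borel" "W \<in> borel_measurable borel"
    and W: "\<And>v. 0 \<le> W v" "\<And>v. v \<le> 0 \<Longrightarrow> W v = 0"
    and anti: "\<And>x y. x \<le> y \<Longrightarrow> \<Phi> y \<le> \<Phi> x"
    and b: "\<And>v. v > 0 \<Longrightarrow> (\<integral>\<^sup>+x. ennreal (rate x v * (\<Phi> x - \<Phi> (x + v))) \<partial>F) \<le> ennreal (b v)"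
    and b0: "\<And>v. 0 \<le> b v" and int: "integrable lborel (\<lambda>v. W v * b v)"
  shows "(\<integral>x. - (\<integral>v. W v * rate x v * (\<Phi> (x + v) - \<Phi> x) \<partial>lborel) \<partial>F) \<le> (\<integral>v. W v * b v \<partial>lborel)"
proof (rule integral_real_bounded)
  interpret finite_measure F by fact
  interpret pair_sigma_finite F lborel ..
  note [measurable_cong] = sF
  show "0 \<le> (\<integral>v. W v * b v \<partial>lborel)" using W b0 by simp
  have nn: "0 \<le> W v * rate x v * (\<Phi> x - \<Phi> (x + v))" for x v
    using W anti[of x "x+v"] by (cases "v \<le> 0") auto
  have "(\<integral>\<^sup>+x. ennreal (- (\<integral>v. W v * rate x v * (\<Phi> (x + v) - \<Phi> x) \<partial>lborel)) \<partial>F)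
      \<le> (\<integral>\<^sup>+x. (\<integral>\<^sup>+v. ennreal (W v * rate x v * (\<Phi> x - \<Phi> (x + v))) \<partial>lborel) \<partial>F)"
  proof (rule nn_integral_mono)
    fix x
    have eq: "- (\<integral>v. W v * rate x v * (\<Phi> (x + v) - \<Phi> x) \<partial>lborel) =
        (\<integral>v. W v * rate x v * (\<Phi> x - \<Phi> (x + v)) \<partial>lborel)"
      by (subst Bochner_Integration.integral_minus[symmetric])
        (intro Bochner_Integration.integral_cong refl, simp add: algebra_simps)
    show "ennreal (- (\<integral>v. W v * rate x v * (\<Phi> (x + v) - \<Phi> x) \<partial>lborel))
      \<le> (\<integral>\<^sup>+v. ennreal (W v * rate x v * (\<Phi> x - \<Phi> (x + v))) \<partial>lborel)"
    proof (cases "integrable lborel (\<lambda>v. W v * rate x v * (\<Phi> x - \<Phi> (x + v)))")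
      case True
      then show ?thesis unfolding eq using nn by (subst nn_integral_eq_integral) auto
    next
      \<comment> \<open>A divergent inner integral has the default value 0, so the inequality
        persists.\<close>
      case False
      then show ?thesis unfolding eq by (simp add: not_integrable_integral_eq)
    qed
  qed
  also have "\<dots> = (\<integral>\<^sup>+v. (\<integral>\<^sup>+x. ennreal (W v * rate x v * (\<Phi> x - \<Phi> (x + v))) \<partial>F) \<partial>lborel)"
    by (rule Fubini'[symmetric]) measurable
  also have "\<dots> \<le> (\<integral>\<^sup>+v. ennreal (W v * b v) \<partial>lborel)"
  proof (rule nn_integral_mono)
    fix v :: real
    show "(\<integral>\<^sup>+x. ennreal (W v * rate x v * (\<Phi> x - \<Phi> (x + v))) \<partial>F) \<le> ennreal (W v * b v)"
    proof (cases "v \<le> 0")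
      case False
      have "(\<integral>\<^sup>+x. ennreal (W v * rate x v * (\<Phi> x - \<Phi> (x + v))) \<partial>F) =
          (\<integral>\<^sup>+x. ennreal (W v) * ennreal (rate x v * (\<Phi> x - \<Phi> (x + v))) \<partial>F)"
        using W by (intro nn_integral_cong) (simp add: mult.assoc ennreal_mult')
      also have "\<dots> = ennreal (W v) * (\<integral>\<^sup>+x. ennreal (rate x v * (\<Phi> x - \<Phi> (x + v))) \<partial>F)"
        by (rule nn_integral_cmult) measurable
      also have "\<dots> \<le> ennreal (W v) * ennreal (b v)"
        using b[of v] False by (intro mult_left_mono) auto
      finally show ?thesis using W by (simp add: ennreal_mult')
    qed (simp add: W)
  qed
  also have "\<dots> = ennreal (\<integral>v. W v * b v \<partial>lborel)"
    using W b0 by (intro nn_integral_eq_integral int) auto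
  finally show "(\<integral>\<^sup>+x. ennreal (- (\<integral>v. W v * rate x v * (\<Phi> (x + v) - \<Phi> x) \<partial>lborel)) \<partial>F)
      \<le> ennreal (\<integral>v. W v * b v \<partial>lborel)" .
qed

text \<open>A trapezoid of height 1/w with plateau of half-width w and support of half-width 2 w.
  The normalisation makes the total drop of its antiderivative independent of w.\<close>

definition bump :: "real \<Rightarrow> real \<Rightarrow> real \<Rightarrow> real" where
  "bump c w y = max 0 (min 1 (2 - \<bar>y - c\<bar> / w)) / w"

lemma bump_props:
  assumes "w > 0"
  shows "0 \<le> bump c w y" "bump c w y \<le> 1 / w" "\<bar>y - c\<bar> \<le> w \<Longrightarrow> bump c w y = 1 / w"
    "2 * w \<le> \<bar>y - c\<bar> \<Longrightarrow> bump c w y = 0" "continuous_on A (bump c w)"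
proof -
  show "continuous_on A (bump c w)"
    unfolding bump_def using assms by (intro continuous_intros) auto
  show "\<bar>y - c\<bar> \<le> w \<Longrightarrow> bump c w y = 1 / w"
    using assms by (simp add: bump_def field_simps min_def)
  show "2 * w \<le> \<bar>y - c\<bar> \<Longrightarrow> bump c w y = 0"
    using assms by (auto simp: bump_def field_simps)
qed (use assms in \<open>auto simp: bump_def divide_right_mono\<close>)

text \<open>A smoothed step, constant to the left of the bump and 0 to the right. Its drop is at
  least 2, from the plateau of length 2 w, and at most 4, from the support of length 4 w.\<close>

lemma bump_antiderivative:
  assumes "w > 0"
  obtains \<Phi> where "\<And>x. (\<Phi> has_real_derivative - bump c w x) (at x)"
    "\<And>x. c + 2 * w \<le> x \<Longrightarrow> \<Phi> x = 0"
    "\<And>x y. x \<le> y \<Longrightarrow> \<Phi> y \<le> \<Phi> x"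
    "\<And>x y. x \<le> y \<Longrightarrow> \<Phi> x - \<Phi> y \<le> min ((y - x) / w) 4"
    "\<And>x. x \<le> c - w \<Longrightarrow> 2 \<le> \<Phi> x"
    "\<And>x y. x \<le> y \<Longrightarrow> y \<le> c - 2 * w \<Longrightarrow> \<Phi> x = \<Phi> y"
proof -
  note B = bump_props[OF assms, where c=c]
  obtain \<Phi> where der: "\<And>x. (\<Phi> has_real_derivative - bump c w x) (at x)"
      and zero: "\<And>x. c + 2 * w \<le> x \<Longrightarrow> \<Phi> x = 0"
    by (rule antiderivative_vanishing[of "bump c w" "c + 2 * w"]) (auto intro: B)
  have mvt: "\<exists>z. x < z \<and> z < y \<and> \<Phi> x - \<Phi> y = (y - x) * bump c w z" if "x < y" for x y
  proof -
    have "\<exists>z. x < z \<and> z < y \<and> \<Phi> y - \<Phi> x = (y - x) * - bump c w z"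
      using that by (intro MVT2 der)
    then show ?thesis by (auto simp: algebra_simps)
  qed
  have anti: "\<Phi> y \<le> \<Phi> x" if "x \<le> y" for x y
  proof (cases "x = y")
    case False
    then obtain z where "\<Phi> x - \<Phi> y = (y - x) * bump c w z" using mvt[of x y] \<open>x \<le> y\<close> by auto
    moreover have "0 \<le> (y - x) * bump c w z" using \<open>x \<le> y\<close> B(1) by simp
    ultimately show ?thesis by linarith
  qed simp
  have lip: "\<Phi> x - \<Phi> y \<le> (y - x) / w" if "x \<le> y" for x y
  proof (cases "x = y")
    case False
    then obtain z where "\<Phi> x - \<Phi> y = (y - x) * bump c w z" using mvt[of x y] \<open>x \<le> y\<close> by auto
    also have "\<dots> \<le> (y - x) * (1 / w)" using \<open>x \<le> y\<close> B(2) by (intro mult_left_mono) auto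
    finally show ?thesis by simp
  qed simp
  have left: "\<Phi> x = \<Phi> y" if "x \<le> y" "y \<le> c - 2 * w" for x y
  proof (cases "x = y")
    case False
    then obtain z where "z < y" "\<Phi> x - \<Phi> y = (y - x) * bump c w z" using mvt[of x y] \<open>x \<le> y\<close> by auto
    then show ?thesis using B(4)[of z] that by simp
  qed simp
  have top: "\<Phi> x \<le> 4" for x
  proof -
    have "\<Phi> (c - 2 * w) \<le> 4"
      using lip[of "c - 2 * w" "c + 2 * w"] zero[of "c + 2 * w"] assms by (simp add: field_simps)
    moreover have "\<Phi> x \<le> \<Phi> (c - 2 * w)"
      using left[of x "c - 2 * w"] anti[of "c - 2 * w" x] by linarith
    ultimately show ?thesis by linarith
  qed
  have nonneg: "0 \<le> \<Phi> x" for x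
    using anti[of x "max x (c + 2 * w)"] zero[of "max x (c + 2 * w)"] by simp
  have two: "2 \<le> \<Phi> x" if "x \<le> c - w" for x
  proof -
    obtain z where "c - w < z" "z < c + w" "\<Phi> (c - w) - \<Phi> (c + w) = (c + w - (c - w)) * bump c w z"
      using mvt[of "c - w" "c + w"] assms by auto
    then have "\<Phi> (c - w) - \<Phi> (c + w) = 2" using B(3)[of z] assms by (simp add: abs_le_iff)
    then show ?thesis using nonneg[of "c + w"] anti[OF that] by linarith
  qed
  have key: "\<Phi> x - \<Phi> y \<le> min ((y - x) / w) 4" if "x \<le> y" for x y
    using lip[OF that] top[of x] nonneg[of y] by simp
  show ?thesis by (rule that[OF der zero anti key two left])
qed

text \<open>Here v is the width of a bump and \<eta> the size of a jump. The left side bounds the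
  increment of the smoothed step times the mass of a window of length 4 v + \<eta>. The right side
  gains the power \<eta>^\<beta>, to be integrated against \<eta>^(-\<sigma>), at the price
  v^(\<alpha> - \<beta>). For \<eta> \<le> 1 division by v^\<alpha> reduces the claim to one in r =
  \<eta> / v; for \<eta> > 1 the right side is at least 32 and the left at most 4.\<close>

lemma bump_interpolation:
  fixes \<alpha> \<beta> v \<eta> :: real
  assumes "0 \<le> \<alpha>" "\<alpha> \<le> \<beta>" "\<beta> \<le> 1" "0 < v" "v \<le> 1" "0 < \<eta>"
  shows "min (\<eta> / v) 4 * min 1 ((4 * v + \<eta>) powr \<alpha>) \<le> 32 * v powr (\<alpha> - \<beta>) * min 1 (\<eta> powr \<beta>)"
proof (cases "\<eta> \<le> 1")
  case True
  define r where "r = \<eta> / v"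
  have r: "0 < r" "\<eta> = r * v" using assms by (auto simp: r_def)
  have key: "min r 4 * (4 + r) powr \<alpha> \<le> 32 * r powr \<beta>"
  proof (cases "r \<le> 4")
    case True
    have "r = r powr (1 - \<beta>) * r powr \<beta>" using r by (simp flip: powr_add)
    also have "\<dots> \<le> 4 powr (1 - \<beta>) * r powr \<beta>"
      using r True assms by (intro mult_right_mono powr_mono2) auto
    also have "\<dots> \<le> 4 powr 1 * r powr \<beta>"
      using assms by (intro mult_right_mono powr_mono) auto
    finally have 1: "r \<le> 4 * r powr \<beta>" by simp
    have "(4 + r) powr \<alpha> \<le> 8 powr \<alpha>" using True r assms by (intro powr_mono2) auto
    also have "\<dots> \<le> 8 powr 1" using assms by (intro powr_mono) auto
    finally have 2: "(4 + r) powr \<alpha> \<le> 8" by simp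
    have "min r 4 * (4 + r) powr \<alpha> \<le> (4 * r powr \<beta>) * 8"
      using 1 2 r True by (intro mult_mono) auto
    then show ?thesis by simp
  next
    case False
    have "(4 + r) powr \<alpha> \<le> (2 * r) powr \<alpha>" using False r assms by (intro powr_mono2) auto
    also have "\<dots> = 2 powr \<alpha> * r powr \<alpha>" using r by (simp add: powr_mult)
    also have "\<dots> \<le> 2 powr 1 * r powr \<beta>" using assms False by (intro mult_mono powr_mono) auto
    finally have "min r 4 * (4 + r) powr \<alpha> \<le> 4 * (2 * r powr \<beta>)"
      using False by (intro mult_mono) auto
    also have "\<dots> \<le> 32 * r powr \<beta>" by simp
    finally show ?thesis .
  qed
  have "min (\<eta> / v) 4 * min 1 ((4 * v + \<eta>) powr \<alpha>) \<le> min r 4 * ((4 + r) * v) powr \<alpha>"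
    unfolding r_def[symmetric] using r by (intro mult_left_mono) (auto simp: algebra_simps)
  also have "\<dots> = (min r 4 * (4 + r) powr \<alpha>) * v powr \<alpha>" using r assms by (simp add: powr_mult)
  also have "\<dots> \<le> (32 * r powr \<beta>) * v powr \<alpha>" by (intro mult_right_mono key) auto
  also have "\<dots> = 32 * v powr (\<alpha> - \<beta>) * \<eta> powr \<beta>"
    using r assms by (simp add: powr_mult powr_diff)
  also have "\<eta> powr \<beta> = min 1 (\<eta> powr \<beta>)"
    using True assms powr_le1[of \<beta> \<eta>] by (simp add: min_def)
  finally show ?thesis .
next
  case False
  have "v powr 0 \<le> v powr (\<alpha> - \<beta>)" using assms by (intro powr_mono') auto
  then have "1 \<le> v powr (\<alpha> - \<beta>)" using assms by simp
  moreover have "min 1 (\<eta> powr \<beta>) = 1" using False assms ge_one_powr_ge_zero[of \<eta> \<beta>] by (simp add: min_def)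
  moreover have "min (\<eta> / v) 4 * min 1 ((4 * v + \<eta>) powr \<alpha>) \<le> 4 * 1"
    using assms by (intro mult_mono) auto
  ultimately show ?thesis by simp
qed

text \<open>Small jumps have infinite total rate under the power kernel, so boundedness of \<Phi>
  does not suffice. The bound L min 1 (y - x) joins a Lipschitz estimate to one for the oscillation
  and produces the integrable \<open>weight \<sigma> 1\<close>.\<close>

lemma power_growth_bounded:
  assumes sigma: "5/3 < \<sigma>" "\<sigma> < 2" and [measurable]: "\<Phi> \<in> borel_measurable borel"
    and lip: "\<And>x y. x \<le> y \<Longrightarrow> \<bar>\<Phi> y - \<Phi> x\<bar> \<le> L * min 1 (y - x)"
    and zero: "\<And>x. x \<ge> M \<Longrightarrow> \<Phi> x = 0" and "0 \<le> L"
  shows "integrable lborel (\<lambda>v. power_kernel \<sigma> v * rate x v * (\<Phi> (x + v) - \<Phi> x))"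
    and "\<bar>growth (power_kernel \<sigma>) \<Phi> x\<bar> \<le> L * rate M 1 * (\<integral>v. weight \<sigma> 1 v \<partial>lborel)"
    and "growth (power_kernel \<sigma>) \<Phi> \<in> borel_measurable borel"
proof -
  have pt: "\<bar>power_kernel \<sigma> v * rate x v * (\<Phi> (x + v) - \<Phi> x)\<bar> \<le> L * rate M 1 * weight \<sigma> 1 v" for v
  proof (cases "v > 0 \<and> x < M")
    case True
    have "\<bar>power_kernel \<sigma> v * rate x v * (\<Phi> (x + v) - \<Phi> x)\<bar>
        \<le> power_kernel \<sigma> v * (rate M 1 * (1 + v powr (1/3))\<^sup>2) * (L * min 1 v)"
      unfolding abs_mult using True rate_le[of x M v] lip[of x "x+v"] by (intro mult_mono) auto
    also have "\<dots> = L * rate M 1 * weight \<sigma> 1 v" using True by (simp add: weight_def)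
    finally show ?thesis .
  next
    case False
    then have "power_kernel \<sigma> v * rate x v * (\<Phi> (x + v) - \<Phi> x) = 0"
      by (cases "v > 0") (auto simp: zero power_kernel_def)
    then show ?thesis using \<open>0 \<le> L\<close> by (simp only:) simp
  qed
  have iw: "integrable lborel (\<lambda>v. L * rate M 1 * weight \<sigma> 1 v)"
    using sigma by (intro integrable_mult_right integrable_weight) auto
  show int: "integrable lborel (\<lambda>v. power_kernel \<sigma> v * rate x v * (\<Phi> (x + v) - \<Phi> x))"
    by (rule Bochner_Integration.integrable_bound[OF iw])
      (use pt in \<open>auto intro!: AE_I2 intro: order_trans[OF _ abs_ge_self]\<close>)
  have "\<bar>growth (power_kernel \<sigma>) \<Phi> x\<bar> \<le> (\<integral>v. L * rate M 1 * weight \<sigma> 1 v \<partial>lborel)"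
    unfolding growth_def using pt int
    by (intro integral_abs_bound[THEN order_trans] integral_mono iw) auto
  then show "\<bar>growth (power_kernel \<sigma>) \<Phi> x\<bar> \<le> L * rate M 1 * (\<integral>v. weight \<sigma> 1 v \<partial>lborel)"
    by simp
  show "growth (power_kernel \<sigma>) \<Phi> \<in> borel_measurable borel"
    unfolding growth_def[abs_def] by measurable
qed

text \<open>The profile on the real line, with its equation tested against C^1 functions. Writing
  \<Phi>' = -g makes both sides nonnegative for decreasing \<Phi>: drift on the left, jumps on the
  right. That a self-similar profile has these properties is shown in
  \<open>profile_of_self_similar\<close>.\<close>

locale profile = finite_measure F for F :: "real measure" +
  fixes \<sigma> \<mu> :: real
  assumes sigma: "5/3 < \<sigma>" "\<sigma> < 2" and mu: "\<mu> = inverse (\<sigma> - 5/3)"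
    and sets_F [measurable_cong]: "sets F = sets borel"
    and mass: "measure F UNIV = 1"
    and support: "AE x in F. 0 \<le> x"
    and stationary: "\<And>g \<Phi> M. continuous_on UNIV g \<Longrightarrow> (\<And>x. x \<ge> M \<Longrightarrow> g x = 0) \<Longrightarrow>
      (\<And>x. (\<Phi> has_real_derivative - g x) (at x)) \<Longrightarrow> (\<And>x. x \<ge> M \<Longrightarrow> \<Phi> x = 0) \<Longrightarrow>
      \<mu> * (\<integral>x. x * g x \<partial>F) = (\<integral>x. - growth (power_kernel \<sigma>) \<Phi> x \<partial>F)"
begin

lemma mu_pos: "0 < \<mu>" "\<mu> * (\<sigma> - 5/3) = 1"
  using sigma mu by auto

lemma measure_F_le_1: "measure F A \<le> 1"
  using mass bounded_measure[of A] sets_eq_imp_space_eq[OF sets_F] by simp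

lemma growth_nonneg:
  assumes "\<And>x y. x \<le> y \<Longrightarrow> \<Phi> y \<le> \<Phi> x"
  shows "0 \<le> - growth (power_kernel \<sigma>) \<Phi> y"
proof -
  have "0 \<le> - (power_kernel \<sigma> v * rate y v * (\<Phi> (y + v) - \<Phi> y))" for v
    using assms[of y "y + v"] by (cases "v > 0") (auto intro!: mult_nonneg_nonpos simp: power_kernel_def)
  then have "0 \<le> (\<integral>v. - (power_kernel \<sigma> v * rate y v * (\<Phi> (y + v) - \<Phi> y)) \<partial>lborel)"
    by (rule Bochner_Integration.integral_nonneg)
  then show ?thesis by (simp add: growth_def)
qed

lemma bump_lipschitz:
  assumes "w > 0" and "\<And>x y. x \<le> y \<Longrightarrow> \<Phi> y \<le> \<Phi> x"
    and "\<And>x y. x \<le> y \<Longrightarrow> \<Phi> x - \<Phi> y \<le> min ((y - x) / w) 4" and "x \<le> (y::real)"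
  shows "\<bar>\<Phi> y - \<Phi> x\<bar> \<le> (4 + 1 / w) * min 1 (y - x)"
proof (cases "y - x \<le> 1")
  case True
  have "(y - x) / w \<le> (4 + 1 / w) * (y - x)" using assms by (simp add: field_simps)
  then show ?thesis using assms(2,3)[OF assms(4)] True by simp
next
  case False
  have "0 \<le> 1 / w" using assms by simp
  moreover have "\<Phi> x - \<Phi> y \<le> 4" using assms(3)[OF assms(4)] by simp
  ultimately have "\<Phi> x - \<Phi> y \<le> 4 + 1 / w" by linarith
  then show ?thesis using assms(2)[OF assms(4)] False by simp
qed

text \<open>Below \<open>x\<close> the jumps of size about \<open>x\<close> have total rate of order \<open>x\<^bsup>5/3-\<sigma>\<^esup>\<close>.\<close>

lemma decay_step:
  assumes "x > 0"
  shows "measure F {..x} \<le> 6 * \<mu> * (6 * x) powr (\<sigma> - 5/3) * measure F {..3 * x}"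
proof -
  \<comment> \<open>A bump centred at 2 x with this width lives on [x, 3 x]; its antiderivative is
    at least 2 on volumes up to x and 0 from 3 x on. The drift integrand is at most 3 x (2 / x) =
    6.\<close>
  define w where "w = x / 2"
  have w: "w > 0" using assms by (simp add: w_def)
  note B = bump_props[OF w, where c = "2 * x"]
  obtain \<Phi> where \<Phi>: "\<And>y. (\<Phi> has_real_derivative - bump (2 * x) w y) (at y)"
    "\<And>y. 2 * x + 2 * w \<le> y \<Longrightarrow> \<Phi> y = 0"
    "\<And>y z. y \<le> z \<Longrightarrow> \<Phi> z \<le> \<Phi> y"
    "\<And>y z. y \<le> z \<Longrightarrow> \<Phi> y - \<Phi> z \<le> min ((z - y) / w) 4"
    "\<And>y. y \<le> 2 * x - w \<Longrightarrow> 2 \<le> \<Phi> y"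
    by (rule bump_antiderivative[OF w, of "2 * x"]) blast
  have [measurable]: "\<Phi> \<in> borel_measurable borel" by (rule continuous_on_of_DERIV(2)[OF \<Phi>(1)])
  have [measurable]: "bump (2 * x) w \<in> borel_measurable borel"
    by (rule borel_measurable_continuous_onI[OF B(5)])
  have zero: "bump (2 * x) w y = 0" if "3 * x \<le> y" for y
    using B(4)[of y] that assms by (auto simp: w_def abs_if)
  have eq: "\<mu> * (\<integral>y. y * bump (2 * x) w y \<partial>F) = (\<integral>y. - growth (power_kernel \<sigma>) \<Phi> y \<partial>F)"
    using zero \<Phi>(1,2) by (intro stationary[of _ "3 * x"] B(5)) (auto simp: w_def)
  have lip: "\<bar>\<Phi> z - \<Phi> y\<bar> \<le> (4 + 1 / w) * min 1 (z - y)" if "y \<le> z" for y z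
    by (rule bump_lipschitz[OF w \<Phi>(3,4) that])
  have w4: "0 \<le> 4 + 1 / w" using w by simp
  have m\<Phi>: "\<Phi> \<in> borel_measurable borel" by measurable
  note PG = power_growth_bounded[OF sigma m\<Phi> lip \<Phi>(2) w4]
  have "(\<integral>y. y * bump (2 * x) w y \<partial>F) \<le> (\<integral>y. 6 * indicat_real {..3 * x} y \<partial>F)"
  proof (rule integral_mono_AE')
    show "integrable F (\<lambda>y. 6 * indicat_real {..3 * x} y)"
      by (intro integrable_mult_right integrable_real_indicator) (auto simp: less_top[symmetric])
    show "AE y in F. y * bump (2 * x) w y \<le> 6 * indicat_real {..3 * x} y"
      using support
    proof eventually_elim
      case (elim y)
      show ?case
      proof (cases "y \<le> 3 * x")
        case True
        then have "y * bump (2 * x) w y \<le> (3 * x) * (1 / w)" using elim B(1,2) by (intro mult_mono) auto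
        also have "\<dots> = 6" using assms by (simp add: w_def)
        finally show ?thesis using True by simp
      qed (simp add: zero)
    qed
  qed simp
  also have "\<dots> = 6 * measure F {..3 * x}"
    by (simp add: sets_eq_imp_space_eq[OF sets_F])
  finally have upper: "(\<integral>y. y * bump (2 * x) w y \<partial>F) \<le> 6 * measure F {..3 * x}" .
  have "(\<integral>y. (6 * x) powr (5/3 - \<sigma>) * indicator {..x} y \<partial>F) \<le> (\<integral>y. - growth (power_kernel \<sigma>) \<Phi> y \<partial>F)"
  proof (rule integral_mono_AE')
    show "integrable F (\<lambda>y. - growth (power_kernel \<sigma>) \<Phi> y)"
      using PG(2,3)
      by (intro integrable_const_bound[where B="(4 + 1 / w) * rate (2 * x + 2 * w) 1 * (\<integral>v. weight \<sigma> 1 v \<partial>lborel)"]) auto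
    show "AE y in F. (6 * x) powr (5/3 - \<sigma>) * indicator {..x} y \<le> - growth (power_kernel \<sigma>) \<Phi> y"
      using support
    proof eventually_elim
      case (elim y)
      show ?case
      proof (cases "y \<le> x")
        case True
        \<comment> \<open>Jumps of size v in [3 x, 6 x] carry every y in [0, x] past 3 x. This
          interval has length 3 x, the decrement is at least 2, and the jump density on it is at
          least (6 x)^(2/3 - \<sigma>).\<close>
        have "(6 * x) powr (5/3 - \<sigma>) = 3 * x * (2 * (6 * x) powr (2/3 - \<sigma>))"
          using assms powr_mult_base[of "6 * x" "2/3 - \<sigma>"] by (simp add: algebra_simps)
        also have "\<dots> = (\<integral>v. indicator {3 * x..6 * x} v * (2 * (6 * x) powr (2/3 - \<sigma>)) \<partial>lborel)"
          using assms by simp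
        also have "\<dots> \<le> (\<integral>v. - (power_kernel \<sigma> v * rate y v * (\<Phi> (y + v) - \<Phi> y)) \<partial>lborel)"
        proof (rule integral_mono)
          show "integrable lborel (\<lambda>v. indicator {3 * x..6 * x} v * (2 * (6 * x) powr (2/3 - \<sigma>)))"
            by (intro integrable_mult_left integrable_real_indicator) (use assms in \<open>auto simp: ennreal_less_top\<close>)
          show "integrable lborel (\<lambda>v. - (power_kernel \<sigma> v * rate y v * (\<Phi> (y + v) - \<Phi> y)))"
            using PG(1) by simp
          fix v
          show "indicator {3 * x..6 * x} v * (2 * (6 * x) powr (2/3 - \<sigma>)) \<le>
            - (power_kernel \<sigma> v * rate y v * (\<Phi> (y + v) - \<Phi> y))"
          proof (cases "v \<in> {3 * x..6 * x}")
            case in_int: True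
            have "(6 * x) powr (2/3 - \<sigma>) \<le> v powr (2/3 - \<sigma>)"
              using in_int assms sigma by (intro powr_mono2') auto
            also have "\<dots> = power_kernel \<sigma> v * v powr (2/3)"
              using in_int assms by (simp add: power_kernel_def flip: powr_add)
            also have "\<dots> \<le> power_kernel \<sigma> v * rate y v"
              by (intro mult_left_mono rate_ge) auto
            finally have "(6 * x) powr (2/3 - \<sigma>) * 2 \<le> power_kernel \<sigma> v * rate y v * \<Phi> y"
              using \<Phi>(5)[of y] True assms by (intro mult_mono) (auto simp: w_def)
            moreover have "\<Phi> (y + v) = 0" using in_int elim by (intro \<Phi>(2)) (auto simp: w_def)
            ultimately show ?thesis using in_int by simp
          next
            case False
            have "power_kernel \<sigma> v * rate y v * (\<Phi> (y + v) - \<Phi> y) \<le> 0"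
              using \<Phi>(3)[of y "y + v"] by (cases "v > 0") (auto intro!: mult_nonneg_nonpos simp: power_kernel_def)
            then show ?thesis using False by simp
          qed
        qed
        also have "\<dots> = - growth (power_kernel \<sigma>) \<Phi> y" by (simp add: growth_def)
        finally show ?thesis using True by simp
      qed (use growth_nonneg[OF \<Phi>(3)] in simp)
    qed
  qed (use growth_nonneg[OF \<Phi>(3)] in simp)
  then have "(6 * x) powr (5/3 - \<sigma>) * measure F {..x} \<le> \<mu> * (6 * measure F {..3 * x})"
    using eq upper mu_pos(1) mult_left_mono[OF upper, of \<mu>] by (simp add: sets_eq_imp_space_eq[OF sets_F])
  then have "(6 * x) powr (\<sigma> - 5/3) * ((6 * x) powr (5/3 - \<sigma>) * measure F {..x})
      \<le> (6 * x) powr (\<sigma> - 5/3) * (\<mu> * (6 * measure F {..3 * x}))"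
    by (intro mult_left_mono) auto
  then show ?thesis using assms by (simp add: mult_ac flip: mult.assoc powr_add)
qed

text \<open>Each use of \<open>decay_step\<close> gains the exponent \<sigma> - 5/3 at the cost of a
  dilation by 3 and a larger constant, so F decays at 0 faster than any power.\<close>

lemma decay:
  shows "\<exists>K\<ge>0. \<forall>x>0. measure F {..x} \<le> K * x powr (real n * (\<sigma> - 5/3))"
proof (induction n)
  case 0
  show ?case by (rule exI[of _ 1]) (auto intro: measure_F_le_1)
next
  case (Suc n)
  then obtain K where K: "K \<ge> 0" "\<And>x. x > 0 \<Longrightarrow> measure F {..x} \<le> K * x powr (real n * (\<sigma> - 5/3))"
    by auto
  define K' where "K' = 6 * \<mu> * 6 powr (\<sigma> - 5/3) * K * 3 powr (real n * (\<sigma> - 5/3))"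
  have "measure F {..x} \<le> K' * x powr (real (Suc n) * (\<sigma> - 5/3))" if "x > 0" for x
  proof -
    have "measure F {..x} \<le> 6 * \<mu> * (6 * x) powr (\<sigma> - 5/3) * measure F {..3 * x}"
      by (rule decay_step[OF that])
    also have "\<dots> \<le> 6 * \<mu> * (6 * x) powr (\<sigma> - 5/3) * (K * (3 * x) powr (real n * (\<sigma> - 5/3)))"
      using that mu_pos K by (intro mult_left_mono K(2)) auto
    also have "\<dots> = K' * (x powr (\<sigma> - 5/3) * x powr (real n * (\<sigma> - 5/3)))"
      using that by (simp add: K'_def powr_mult)
    also have "x powr (\<sigma> - 5/3) * x powr (real n * (\<sigma> - 5/3)) = x powr (real (Suc n) * (\<sigma> - 5/3))"
      by (simp add: distrib_right flip: powr_add)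
    finally show ?thesis .
  qed
  moreover have "0 \<le> K'" using K mu_pos by (simp add: K'_def)
  ultimately show ?case by blast
qed

text \<open>The profile equation tested with a bump of width v around [x, x + v]. The drift sees the
  plateau. On the jump side, a jump \<eta> changes \<Phi> by at most min (\<eta> / v) 4, and only
  from starting points in a window of length 4 v + \<eta>, whose mass is controlled by the exponent
  \<alpha> already known.\<close>

lemma stationary_bump_le:
  assumes "0 < v" "v \<le> 1" "0 < x" "x \<le> B" "0 \<le> \<alpha>" "\<alpha> \<le> \<beta>" "\<sigma> - 1 < \<beta>" "\<beta> \<le> 1" "1 \<le> C"
    and conc: "\<And>x v. 0 \<le> x \<Longrightarrow> x \<le> B \<Longrightarrow> 0 < v \<Longrightarrow> measure F {x..x + v} \<le> C * v powr \<alpha>"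
  shows "\<mu> * (x / v * measure F {x..x + v}) \<le>
    rate (B + 3) 1 * (32 * C * v powr (\<alpha> - \<beta>)) * (\<integral>\<eta>. weight \<sigma> \<beta> \<eta> \<partial>lborel)"
proof -
  define c where "c = x + v / 2"
  note B = bump_props[OF \<open>0 < v\<close>, where c = c]
  obtain \<Phi> where \<Phi>: "\<And>y. (\<Phi> has_real_derivative - bump c v y) (at y)"
    "\<And>y. c + 2 * v \<le> y \<Longrightarrow> \<Phi> y = 0"
    "\<And>y z. y \<le> z \<Longrightarrow> \<Phi> z \<le> \<Phi> y"
    "\<And>y z. y \<le> z \<Longrightarrow> \<Phi> y - \<Phi> z \<le> min ((z - y) / v) 4"
    "\<And>y z. y \<le> z \<Longrightarrow> z \<le> c - 2 * v \<Longrightarrow> \<Phi> y = \<Phi> z"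
    by (rule bump_antiderivative[OF \<open>0 < v\<close>, of c]) blast
  have [measurable]: "\<Phi> \<in> borel_measurable borel" by (rule continuous_on_of_DERIV(2)[OF \<Phi>(1)])
  have [measurable]: "bump c v \<in> borel_measurable borel"
    by (rule borel_measurable_continuous_onI[OF B(5)])
  have zero: "bump c v y = 0" if "c + 2 * v \<le> y" for y
    using B(4)[of y] that by simp
  have eq: "\<mu> * (\<integral>y. y * bump c v y \<partial>F) = (\<integral>y. - growth (power_kernel \<sigma>) \<Phi> y \<partial>F)"
    by (rule stationary[OF B(5) zero \<Phi>(1,2)])
  \<comment> \<open>Starting points with a nonzero decrement satisfy y \<le> x + v/2 + 2 v \<le> B +
    3, because v \<le> 1.\<close>
  define R where "R = rate (B + 3) 1"
  define b where "b \<eta> = R * (32 * C * v powr (\<alpha> - \<beta>)) * ((1 + \<eta> powr (1/3))\<^sup>2 * min 1 (\<eta> powr \<beta>))" for \<eta>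
  have [measurable]: "b \<in> borel_measurable borel" unfolding b_def by measurable
  have pw: "power_kernel \<sigma> \<eta> * b \<eta> = R * (32 * C * v powr (\<alpha> - \<beta>)) * weight \<sigma> \<beta> \<eta>" for \<eta>
    by (simp add: b_def weight_def)
  have iw: "integrable lborel (weight \<sigma> \<beta>)" using sigma assms by (intro integrable_weight) auto
  have "(\<integral>y. x / v * indicat_real {x..x + v} y \<partial>F) \<le> (\<integral>y. y * bump c v y \<partial>F)"
  proof (rule integral_mono_AE')
    show "integrable F (\<lambda>y. y * bump c v y)"
    proof (rule integrable_const_bound[where B="(c + 2 * v) * (1 / v)"])
      show "AE y in F. norm (y * bump c v y) \<le> (c + 2 * v) * (1 / v)"
        using support
      proof eventually_elim
        case (elim y)
        show ?case
        proof (cases "y \<le> c + 2 * v")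
          case True
          then have "y * bump c v y \<le> (c + 2 * v) * (1 / v)" using elim B(1,2) by (intro mult_mono) auto
          then show ?thesis using elim B(1)[of y] by simp
        next
          case False
          then show ?thesis using zero[of y] assms by (simp add: c_def)
        qed
      qed
    qed measurable
    show "AE y in F. x / v * indicat_real {x..x + v} y \<le> y * bump c v y"
      using support
    proof eventually_elim
      case (elim y)
      show ?case
      proof (cases "y \<in> {x..x + v}")
        case True
        then have "bump c v y = 1 / v" by (intro B(3)) (auto simp: c_def abs_le_iff)
        then show ?thesis using True assms by (simp add: divide_right_mono)
      next
        case False
        then show ?thesis using elim B(1)[of y] by simp
      qed
    qed
    show "AE y in F. 0 \<le> y * bump c v y"
      using support by eventually_elim (simp add: B(1))
  qed
  then have "\<mu> * (x / v * measure F {x..x + v}) \<le> \<mu> * (\<integral>y. y * bump c v y \<partial>F)"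
    using mu_pos by (intro mult_left_mono) (auto simp: sets_eq_imp_space_eq[OF sets_F])
  also have "\<dots> \<le> (\<integral>\<eta>. power_kernel \<sigma> \<eta> * b \<eta> \<partial>lborel)"
    unfolding eq growth_def
  proof (rule integral_growth_le[OF finite_measure_axioms sets_F])
    show "integrable lborel (\<lambda>\<eta>. power_kernel \<sigma> \<eta> * b \<eta>)"
      unfolding pw by (intro integrable_mult_right iw)
    show "0 \<le> b \<eta>" for \<eta> using assms by (simp add: b_def R_def)
    show "(\<integral>\<^sup>+y. ennreal (rate y \<eta> * (\<Phi> y - \<Phi> (y + \<eta>))) \<partial>F) \<le> ennreal (b \<eta>)" if "\<eta> > 0" for \<eta>
    proof -
      \<comment> \<open>The window is cut at 0 because the known concentration bound is stated for
        left end points in [0, B]; F charges nothing below 0.\<close>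
      define A where "A = {max 0 (c - 2 * v - \<eta>)..max 0 (c - 2 * v - \<eta>) + (4 * v + \<eta>)}"
      define k where "k = R * (1 + \<eta> powr (1/3))\<^sup>2 * min (\<eta> / v) 4"
      have k0: "0 \<le> k" using assms that by (simp add: k_def R_def)
      have "(\<integral>\<^sup>+y. ennreal (rate y \<eta> * (\<Phi> y - \<Phi> (y + \<eta>))) \<partial>F) \<le> (\<integral>\<^sup>+y. ennreal k * indicator A y \<partial>F)"
      proof (rule nn_integral_mono_AE)
        show "AE y in F. ennreal (rate y \<eta> * (\<Phi> y - \<Phi> (y + \<eta>))) \<le> ennreal k * indicator A y"
          using support
        proof eventually_elim
          case (elim y)
          consider "y > c + 2 * v" | "y + \<eta> < c - 2 * v" | "y \<le> c + 2 * v" "c - 2 * v \<le> y + \<eta>" by linarith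
          then show ?case
          proof cases
            case 1
            then show ?thesis using \<Phi>(2)[of y] \<Phi>(2)[of "y + \<eta>"] that by simp
          next
            case 2
            then show ?thesis using \<Phi>(5)[of y "y + \<eta>"] that by simp
          next
            case 3
            then have "y \<in> A" using elim by (auto simp: A_def)
            have "y \<le> B + 3" using 3 assms by (simp add: c_def)
            then have "rate y \<eta> * (\<Phi> y - \<Phi> (y + \<eta>)) \<le> (R * (1 + \<eta> powr (1/3))\<^sup>2) * min (\<eta> / v) 4"
              unfolding R_def using \<Phi>(4)[of y "y + \<eta>"] \<Phi>(3)[of y "y + \<eta>"] that
              by (intro mult_mono rate_le) auto
            then show ?thesis using \<open>y \<in> A\<close> by (simp add: k_def ennreal_leI)
          qed
        qed
      qed
      also have "\<dots> = ennreal (k * measure F A)"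
        using k0 by (simp add: A_def nn_integral_cmult_indicator emeasure_eq_measure ennreal_mult)
      also have "\<dots> \<le> ennreal (b \<eta>)"
      proof (rule ennreal_leI)
        have "measure F A \<le> C * (4 * v + \<eta>) powr \<alpha>"
          unfolding A_def using assms that by (intro conc) (auto simp: c_def)
        moreover have "measure F A \<le> C * 1" using measure_F_le_1[of A] \<open>1 \<le> C\<close> by simp
        ultimately have "measure F A \<le> C * min 1 ((4 * v + \<eta>) powr \<alpha>)"
          by (simp add: min_def)
        then have "k * measure F A \<le> k * (C * min 1 ((4 * v + \<eta>) powr \<alpha>))"
          using k0 by (rule mult_left_mono)
        also have "\<dots> = R * (1 + \<eta> powr (1/3))\<^sup>2 * C * (min (\<eta> / v) 4 * min 1 ((4 * v + \<eta>) powr \<alpha>))"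
          by (simp add: k_def)
        also have "\<dots> \<le> R * (1 + \<eta> powr (1/3))\<^sup>2 * C * (32 * v powr (\<alpha> - \<beta>) * min 1 (\<eta> powr \<beta>))"
          using assms that by (intro mult_left_mono bump_interpolation) (auto simp: R_def)
        finally show "k * measure F A \<le> b \<eta>" by (simp add: b_def mult_ac)
      qed
      finally show ?thesis .
    qed
  qed (auto simp: power_kernel_def \<Phi>(3))
  finally show ?thesis by (simp add: pw R_def)
qed

text \<open>The condition C \<ge> 1 lets the trivial bound by the total mass 1 share the constant.
  The constant depends on B through the rate, which grows with the volume.\<close>

definition concentration_exponent :: "real \<Rightarrow> real \<Rightarrow> bool" where
  "concentration_exponent B \<alpha> \<longleftrightarrow>
     (\<exists>C\<ge>1. \<forall>x v. 0 \<le> x \<longrightarrow> x \<le> B \<longrightarrow> 0 < v \<longrightarrow> measure F {x..x + v} \<le> C * v powr \<alpha>)"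

text \<open>
  Against a bump of width \<open>v\<close> at \<open>x\<close>, the drift term of the profile equation is of order
  \<open>x F[x, x + v] / v\<close>. This gains an exponent unless \<open>x\<close> is smaller than a power of \<open>v\<close>, where
  \<open>F\<close> decays faster than any power.
\<close>

lemma concentration_exponent_step:
  assumes \<alpha>: "0 \<le> \<alpha>" "\<alpha> \<le> \<sigma> - 1" and conc: "concentration_exponent B \<alpha>"
  shows "concentration_exponent B (\<alpha> + (2 - \<sigma>) / 3)"
proof -
  \<comment> \<open>The margin 2 - \<sigma> is split into three equal parts: one lifts \<beta> above
    \<sigma> - 1, one pays for the lower bound x > v^d in the drift, and one is the gain. Indeed 1 -
    d + (\<alpha> - \<beta>) = \<alpha> + (2 - \<sigma>) - 2 d = \<alpha> + d.\<close>
  define d where "d = (2 - \<sigma>) / 3"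
  define \<beta> where "\<beta> = \<sigma> - 1 + d"
  have d: "0 < d" "d \<le> 1" using sigma by (auto simp: d_def)
  have \<beta>: "\<alpha> \<le> \<beta>" "\<sigma> - 1 < \<beta>" "\<beta> \<le> 1" using sigma \<alpha> by (auto simp: \<beta>_def d_def field_simps)
  obtain C where C: "C \<ge> 1"
      "\<And>x v. 0 \<le> x \<Longrightarrow> x \<le> B \<Longrightarrow> 0 < v \<Longrightarrow> measure F {x..x + v} \<le> C * v powr \<alpha>"
    using conc by (auto simp: concentration_exponent_def)
  define e where "e = (\<sigma> - 5/3) * d"
  have "0 < e" using d sigma by (simp add: e_def)
  \<comment> \<open>This order of decay is high enough for F to have mass of order at most
    v^(\<alpha> + d) on [0, 2 v^d].\<close>
  obtain n :: nat where "(\<alpha> + d) / e \<le> real n" using real_arch_simple by blast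
  then have n: "\<alpha> + d \<le> real n * (\<sigma> - 5/3) * d"
    using \<open>0 < e\<close> by (simp add: pos_divide_le_eq e_def mult.assoc)
  obtain K where K: "K \<ge> 0" "\<And>x. x > 0 \<Longrightarrow> measure F {..x} \<le> K * x powr (real n * (\<sigma> - 5/3))"
    using decay[of n] by auto
  define K1 where "K1 = K * 2 powr (real n * (\<sigma> - 5/3))"
  define K2 where "K2 = rate (B + 3) 1 * (32 * C) * (\<integral>\<eta>. weight \<sigma> \<beta> \<eta> \<partial>lborel) / \<mu>"
  have K12: "0 \<le> K1" "0 \<le> K2" using K C mu_pos by (auto simp: K1_def K2_def)
  have "measure F {x..x + v} \<le> (1 + K1 + K2) * v powr (\<alpha> + d)" if xv: "0 \<le> x" "x \<le> B" "0 < v" for x v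
  proof -
    have "measure F {x..x + v} \<le> v powr (\<alpha> + d) \<or> measure F {x..x + v} \<le> K1 * v powr (\<alpha> + d) \<or>
        measure F {x..x + v} \<le> K2 * v powr (\<alpha> + d)"
    proof (cases "v < 1")
      case False
      then have "1 \<le> v powr (\<alpha> + d)" using \<alpha> d by (intro ge_one_powr_ge_zero) auto
      then show ?thesis using measure_F_le_1[of "{x..x + v}"] by linarith
    next
      case v1: True
      show ?thesis
      proof (cases "x \<le> v powr d")
        case True
        have "v powr 1 \<le> v powr d" using v1 xv d by (intro powr_mono') auto
        then have "measure F {x..x + v} \<le> measure F {..2 * v powr d}"
          using True xv by (intro finite_measure_mono) auto
        also have "\<dots> \<le> K * (2 * v powr d) powr (real n * (\<sigma> - 5/3))"
          using xv by (intro K) auto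
        also have "\<dots> = K1 * v powr (real n * (\<sigma> - 5/3) * d)"
          using xv by (simp add: K1_def powr_mult powr_powr mult.commute)
        also have "\<dots> \<le> K1 * v powr (\<alpha> + d)"
          using v1 xv n K12 by (intro mult_left_mono powr_mono') auto
        finally show ?thesis by simp
      next
        case False
        then have x: "v powr d < x" "0 < x" using xv by (auto intro: le_less_trans[of 0 "v powr d"])
        have "\<mu> * (x / v * measure F {x..x + v}) \<le>
            rate (B + 3) 1 * (32 * C * v powr (\<alpha> - \<beta>)) * (\<integral>\<eta>. weight \<sigma> \<beta> \<eta> \<partial>lborel)"
          using xv v1 x \<alpha> \<beta> C by (intro stationary_bump_le) auto
        also have "\<dots> = \<mu> * (K2 * v powr (\<alpha> - \<beta>))" using mu_pos by (simp add: K2_def)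
        finally have "x / v * measure F {x..x + v} \<le> K2 * v powr (\<alpha> - \<beta>)"
          using mult_le_cancel_left_pos[OF mu_pos(1)] by blast
        moreover have "v powr d / v * measure F {x..x + v} \<le> x / v * measure F {x..x + v}"
          using x xv by (intro mult_right_mono divide_right_mono) auto
        ultimately have "v powr d / v * measure F {x..x + v} \<le> K2 * v powr (\<alpha> - \<beta>)" by linarith
        then have le: "v powr (1 - d) * (v powr d / v * measure F {x..x + v}) \<le> v powr (1 - d) * (K2 * v powr (\<alpha> - \<beta>))"
          by (intro mult_left_mono) auto
        have c1: "v powr (1 - d) * (v powr d / v) = 1" using xv by (simp add: powr_diff)
        have c2: "v powr (1 - d) * v powr (\<alpha> - \<beta>) = v powr (\<alpha> + d)"
        proof -
          have "1 - d + (\<alpha> - \<beta>) = \<alpha> + d" by (simp add: \<beta>_def d_def field_simps)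
          then show ?thesis by (simp only: powr_add[symmetric])
        qed
        have "measure F {x..x + v} = v powr (1 - d) * (v powr d / v * measure F {x..x + v})"
          by (simp only: mult.assoc[symmetric] c1 mult_1_left)
        also have "\<dots> \<le> K2 * v powr (\<alpha> + d)"
          using le by (simp only: mult.left_commute[of "v powr (1 - d)" K2] c2)
        finally show ?thesis by simp
      qed
    qed
    moreover have "0 \<le> v powr (\<alpha> + d)" "0 \<le> K1 * v powr (\<alpha> + d)" "0 \<le> K2 * v powr (\<alpha> + d)"
      using K12 by auto
    ultimately show ?thesis by (simp only: distrib_right) linarith
  qed
  moreover have "1 \<le> 1 + K1 + K2" using K12 by simp
  ultimately show ?thesis unfolding concentration_exponent_def d_def[symmetric] by blast
qed

text \<open>From the trivial exponent 0 each step adds the fixed positive amount (2 - \<sigma>) / 3.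
  Above the threshold \<sigma> - 1 the power v^\<alpha> is integrable against v^(-\<sigma>) at 0;
  the step is available only up to the threshold, so the induction stops once it is passed.\<close>

lemma concentration:
  obtains C \<alpha> where "\<sigma> - 1 < \<alpha>" "1 \<le> C"
    "\<And>x v. 0 \<le> x \<Longrightarrow> x \<le> B \<Longrightarrow> 0 < v \<Longrightarrow> measure F {x..x + v} \<le> C * v powr \<alpha>"
proof -
  define d where "d = (2 - \<sigma>) / 3"
  have d: "0 < d" using sigma by (simp add: d_def)
  have "\<exists>\<alpha>\<ge>0. concentration_exponent B \<alpha> \<and> (\<sigma> - 1 < \<alpha> \<or> real n * d \<le> \<alpha>)" for n
  proof (induction n)
    case 0
    have "concentration_exponent B 0"
      unfolding concentration_exponent_def by (rule exI[of _ 1]) (auto intro: measure_F_le_1)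
    then show ?case by auto
  next
    case (Suc n)
    then obtain \<alpha> where \<alpha>: "\<alpha> \<ge> 0" "concentration_exponent B \<alpha>" "\<sigma> - 1 < \<alpha> \<or> real n * d \<le> \<alpha>"
      by blast
    show ?case
    proof (cases "\<sigma> - 1 < \<alpha>")
      case False
      then have "concentration_exponent B (\<alpha> + d)"
        unfolding d_def using \<alpha> by (intro concentration_exponent_step) auto
      moreover have "real (Suc n) * d \<le> \<alpha> + d" using \<alpha> False by (simp add: algebra_simps)
      ultimately show ?thesis using \<alpha> d by (intro exI[of _ "\<alpha> + d"]) auto
    qed (use \<alpha> in blast)
  qed
  note ex = this
  obtain n :: nat where "\<sigma> / d \<le> real n" using real_arch_simple by blast
  then have "\<sigma> \<le> real n * d" using d by (simp add: pos_divide_le_eq)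
  then obtain \<alpha> where "concentration_exponent B \<alpha>" "\<sigma> - 1 < \<alpha>" using ex[of n] by auto
  then show ?thesis using that unfolding concentration_exponent_def by blast
qed

end

subsection \<open>Stability of the growth operator under rescaling\<close>

locale flow = profile F \<sigma> \<mu> + integrable_jump_kernel \<sigma> C\<^sub>0 G
  for F :: "real measure" and \<sigma> \<mu> C\<^sub>0 :: real and G :: "real \<Rightarrow> real" +
  assumes G_limit: "((\<lambda>v. v powr \<sigma> * G v) \<longlongrightarrow> 1) at_top"
begin

text \<open>The kernel seen at volume scale l. As l grows it converges to
  \<open>power_kernel\<close> pointwise and keeps the same constant \<open>C\<^sub>0\<close>, but
  its L^1 norm blows up.\<close>

definition rescaled_kernel :: "real \<Rightarrow> real \<Rightarrow> real" where
  "rescaled_kernel l v = l powr \<sigma> * G (l * v)"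

lemma C0_nonneg: "0 \<le> C\<^sub>0"
  using order_trans[OF G_nonneg[of 1] G_le[of 1]] by (simp add: power_kernel_def)

lemma rescaled_kernel_le:
  assumes "0 < l"
  shows "rescaled_kernel l v \<le> C\<^sub>0 * power_kernel \<sigma> v"
proof (cases "v > 0")
  case True
  have "rescaled_kernel l v \<le> l powr \<sigma> * (C\<^sub>0 * power_kernel \<sigma> (l * v))"
    unfolding rescaled_kernel_def by (intro mult_left_mono G_le) auto
  also have "\<dots> = C\<^sub>0 * power_kernel \<sigma> v"
    using assms True by (simp add: power_kernel_def powr_mult powr_minus)
  finally show ?thesis .
next
  case False
  then have "l * v \<le> 0" using assms by (simp add: mult_le_0_iff)
  then show ?thesis using False by (simp add: rescaled_kernel_def G_zero power_kernel_def)
qed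

lemma rescaled_kernel_integrable_jump_kernel:
  assumes "0 < l"
  shows "integrable_jump_kernel \<sigma> C\<^sub>0 (rescaled_kernel l)"
proof
  show "rescaled_kernel l \<in> borel_measurable borel"
    unfolding rescaled_kernel_def[abs_def] by measurable
  show "rescaled_kernel l v = 0" if "v \<le> 0" for v
    using that assms by (simp add: rescaled_kernel_def G_zero mult_le_0_iff)
  show "integrable lborel (rescaled_kernel l)"
    unfolding rescaled_kernel_def[abs_def]
    using lborel_integrable_real_affine[OF G_integrable, of l 0] assms by simp
qed (use kernel_exponent rescaled_kernel_le[OF assms] in \<open>auto simp: rescaled_kernel_def\<close>)

text \<open>An L^1 distance weighted so as to stay finite: v^\<alpha> is the order of the averaged
  decrement that \<open>concentration\<close> provides, and \<alpha> > \<sigma> - 1 makes the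
  integral converge at 0.\<close>

definition kernel_error :: "real \<Rightarrow> real \<Rightarrow> real" where
  "kernel_error \<alpha> l =
     (\<integral>v. \<bar>power_kernel \<sigma> v - rescaled_kernel l v\<bar> * ((1 + v powr (1/3))\<^sup>2 * min 1 (v powr \<alpha>)) \<partial>lborel)"

lemma rescaled_kernel_measurable [measurable]: "rescaled_kernel l \<in> borel_measurable borel"
  unfolding rescaled_kernel_def[abs_def] by measurable

lemma kernel_error_integrand_le:
  assumes "0 < l"
  shows "\<bar>power_kernel \<sigma> v - rescaled_kernel l v\<bar> * ((1 + v powr (1/3))\<^sup>2 * min 1 (v powr \<alpha>))
    \<le> (1 + C\<^sub>0) * weight \<sigma> \<alpha> v"
proof -
  have "0 \<le> rescaled_kernel l v" "0 \<le> C\<^sub>0 * power_kernel \<sigma> v"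
    using C0_nonneg by (auto simp: rescaled_kernel_def)
  then have "\<bar>power_kernel \<sigma> v - rescaled_kernel l v\<bar> \<le> (1 + C\<^sub>0) * power_kernel \<sigma> v"
    using rescaled_kernel_le[OF assms, of v] power_kernel_nonneg[of \<sigma> v]
    unfolding distrib_right by (intro abs_leI) linarith+
  then have "\<bar>power_kernel \<sigma> v - rescaled_kernel l v\<bar> * ((1 + v powr (1/3))\<^sup>2 * min 1 (v powr \<alpha>))
      \<le> (1 + C\<^sub>0) * power_kernel \<sigma> v * ((1 + v powr (1/3))\<^sup>2 * min 1 (v powr \<alpha>))"
    by (intro mult_right_mono) auto
  then show ?thesis by (simp add: weight_def mult.assoc)
qed

text \<open>Dominated convergence: the pointwise limit is the tail assumption on G, and
  \<open>(1 + C\<^sub>0) * weight \<sigma> \<alpha> v\<close> dominates for all l > 0 at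
  once.\<close>

lemma kernel_error_tendsto:
  assumes "\<sigma> - 1 < \<alpha>"
  shows "(kernel_error \<alpha> \<longlongrightarrow> 0) at_top"
proof -
  have iw: "integrable lborel (\<lambda>v. (1 + C\<^sub>0) * weight \<sigma> \<alpha> v)"
    using assms sigma by (intro integrable_mult_right integrable_weight) auto
  have "((\<lambda>l. \<integral>v. \<bar>power_kernel \<sigma> v - rescaled_kernel l v\<bar> * ((1 + v powr (1/3))\<^sup>2 * min 1 (v powr \<alpha>)) \<partial>lborel)
      \<longlongrightarrow> (\<integral>v. 0 \<partial>(lborel :: real measure))) at_top"
  proof (rule integral_dominated_convergence_at_top[OF _ _ iw])
    show "\<forall>\<^sub>F l in at_top. AE v in lborel.
        norm (\<bar>power_kernel \<sigma> v - rescaled_kernel l v\<bar> * ((1 + v powr (1/3))\<^sup>2 * min 1 (v powr \<alpha>)))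
        \<le> (1 + C\<^sub>0) * weight \<sigma> \<alpha> v"
      using eventually_gt_at_top[of 0]
      by eventually_elim (use kernel_error_integrand_le in \<open>auto simp: abs_mult\<close>)
    show "AE v in lborel. ((\<lambda>l. \<bar>power_kernel \<sigma> v - rescaled_kernel l v\<bar> * ((1 + v powr (1/3))\<^sup>2 * min 1 (v powr \<alpha>)))
        \<longlongrightarrow> 0) at_top"
    proof (intro AE_I2)
      fix v :: real
      have "((\<lambda>l. rescaled_kernel l v) \<longlongrightarrow> power_kernel \<sigma> v) at_top"
      proof (cases "v > 0")
        case True
        have "filterlim (\<lambda>l. l * v) at_top at_top"
          using True by (intro filterlim_at_top_mult_tendsto_pos[of _ v] filterlim_ident tendsto_const) auto
        then have "((\<lambda>l. (l * v) powr \<sigma> * G (l * v)) \<longlongrightarrow> 1) at_top"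
          by (rule filterlim_compose[OF G_limit])
        then have "((\<lambda>l. v powr (-\<sigma>) * ((l * v) powr \<sigma> * G (l * v))) \<longlongrightarrow> v powr (-\<sigma>) * 1) at_top"
          by (intro tendsto_mult tendsto_const)
        then have "((\<lambda>l. rescaled_kernel l v) \<longlongrightarrow> v powr (-\<sigma>) * 1) at_top"
        proof (rule Lim_transform_eventually)
          show "\<forall>\<^sub>F l in at_top. v powr (-\<sigma>) * ((l * v) powr \<sigma> * G (l * v)) = rescaled_kernel l v"
            using eventually_gt_at_top[of 0]
          proof eventually_elim
            case (elim l)
            then show ?case
              using True by (simp add: rescaled_kernel_def powr_mult powr_minus)
          qed
        qed
        then show ?thesis using True by (simp add: power_kernel_def)
      next
        case False
        have "\<forall>\<^sub>F l in at_top. rescaled_kernel l v = power_kernel \<sigma> v"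
          using eventually_gt_at_top[of 0]
        proof eventually_elim
          case (elim l)
          then have "l * v \<le> 0" using False by (simp add: mult_le_0_iff)
          then show ?case using False by (simp add: rescaled_kernel_def power_kernel_def G_zero)
        qed
        then show ?thesis by (rule tendsto_eventually)
      qed
      then have "((\<lambda>l. \<bar>power_kernel \<sigma> v - rescaled_kernel l v\<bar> * ((1 + v powr (1/3))\<^sup>2 * min 1 (v powr \<alpha>)))
        \<longlongrightarrow> \<bar>power_kernel \<sigma> v - power_kernel \<sigma> v\<bar> * ((1 + v powr (1/3))\<^sup>2 * min 1 (v powr \<alpha>))) at_top"
        by (intro tendsto_intros)
      then show "((\<lambda>l. \<bar>power_kernel \<sigma> v - rescaled_kernel l v\<bar> * ((1 + v powr (1/3))\<^sup>2 * min 1 (v powr \<alpha>)))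
        \<longlongrightarrow> 0) at_top" by simp
    qed
  qed auto
  then show ?thesis by (simp add: kernel_error_def[abs_def])
qed

text \<open>The bound is free of L. Lipschitz continuity of \<psi> makes the integrals against the
  power kernel converge; the size of the difference is governed by the concentration of F through
  \<open>integral_decrement_le\<close>.\<close>

lemma growth_difference_le:
  assumes \<psi>: "\<psi> \<in> decreasing_tests M" and "0 \<le> M" and "0 < l"
    and lip: "0 \<le> L" "\<And>x y. x \<le> y \<Longrightarrow> \<bar>\<psi> y - \<psi> x\<bar> \<le> L * min 1 (y - x)"
    and "\<sigma> - 1 < \<alpha>" "1 \<le> C"
    and conc: "\<And>x v. 0 \<le> x \<Longrightarrow> x \<le> M \<Longrightarrow> 0 < v \<Longrightarrow> measure F {x..x + v} \<le> C * v powr \<alpha>"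
  shows "\<bar>(\<integral>x. growth (power_kernel \<sigma>) \<psi> x \<partial>F) - (\<integral>x. growth (rescaled_kernel l) \<psi> x \<partial>F)\<bar>
    \<le> 2 * C * rate M 1 * kernel_error \<alpha> l"
proof -
  interpret K: integrable_jump_kernel \<sigma> C\<^sub>0 "rescaled_kernel l"
    by (rule rescaled_kernel_integrable_jump_kernel) fact
  note D = decreasing_testsD[OF \<psi>]
  have [measurable]: "\<psi> \<in> borel_measurable borel" by (rule D)
  have B: "\<bar>\<psi> z\<bar> \<le> 1" for z using D(3,4)[of z] by simp
  have PG: "integrable lborel (\<lambda>v. power_kernel \<sigma> v * rate x v * (\<psi> (x + v) - \<psi> x))"
    "\<bar>growth (power_kernel \<sigma>) \<psi> x\<bar> \<le> L * rate M 1 * (\<integral>v. weight \<sigma> 1 v \<partial>lborel)"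
    "growth (power_kernel \<sigma>) \<psi> \<in> borel_measurable borel" for x
    by (rule power_growth_bounded[OF sigma, where L = L and M = M]; use D lip in blast)+
  have int_K: "integrable lborel (\<lambda>v. rescaled_kernel l v * rate x v * (\<psi> (x + v) - \<psi> x))" for x
    by (rule K.growth_integrable[OF D(6), where B=1]) (rule B)
  define W where "W v = \<bar>power_kernel \<sigma> v - rescaled_kernel l v\<bar>" for v
  have [measurable]: "W \<in> borel_measurable borel" unfolding W_def[abs_def] by measurable
  have W0: "0 \<le> W v" "v \<le> 0 \<Longrightarrow> W v = 0" for v
    by (auto simp: W_def K.G_zero power_kernel_def)
  \<comment> \<open>As \<psi> decreases, W times the rate and the decrement is the absolute
    difference of the two growth integrands; h is its integral.\<close>
  define h where "h x = - (\<integral>v. W v * rate x v * (\<psi> (x + v) - \<psi> x) \<partial>lborel)" for x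
  have [measurable]: "h \<in> borel_measurable borel" unfolding h_def[abs_def] by measurable
  have growth_K_bound: "\<bar>growth (rescaled_kernel l) \<psi> x\<bar> \<le> 2 * rate M 1 * K.total" for x
  proof (cases "x \<le> M")
    case True
    then show ?thesis using K.growth_bound[OF D(6) True B] by simp
  next
    case False
    then have "growth (rescaled_kernel l) \<psi> x = 0" by (intro K.growth_eq_0[of M] D(5)) auto
    then show ?thesis using K.total_nonneg by simp
  qed
  have [measurable]: "growth (rescaled_kernel l) \<psi> \<in> borel_measurable borel"
    using K.continuous_on_growth[OF D(1) B] by (rule borel_measurable_continuous_onI)
  have [measurable]: "growth (power_kernel \<sigma>) \<psi> \<in> borel_measurable borel" by (rule PG(3))
  have intP: "integrable F (growth (power_kernel \<sigma>) \<psi>)"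
    using PG(2) by (intro integrable_const_bound[where B="L * rate M 1 * (\<integral>v. weight \<sigma> 1 v \<partial>lborel)"]) auto
  have intK: "integrable F (growth (rescaled_kernel l) \<psi>)"
    using growth_K_bound by (intro integrable_const_bound[where B="2 * rate M 1 * K.total"]) auto
  \<comment> \<open>The first bound makes h dominate the difference of the growth terms; the second,
    an instance of |a - b| \<le> a + b, makes h integrable through the two separate terms.\<close>
  have pt: "W v * rate x v * (\<psi> x - \<psi> (x + v)) \<ge> \<bar>power_kernel \<sigma> v * rate x v * (\<psi> (x + v) - \<psi> x)
      - rescaled_kernel l v * rate x v * (\<psi> (x + v) - \<psi> x)\<bar>"
    "W v * rate x v * (\<psi> x - \<psi> (x + v)) \<le> - (power_kernel \<sigma> v * rate x v * (\<psi> (x + v) - \<psi> x))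
      - rescaled_kernel l v * rate x v * (\<psi> (x + v) - \<psi> x)"
    "0 \<le> W v * rate x v * (\<psi> x - \<psi> (x + v))" for x v
  proof -
    have d: "0 \<le> \<psi> x - \<psi> (x + v)" if "v > 0" using D(2)[of x "x + v"] that by simp
    show "W v * rate x v * (\<psi> x - \<psi> (x + v)) \<ge> \<bar>power_kernel \<sigma> v * rate x v * (\<psi> (x + v) - \<psi> x)
      - rescaled_kernel l v * rate x v * (\<psi> (x + v) - \<psi> x)\<bar>"
    proof (cases "v > 0")
      case True
      have "\<bar>power_kernel \<sigma> v * rate x v * (\<psi> (x + v) - \<psi> x) - rescaled_kernel l v * rate x v * (\<psi> (x + v) - \<psi> x)\<bar>
        = \<bar>(power_kernel \<sigma> v - rescaled_kernel l v) * rate x v * (\<psi> (x + v) - \<psi> x)\<bar>"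
        by (simp add: algebra_simps)
      also have "\<dots> = W v * rate x v * (\<psi> x - \<psi> (x + v))"
        using d[OF True] by (simp add: abs_mult W_def)
      finally show ?thesis by simp
    qed (auto simp: W0 K.G_zero power_kernel_def)
    show "0 \<le> W v * rate x v * (\<psi> x - \<psi> (x + v))"
      using W0 d by (cases "v > 0") auto
    show "W v * rate x v * (\<psi> x - \<psi> (x + v)) \<le> - (power_kernel \<sigma> v * rate x v * (\<psi> (x + v) - \<psi> x))
      - rescaled_kernel l v * rate x v * (\<psi> (x + v) - \<psi> x)"
    proof (cases "v > 0")
      case True
      have "W v \<le> power_kernel \<sigma> v + rescaled_kernel l v"
        using K.G_nonneg[of v] power_kernel_nonneg[of \<sigma> v] by (simp add: W_def abs_le_iff)
      then have "W v * (rate x v * (\<psi> x - \<psi> (x + v))) \<le>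
          (power_kernel \<sigma> v + rescaled_kernel l v) * (rate x v * (\<psi> x - \<psi> (x + v)))"
        using d[OF True] by (intro mult_right_mono) auto
      then show ?thesis by (simp add: algebra_simps)
    qed (auto simp: W0 K.G_zero power_kernel_def)
  qed
  have intW: "integrable lborel (\<lambda>v. W v * rate x v * (\<psi> x - \<psi> (x + v)))" for x
  proof (rule Bochner_Integration.integrable_bound)
    show "integrable lborel (\<lambda>v. - (power_kernel \<sigma> v * rate x v * (\<psi> (x + v) - \<psi> x))
      - rescaled_kernel l v * rate x v * (\<psi> (x + v) - \<psi> x))"
      by (intro Bochner_Integration.integrable_diff Bochner_Integration.integrable_minus PG(1) int_K)
    show "AE v in lborel. norm (W v * rate x v * (\<psi> x - \<psi> (x + v))) \<le> norm (- (power_kernel \<sigma> v * rate x v * (\<psi> (x + v) - \<psi> x))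
      - rescaled_kernel l v * rate x v * (\<psi> (x + v) - \<psi> x))"
      using pt(2,3)[where x=x] by (intro AE_I2) (metis abs_of_nonneg order_trans real_norm_def)
  qed measurable
  have h_eq: "h x = (\<integral>v. W v * rate x v * (\<psi> x - \<psi> (x + v)) \<partial>lborel)" for x
    unfolding h_def by (subst Bochner_Integration.integral_minus[symmetric])
      (intro Bochner_Integration.integral_cong refl, simp add: algebra_simps)
  have le_h: "\<bar>growth (power_kernel \<sigma>) \<psi> x - growth (rescaled_kernel l) \<psi> x\<bar> \<le> h x" for x
  proof -
    have "growth (power_kernel \<sigma>) \<psi> x - growth (rescaled_kernel l) \<psi> x =
      (\<integral>v. power_kernel \<sigma> v * rate x v * (\<psi> (x + v) - \<psi> x)
        - rescaled_kernel l v * rate x v * (\<psi> (x + v) - \<psi> x) \<partial>lborel)"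
      unfolding growth_def by (rule Bochner_Integration.integral_diff[OF PG(1) int_K, symmetric])
    then show ?thesis
      unfolding h_eq
      by (simp only:) (intro integral_abs_bound[THEN order_trans] integral_mono intW
        Bochner_Integration.integrable_diff integrable_abs PG(1) int_K pt(1))
  qed
  have h_le: "h x \<le> - growth (power_kernel \<sigma>) \<psi> x - growth (rescaled_kernel l) \<psi> x" for x
  proof -
    have "h x \<le> (\<integral>v. - (power_kernel \<sigma> v * rate x v * (\<psi> (x + v) - \<psi> x))
      - rescaled_kernel l v * rate x v * (\<psi> (x + v) - \<psi> x) \<partial>lborel)"
      unfolding h_eq
      by (intro integral_mono intW Bochner_Integration.integrable_diff Bochner_Integration.integrable_minus PG(1) int_K pt(2))
    also have "\<dots> = - growth (power_kernel \<sigma>) \<psi> x - growth (rescaled_kernel l) \<psi> x"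
      unfolding growth_def
      by (subst Bochner_Integration.integral_diff[OF Bochner_Integration.integrable_minus[OF PG(1)] int_K])
        (simp only: Bochner_Integration.integral_minus)
    finally show ?thesis .
  qed
  have h0: "0 \<le> h x" for x unfolding h_eq by (intro Bochner_Integration.integral_nonneg pt(3))
  have inth: "integrable F h"
  proof (rule Bochner_Integration.integrable_bound)
    show "integrable F (\<lambda>x. - growth (power_kernel \<sigma>) \<psi> x - growth (rescaled_kernel l) \<psi> x)"
      by (intro Bochner_Integration.integrable_diff Bochner_Integration.integrable_minus intP intK)
    show "AE x in F. norm (h x) \<le> norm (- growth (power_kernel \<sigma>) \<psi> x - growth (rescaled_kernel l) \<psi> x)"
      using h0 h_le by (intro AE_I2) (metis abs_of_nonneg order_trans real_norm_def)
  qed measurable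
  define b where "b v = 2 * C * rate M 1 * ((1 + v powr (1/3))\<^sup>2 * min 1 (v powr \<alpha>))" for v
  have "\<bar>(\<integral>x. growth (power_kernel \<sigma>) \<psi> x \<partial>F) - (\<integral>x. growth (rescaled_kernel l) \<psi> x \<partial>F)\<bar>
      = \<bar>\<integral>x. growth (power_kernel \<sigma>) \<psi> x - growth (rescaled_kernel l) \<psi> x \<partial>F\<bar>"
    by (simp add: Bochner_Integration.integral_diff[OF intP intK])
  also have "\<dots> \<le> (\<integral>x. h x \<partial>F)"
    by (intro integral_abs_bound[THEN order_trans] integral_mono integrable_abs
      Bochner_Integration.integrable_diff intP intK inth le_h)
  also have "\<dots> \<le> (\<integral>v. W v * b v \<partial>lborel)"
    unfolding h_def
  proof (rule integral_growth_le[OF finite_measure_axioms sets_F])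
    show "0 \<le> b v" for v using \<open>1 \<le> C\<close> by (simp add: b_def)
    have "W v * b v \<le> 2 * C * rate M 1 * ((1 + C\<^sub>0) * weight \<sigma> \<alpha> v)" for v
      using mult_left_mono[OF kernel_error_integrand_le[OF \<open>0 < l\<close>, of v \<alpha>], of "2 * C * rate M 1"] \<open>1 \<le> C\<close>
      by (simp add: W_def b_def mult_ac)
    moreover have "0 \<le> W v * b v" for v using W0 \<open>1 \<le> C\<close> by (simp add: b_def)
    moreover have "integrable lborel (\<lambda>v. 2 * C * rate M 1 * ((1 + C\<^sub>0) * weight \<sigma> \<alpha> v))"
      using sigma \<open>\<sigma> - 1 < \<alpha>\<close> by (intro integrable_mult_right integrable_weight) auto
    moreover have "(\<lambda>v. W v * b v) \<in> borel_measurable lborel" unfolding b_def by measurable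
    ultimately show "integrable lborel (\<lambda>v. W v * b v)"
      by (elim Bochner_Integration.integrable_bound) (auto intro!: AE_I2 intro: order_trans[OF _ abs_ge_self])
    show "(\<integral>\<^sup>+x. ennreal (rate x v * (\<psi> x - \<psi> (x + v))) \<partial>F) \<le> ennreal (b v)" if "v > 0" for v
    proof -
      \<comment> \<open>Beyond M the decrement vanishes, so the rate may be replaced by its bound
        for x \<le> M; what remains is a pure decrement.\<close>
      define k where "k = rate M 1 * (1 + v powr (1/3))\<^sup>2"
      have bd: "\<bar>\<psi> x - \<psi> (x + v)\<bar> \<le> 1" for x using D(3,4)[of x] D(3,4)[of "x + v"] by linarith
      have d0: "0 \<le> \<psi> x - \<psi> (x + v)" for x using D(2)[of x "x + v"] that by simp
      have "(\<integral>\<^sup>+x. ennreal (rate x v * (\<psi> x - \<psi> (x + v))) \<partial>F) \<le> (\<integral>\<^sup>+x. ennreal (k * (\<psi> x - \<psi> (x + v))) \<partial>F)"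
      proof (intro nn_integral_mono ennreal_leI)
        fix x
        show "rate x v * (\<psi> x - \<psi> (x + v)) \<le> k * (\<psi> x - \<psi> (x + v))"
        proof (cases "x \<le> M")
          case True
          then show ?thesis unfolding k_def by (intro mult_right_mono rate_le d0)
        next
          case False
          then show ?thesis using D(5)[of x] D(5)[of "x + v"] that by simp
        qed
      qed
      also have "\<dots> = ennreal (\<integral>x. k * (\<psi> x - \<psi> (x + v)) \<partial>F)"
        using bd d0 by (intro nn_integral_eq_integral integrable_mult_right integrable_const_bound[where B=1])
          (auto simp: k_def)
      also have "\<dots> \<le> ennreal (b v)"
      proof (rule ennreal_leI)
        have "(\<integral>x. \<psi> x - \<psi> (x + v) \<partial>F) \<le> 2 * (C * min 1 (v powr \<alpha>))"
        proof (rule integral_decrement_le[OF finite_measure_axioms sets_F support \<psi> that])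
          show "0 \<le> C * min 1 (v powr \<alpha>)" using \<open>1 \<le> C\<close> by simp
          fix x assume "0 \<le> x" "x \<le> M"
          have "measure F {x..x + v} \<le> C * 1" using measure_F_le_1[of "{x..x + v}"] \<open>1 \<le> C\<close> by simp
          then show "measure F {x..x + v} \<le> C * min 1 (v powr \<alpha>)"
            using conc[OF \<open>0 \<le> x\<close> \<open>x \<le> M\<close> that] by (simp add: min_def)
        qed
        then have "k * (\<integral>x. \<psi> x - \<psi> (x + v) \<partial>F) \<le> k * (2 * (C * min 1 (v powr \<alpha>)))"
          by (intro mult_left_mono) (auto simp: k_def)
        then show "(\<integral>x. k * (\<psi> x - \<psi> (x + v)) \<partial>F) \<le> b v" by (simp add: k_def b_def mult_ac)
      qed
      finally show ?thesis .
    qed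
  qed (use W0 D(2) in auto)
  also have "\<dots> = (\<integral>v. 2 * C * rate M 1 * (\<bar>power_kernel \<sigma> v - rescaled_kernel l v\<bar> * ((1 + v powr (1/3))\<^sup>2 * min 1 (v powr \<alpha>))) \<partial>lborel)"
    by (simp add: W_def b_def mult_ac)
  also have "\<dots> = 2 * C * rate M 1 * kernel_error \<alpha> l"
    unfolding kernel_error_def by (rule integral_mult_right_zero)
  finally show ?thesis .
qed

text \<open>The threshold \<Lambda> is chosen before \<psi> and L. This uniformity over the test
  class is what the comparison argument consumes.\<close>

lemma growth_consistency:
  assumes "0 \<le> M" "0 < \<epsilon>"
  obtains \<Lambda> where "0 < \<Lambda>" "\<And>l \<psi> L. \<Lambda> \<le> l \<Longrightarrow> \<psi> \<in> decreasing_tests M \<Longrightarrow> 0 \<le> L \<Longrightarrow>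
    (\<And>x y. x \<le> y \<Longrightarrow> \<bar>\<psi> y - \<psi> x\<bar> \<le> L * min 1 (y - x)) \<Longrightarrow>
    \<bar>(\<integral>x. growth (power_kernel \<sigma>) \<psi> x \<partial>F) - (\<integral>x. growth (rescaled_kernel l) \<psi> x \<partial>F)\<bar> \<le> \<epsilon>"
proof -
  obtain C \<alpha> where C: "\<sigma> - 1 < \<alpha>" "1 \<le> C"
    "\<And>x v. 0 \<le> x \<Longrightarrow> x \<le> M \<Longrightarrow> 0 < v \<Longrightarrow> measure F {x..x + v} \<le> C * v powr \<alpha>"
    by (rule concentration[of M]) blast
  have "((\<lambda>l. 2 * C * rate M 1 * kernel_error \<alpha> l) \<longlongrightarrow> 2 * C * rate M 1 * 0) at_top"
    by (intro tendsto_mult tendsto_const kernel_error_tendsto C)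
  then have "\<forall>\<^sub>F l in at_top. 2 * C * rate M 1 * kernel_error \<alpha> l < \<epsilon>"
    using order_tendstoD(2)[of _ 0 at_top \<epsilon>] \<open>0 < \<epsilon>\<close> by simp
  then obtain \<Lambda> where \<Lambda>: "\<And>l. \<Lambda> \<le> l \<Longrightarrow> 2 * C * rate M 1 * kernel_error \<alpha> l < \<epsilon>"
    by (auto simp: eventually_at_top_linorder)
  show ?thesis
  proof (rule that[of "max 1 \<Lambda>"])
    fix l \<psi> L
    assume A: "max 1 \<Lambda> \<le> l" "\<psi> \<in> decreasing_tests M" "0 \<le> L"
      "\<And>x y. x \<le> y \<Longrightarrow> \<bar>\<psi> y - \<psi> x\<bar> \<le> L * min 1 (y - x)"
    have "0 < l" using A(1) by simp
    from growth_difference_le[OF A(2) \<open>0 \<le> M\<close> this A(3,4) C] \<Lambda>[of l] A(1)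
    show "\<bar>(\<integral>x. growth (power_kernel \<sigma>) \<psi> x \<partial>F) - (\<integral>x. growth (rescaled_kernel l) \<psi> x \<partial>F)\<bar> \<le> \<epsilon>"
      by simp
  qed simp
qed

end

subsection \<open>The self-similar flow\<close>

text \<open>The average of \<phi> over [x, x + h], written as a difference quotient of an
  antiderivative. Averaging to the right preserves monotonicity and vanishing beyond M, and places
  \<Phi> x between \<phi> (x + h) and \<phi> x.\<close>

lemma decreasing_tests_smooth_approx:
  assumes \<phi>: "\<phi> \<in> decreasing_tests M" and "0 < e"
  obtains \<Phi> g L where "\<Phi> \<in> decreasing_tests M" "continuous_on UNIV g"
    "\<And>x. (\<Phi> has_real_derivative - g x) (at x)" "\<And>x. \<bar>g x\<bar> \<le> L" "\<And>x. x \<ge> M \<Longrightarrow> g x = 0"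
    "\<And>x. 0 \<le> x \<Longrightarrow> \<bar>\<Phi> x - \<phi> x\<bar> \<le> e"
proof -
  note D = decreasing_testsD[OF \<phi>]
  have "uniformly_continuous_on {0..max M 0 + 1} \<phi>"
    by (intro compact_uniformly_continuous continuous_on_subset[OF D(1)]) auto
  then obtain \<delta> where \<delta>: "\<delta> > 0"
    "\<And>x y. x \<in> {0..max M 0 + 1} \<Longrightarrow> y \<in> {0..max M 0 + 1} \<Longrightarrow> dist y x < \<delta> \<Longrightarrow> dist (\<phi> y) (\<phi> x) < e"
    using \<open>0 < e\<close> by (rule uniformly_continuous_onE) auto
  define h where "h = min (\<delta> / 2) 1"
  have h: "0 < h" "h < \<delta>" "h \<le> 1" using \<delta> by (auto simp: h_def)
  obtain A where A: "\<And>x. (A has_real_derivative - \<phi> x) (at x)"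
    by (rule antiderivative_vanishing[OF D(1)]) (use D(5) in blast)+
  define \<Phi> where "\<Phi> x = (A x - A (x + h)) / h" for x
  define g where "g x = (\<phi> x - \<phi> (x + h)) / h" for x
  have between: "\<phi> (x + h) \<le> \<Phi> x \<and> \<Phi> x \<le> \<phi> x" for x
  proof -
    have "\<exists>z>x. z < x + h \<and> A (x + h) - A x = (x + h - x) * - \<phi> z"
      using h by (intro MVT2 A) auto
    then obtain z where z: "x < z" "z < x + h" "A (x + h) - A x = h * - \<phi> z" by auto
    then have "\<Phi> x = \<phi> z" using h by (simp add: \<Phi>_def field_simps)
    then show ?thesis using D(2)[of x z] D(2)[of z "x + h"] z by simp
  qed
  have der: "(\<Phi> has_real_derivative - g x) (at x)" for x
  proof -
    have "((\<lambda>x. A (x + h)) has_real_derivative - \<phi> (x + h)) (at x)"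
      using DERIV_shift[of A "- \<phi> (x + h)" x h] A[of "x + h"] by simp
    then have "((\<lambda>x. (A x - A (x + h)) / h) has_real_derivative (- \<phi> x - - \<phi> (x + h)) / h) (at x)"
      by (intro DERIV_cdivide DERIV_diff A)
    then show ?thesis by (simp add: \<Phi>_def[abs_def] g_def minus_divide_left)
  qed
  have g0: "0 \<le> g x" for x using D(2)[of x "x + h"] h by (simp add: g_def)
  show ?thesis
  proof (rule that[OF _ _ der])
    have "antimono \<Phi>"
    proof
      fix x y :: real assume "x \<le> y"
      then show "\<Phi> y \<le> \<Phi> x"
        by (rule DERIV_nonpos_imp_nonincreasing) (rule exI, rule conjI, rule der, simp add: g0)
    qed
    moreover have "continuous_on UNIV \<Phi>"
      by (rule continuous_on_of_DERIV(1)[OF der])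
    moreover have "\<Phi> x \<le> 1" for x using between[of x] D(3)[of x] by linarith
    moreover have "\<Phi> x = 0" if "x \<ge> M" for x
      using between[of x] D(5)[of x] D(5)[of "x + h"] that h by simp
    ultimately show "\<Phi> \<in> decreasing_tests M" by (simp add: decreasing_tests_def)
    show "continuous_on UNIV g"
      unfolding g_def using h by (intro continuous_intros D(1) continuous_on_compose2[OF D(1)]) auto
    show "\<bar>g x\<bar> \<le> 1 / h" for x
    proof -
      have "\<phi> x - \<phi> (x + h) \<le> 1" using D(3)[of x] D(4)[of "x + h"] by linarith
      then have "g x \<le> 1 / h" unfolding g_def using h by (intro divide_right_mono) auto
      then show ?thesis using g0[of x] by simp
    qed
    show "g x = 0" if "x \<ge> M" for x
      using D(5)[of x] D(5)[of "x + h"] that h by (simp add: g_def)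
    show "\<bar>\<Phi> x - \<phi> x\<bar> \<le> e" if "0 \<le> x" for x
    proof (cases "x \<le> max M 0")
      case True
      then have "dist (\<phi> (x + h)) (\<phi> x) < e"
        using that h by (intro \<delta>) (auto simp: dist_real_def)
      then show ?thesis using between[of x] by (simp add: dist_real_def)
    next
      case False
      then show ?thesis using between[of x] D(5)[of x] D(5)[of "x + h"] h \<open>0 < e\<close> by simp
    qed
  qed
qed

context profile
begin

text \<open>The expectation of \<open>\<phi>\<close> at time \<open>t\<close> of the self-similar solution with profile \<open>F\<close>.\<close>

definition flow_mean :: "(real \<Rightarrow> real) \<Rightarrow> real \<Rightarrow> real" where
  "flow_mean \<phi> t = (\<integral>x. \<phi> (t powr \<mu> * x) \<partial>F)"

lemma flow_mean_integrable:
  fixes \<phi> :: "real \<Rightarrow> real"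
  assumes [measurable]: "\<phi> \<in> borel_measurable borel" and "\<And>x. \<bar>\<phi> x\<bar> \<le> B"
  shows "integrable F (\<lambda>x. \<phi> (c * x))"
  using assms(2) by (intro integrable_const_bound[where B=B]) auto

lemma continuous_on_flow_mean:
  assumes "continuous_on UNIV \<phi>" and "\<And>x. \<bar>\<phi> x\<bar> \<le> B"
  shows "continuous_on {0<..} (flow_mean \<phi>)"
  unfolding flow_mean_def[abs_def]
proof (rule continuous_on_integral_param)
  have [measurable]: "\<phi> \<in> borel_measurable borel"
    using assms(1) by (rule borel_measurable_continuous_onI)
  show "(\<lambda>x. \<phi> (t powr \<mu> * x)) \<in> borel_measurable F" for t by measurable
  show "integrable F (\<lambda>x. B)" by simp
  show "AE x in F. continuous_on {0<..} (\<lambda>t. \<phi> (t powr \<mu> * x))"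
    by (intro AE_I2 continuous_on_compose2[OF assms(1)] continuous_intros) auto
qed (use assms in auto)

text \<open>The time derivative of \<Phi>(t^\<mu> x) is (\<mu> / t) y \<Phi>'(y) at y = t^\<mu> x,
  so the profile equation for the dilated test function turns drift into jumps. The difference
  quotients are dominated because y g(y) is bounded for y \<ge> 0, g vanishing beyond M.\<close>

lemma flow_mean_derivative:
  assumes \<Phi>: "\<Phi> \<in> decreasing_tests M" and g: "continuous_on UNIV g" "\<And>x. x \<ge> M \<Longrightarrow> g x = 0"
    and der: "\<And>x. (\<Phi> has_real_derivative - g x) (at x)" and "t > 0"
  shows "(flow_mean \<Phi> has_real_derivative
    (1 / t) * (\<integral>x. growth (power_kernel \<sigma>) (\<lambda>y. \<Phi> (t powr \<mu> * y)) x \<partial>F)) (at t)"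
proof -
  note D = decreasing_testsD[OF \<Phi>]
  have [measurable]: "\<Phi> \<in> borel_measurable borel" by (rule D)
  have [measurable]: "g \<in> borel_measurable borel" using g(1) by (rule borel_measurable_continuous_onI)
  have B: "\<bar>\<Phi> z\<bar> \<le> 1" for z using D(3,4)[of z] by simp
  have int: "integrable F (\<lambda>x. \<Phi> (c * x))" for c
    by (rule flow_mean_integrable[OF D(6)]) (rule B)
  have "bounded ((\<lambda>y. y * g y) ` {0..M})"
    by (intro compact_imp_bounded compact_continuous_image continuous_intros continuous_on_subset[OF g(1)]) auto
  then obtain Y where "\<forall>y\<in>{0..M}. \<bar>y * g y\<bar> \<le> Y"
    unfolding bounded_iff by auto
  then have Y: "\<bar>y * g y\<bar> \<le> max Y 0" if "0 \<le> y" for y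
    using that g(2)[of y] by (cases "y \<le> M") (auto simp: le_max_iff_disj)
  \<comment> \<open>A convex neighbourhood of t bounded away from 0: there \<mu> / s is bounded and
    the mean value inequality applies.\<close>
  define S where "S = {t / 2<..<2 * t}"
  have S: "open S" "convex S" "t \<in> S" "\<And>s. s \<in> S \<Longrightarrow> 0 < s \<and> t / 2 \<le> s"
    using \<open>t > 0\<close> by (auto simp: S_def)
  define d where "d s x = - g (s powr \<mu> * x) * (\<mu> * s powr (\<mu> - 1) * x)" for s x
  have [measurable]: "d s \<in> borel_measurable borel" for s unfolding d_def by measurable
  have dx: "((\<lambda>s. \<Phi> (s powr \<mu> * x)) has_real_derivative d s x) (at s)" if "s > 0" for s x
    unfolding d_def
    by (rule DERIV_chain2[OF der]) (intro DERIV_cmult_right has_real_derivative_powr that)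
  have dbound: "\<bar>d s x\<bar> \<le> \<mu> / (t / 2) * max Y 0" if "s \<in> S" "0 \<le> x" for s x
  proof -
    have "d s x = - (\<mu> / s) * ((s powr \<mu> * x) * g (s powr \<mu> * x))"
      using S(4)[OF that(1)] by (simp add: d_def powr_diff)
    then have "\<bar>d s x\<bar> = (\<mu> / s) * \<bar>(s powr \<mu> * x) * g (s powr \<mu> * x)\<bar>"
      using S(4)[OF that(1)] mu_pos by (simp add: abs_mult)
    also have "\<dots> \<le> \<mu> / (t / 2) * max Y 0"
      using S(4)[OF that(1)] that mu_pos \<open>t > 0\<close> by (intro mult_mono Y divide_left_mono) auto
    finally show ?thesis .
  qed
  have "((\<lambda>s. (flow_mean \<Phi> s - flow_mean \<Phi> t) / (s - t)) \<longlongrightarrow> (\<integral>x. d t x \<partial>F)) (at t within S)"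
    unfolding tendsto_at_iff_sequentially comp_def
  proof (intro allI impI)
    fix X assume X: "\<forall>i. X i \<in> S - {t}" "X \<longlonglongrightarrow> t"
    have "(\<lambda>i. \<integral>x. (\<Phi> (X i powr \<mu> * x) - \<Phi> (t powr \<mu> * x)) / (X i - t) \<partial>F) \<longlonglongrightarrow> (\<integral>x. d t x \<partial>F)"
    proof (rule integral_dominated_convergence[where w="\<lambda>_. \<mu> / (t / 2) * max Y 0"])
      show "AE x in F. (\<lambda>i. (\<Phi> (X i powr \<mu> * x) - \<Phi> (t powr \<mu> * x)) / (X i - t)) \<longlonglongrightarrow> d t x"
      proof (intro AE_I2)
        fix x
        have "((\<lambda>s. (\<Phi> (s powr \<mu> * x) - \<Phi> (t powr \<mu> * x)) / (s - t)) \<longlongrightarrow> d t x) (at t within S)"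
          using has_field_derivative_at_within[OF dx[OF \<open>t > 0\<close>]] by (simp add: has_field_derivative_iff)
        then show "(\<lambda>i. (\<Phi> (X i powr \<mu> * x) - \<Phi> (t powr \<mu> * x)) / (X i - t)) \<longlonglongrightarrow> d t x"
          using X unfolding tendsto_at_iff_sequentially comp_def by blast
      qed
      show "AE x in F. norm ((\<Phi> (X i powr \<mu> * x) - \<Phi> (t powr \<mu> * x)) / (X i - t)) \<le> \<mu> / (t / 2) * max Y 0" for i
        using support
      proof eventually_elim
        case (elim x)
        have "norm (\<Phi> (X i powr \<mu> * x) - \<Phi> (t powr \<mu> * x)) \<le> \<mu> / (t / 2) * max Y 0 * norm (X i - t)"
        proof (rule field_differentiable_bound[OF S(2), of "\<lambda>s. \<Phi> (s powr \<mu> * x)" "\<lambda>s. d s x"])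
          fix s assume "s \<in> S"
          then show "((\<lambda>s. \<Phi> (s powr \<mu> * x)) has_real_derivative d s x) (at s within S)"
            using S(4)[OF \<open>s \<in> S\<close>] by (intro has_field_derivative_at_within[OF dx]) simp
          show "norm (d s x) \<le> \<mu> / (t / 2) * max Y 0"
            using dbound[OF \<open>s \<in> S\<close> elim] by simp
        qed (use X S(3) in auto)
        moreover have "0 < norm (X i - t)" using X(1) by auto
        ultimately show ?case by (simp only: norm_divide pos_divide_le_eq)
      qed
    qed (auto)
    moreover have "(\<integral>x. (\<Phi> (X i powr \<mu> * x) - \<Phi> (t powr \<mu> * x)) / (X i - t) \<partial>F) =
        (flow_mean \<Phi> (X i) - flow_mean \<Phi> t) / (X i - t)" for i
      unfolding flow_mean_def integral_divide_zero
      by (subst Bochner_Integration.integral_diff[OF int int]) (rule refl)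
    ultimately show "(\<lambda>i. (flow_mean \<Phi> (X i) - flow_mean \<Phi> t) / (X i - t)) \<longlonglongrightarrow> (\<integral>x. d t x \<partial>F)"
      by (simp only:)
  qed
  then have "(flow_mean \<Phi> has_real_derivative (\<integral>x. d t x \<partial>F)) (at t)"
    unfolding has_field_derivative_iff at_within_open[OF S(3,1)] .
  moreover have "(\<integral>x. d t x \<partial>F) = (1 / t) * (\<integral>x. growth (power_kernel \<sigma>) (\<lambda>y. \<Phi> (t powr \<mu> * y)) x \<partial>F)"
  proof -
    define l where "l = t powr \<mu>"
    have l: "l > 0" using \<open>t > 0\<close> by (simp add: l_def)
    have "\<mu> * (\<integral>x. x * (g (l * x) * l) \<partial>F) = (\<integral>x. - growth (power_kernel \<sigma>) (\<lambda>y. \<Phi> (l * y)) x \<partial>F)"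
    proof (rule stationary[where M = "M / l"])
      show "continuous_on UNIV (\<lambda>x. g (l * x) * l)"
        by (intro continuous_intros continuous_on_compose2[OF g(1)]) auto
      show "((\<lambda>y. \<Phi> (l * y)) has_real_derivative - (g (l * x) * l)) (at x)" for x
        using DERIV_chain2[OF der[of "l * x"] DERIV_cmult_Id[of l x UNIV]] by simp
    qed (use l g(2) D(5) in \<open>auto simp: divide_le_eq mult.commute\<close>)
    then have eq: "\<mu> * (\<integral>x. x * (g (l * x) * l) \<partial>F) = - (\<integral>x. growth (power_kernel \<sigma>) (\<lambda>y. \<Phi> (l * y)) x \<partial>F)"
      unfolding Bochner_Integration.integral_minus .
    have "(\<integral>x. d t x \<partial>F) = (\<integral>x. - (\<mu> / t) * (x * (g (l * x) * l)) \<partial>F)"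
      using \<open>t > 0\<close> by (intro Bochner_Integration.integral_cong) (simp_all add: d_def l_def powr_diff)
    also have "\<dots> = - (1 / t) * (\<mu> * (\<integral>x. x * (g (l * x) * l) \<partial>F))"
      unfolding integral_mult_right_zero by simp
    also have "\<dots> = (1 / t) * (\<integral>x. growth (power_kernel \<sigma>) (\<lambda>y. \<Phi> (l * y)) x \<partial>F)"
      unfolding eq by simp
    finally show ?thesis by (simp add: l_def)
  qed
  ultimately show ?thesis by simp
qed

end

section \<open>Consistency of the self-similar flow with the kernel G\<close>

context flow
begin

text \<open>Since \<mu> (\<sigma> - 5/3) = 1, the factor of \<open>growth_scale\<close> at l =
  t^\<mu> is 1/t, as in \<open>flow_mean_derivative\<close>. The two expressions therefore differ by
  1/t times the quantity estimated in \<open>growth_consistency\<close>.\<close>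

lemma flow_mean_growth:
  assumes "t > 0"
  shows "flow_mean (growth G \<phi>) t =
    (1 / t) * (\<integral>x. growth (rescaled_kernel (t powr \<mu>)) (\<lambda>y. \<phi> (t powr \<mu> * y)) x \<partial>F)"
proof -
  have "(t powr \<mu>) powr (5/3 - \<sigma>) = t powr (- (\<mu> * (\<sigma> - 5/3)))"
    unfolding powr_powr by (simp add: algebra_simps)
  also have "\<dots> = 1 / t" unfolding mu_pos(2) using assms by (simp add: powr_minus divide_inverse)
  finally have "growth G \<phi> (t powr \<mu> * x) =
      (1 / t) * growth (rescaled_kernel (t powr \<mu>)) (\<lambda>y. \<phi> (t powr \<mu> * y)) x" for x
    using growth_scale[of "t powr \<mu>" G \<phi> x \<sigma>] G_zero assms
    by (simp add: rescaled_kernel_def[abs_def])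
  then show ?thesis by (simp add: flow_mean_def)
qed

text \<open>A test function vanishing beyond M T^\<mu>, dilated by r^\<mu> with r \<ge> a T,
  vanishes beyond M a^(-\<mu>), a range independent of T. One threshold thus serves all times from a
  T on, and the error \<epsilon> a / r is at most \<epsilon> / T.\<close>

lemma smooth_flow_consistency:
  assumes "0 \<le> M" "0 < a" "0 < \<epsilon>"
  obtains T\<^sub>0 where "0 < T\<^sub>0" "\<And>T \<Phi> g L s t. T\<^sub>0 \<le> T \<Longrightarrow> \<Phi> \<in> decreasing_tests (M * T powr \<mu>) \<Longrightarrow>
    continuous_on UNIV g \<Longrightarrow> (\<And>x. (\<Phi> has_real_derivative - g x) (at x)) \<Longrightarrow> (\<And>x. \<bar>g x\<bar> \<le> L) \<Longrightarrow>
    (\<And>x. x \<ge> M * T powr \<mu> \<Longrightarrow> g x = 0) \<Longrightarrow> a * T \<le> s \<Longrightarrow> s \<le> t \<Longrightarrow>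
    \<bar>flow_mean \<Phi> t - flow_mean \<Phi> s - integral {s..t} (flow_mean (growth G \<Phi>))\<bar> \<le> \<epsilon> / T * (t - s)"
proof -
  have "0 \<le> M * a powr (- \<mu>)" "0 < \<epsilon> * a" using assms by auto
  from growth_consistency[OF this] obtain \<Lambda> where \<Lambda>: "0 < \<Lambda>" "\<And>l \<psi> L. \<Lambda> \<le> l \<Longrightarrow>
    \<psi> \<in> decreasing_tests (M * a powr (- \<mu>)) \<Longrightarrow> 0 \<le> L \<Longrightarrow>
    (\<And>x y. x \<le> y \<Longrightarrow> \<bar>\<psi> y - \<psi> x\<bar> \<le> L * min 1 (y - x)) \<Longrightarrow>
    \<bar>(\<integral>x. growth (power_kernel \<sigma>) \<psi> x \<partial>F) - (\<integral>x. growth (rescaled_kernel l) \<psi> x \<partial>F)\<bar> \<le> \<epsilon> * a"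
    by metis
  \<comment> \<open>Chosen so that \<open>T\<^sub>0 \<le> T\<close> gives (a T)^\<mu> \<ge>
    \<Lambda>.\<close>
  define T\<^sub>0 where "T\<^sub>0 = \<Lambda> powr (1 / \<mu>) / a"
  show ?thesis
  proof (rule that[of T\<^sub>0])
    show "0 < T\<^sub>0" using \<Lambda>(1) \<open>0 < a\<close> by (simp add: T\<^sub>0_def)
    fix T \<Phi> g L s t
    assume T: "T\<^sub>0 \<le> T" and \<Phi>: "\<Phi> \<in> decreasing_tests (M * T powr \<mu>)" and g: "continuous_on UNIV g"
      and der: "\<And>x. (\<Phi> has_real_derivative - g x) (at x)" and L: "\<And>x. \<bar>g x\<bar> \<le> L"
      and g0: "\<And>x. x \<ge> M * T powr \<mu> \<Longrightarrow> g x = 0" and st: "a * T \<le> s" "s \<le> t"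
    note D = decreasing_testsD[OF \<Phi>]
    have B: "\<bar>\<Phi> z\<bar> \<le> 1" for z using D(3,4)[of z] by simp
    have "0 < T" using T \<open>0 < T\<^sub>0\<close> by simp
    then have aT: "0 < a * T" using \<open>0 < a\<close> by simp
    define p where "p r = integral {s..r} (flow_mean (growth G \<Phi>))" for r
    have cont: "continuous_on {s..t} (flow_mean (growth G \<Phi>))"
    proof (rule continuous_on_subset)
      show "continuous_on {0<..} (flow_mean (growth G \<Phi>))"
        by (rule continuous_on_flow_mean[OF continuous_on_growth[OF D(1) B]])
          (rule growth_tests_bound[OF D(6) B D(5)])
    qed (use st aT in auto)
    have bound: "\<bar>(1 / r) * (\<integral>x. growth (power_kernel \<sigma>) (\<lambda>y. \<Phi> (r powr \<mu> * y)) x \<partial>F)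
        - flow_mean (growth G \<Phi>) r\<bar> \<le> \<epsilon> / T" if r: "a * T \<le> r" for r
    proof -
      have "0 < r" using aT r by linarith
      define l where "l = r powr \<mu>"
      have l: "0 < l" "(a * T) powr \<mu> \<le> l"
        using \<open>0 < r\<close> aT r mu_pos by (auto simp: l_def intro: powr_mono2)
      have "\<Lambda> = (\<Lambda> powr (1 / \<mu>)) powr \<mu>" using \<Lambda>(1) mu_pos by (simp add: powr_powr)
      also have "\<Lambda> powr (1 / \<mu>) \<le> a * T" using T \<open>0 < a\<close> by (simp add: T\<^sub>0_def field_simps)
      then have "(\<Lambda> powr (1 / \<mu>)) powr \<mu> \<le> (a * T) powr \<mu>" using mu_pos by (intro powr_mono2) auto
      finally have "\<Lambda> \<le> l" using l by linarith
      have "\<bar>(\<integral>x. growth (power_kernel \<sigma>) (\<lambda>y. \<Phi> (l * y)) x \<partial>F)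
          - (\<integral>x. growth (rescaled_kernel l) (\<lambda>y. \<Phi> (l * y)) x \<partial>F)\<bar> \<le> \<epsilon> * a"
      proof (rule \<Lambda>(2)[OF \<open>\<Lambda> \<le> l\<close>])
        have "\<Phi> (l * x) = 0" if "M * a powr - \<mu> \<le> x" for x
        proof (rule D(5))
          have "M * T powr \<mu> = (a * T) powr \<mu> * (M * a powr - \<mu>)"
            using \<open>0 < a\<close> \<open>0 < T\<close> by (simp add: powr_mult powr_minus)
          also have "\<dots> \<le> l * x" using l that \<open>0 \<le> M\<close> by (intro mult_mono) auto
          finally show "M * T powr \<mu> \<le> l * x" .
        qed
        moreover have "antimono (\<lambda>y. \<Phi> (l * y))"
          using l by (intro antimonoI D(2) mult_left_mono) auto
        moreover have "continuous_on UNIV (\<lambda>y. \<Phi> (l * y))"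
          by (intro continuous_on_compose2[OF D(1)] continuous_intros) auto
        ultimately show "(\<lambda>y. \<Phi> (l * y)) \<in> decreasing_tests (M * a powr - \<mu>)"
          using D(3) by (simp add: decreasing_tests_def)
        have "0 \<le> L" using L[of 0] by linarith
        then show "0 \<le> 1 + L * l" using l by simp
        fix x y :: real assume "x \<le> y"
        have "norm (\<Phi> (l * y) - \<Phi> (l * x)) \<le> L * norm (l * y - l * x)"
          by (rule field_differentiable_bound[of UNIV \<Phi> "\<lambda>x. - g x"]) (use der L in auto)
        then have 1: "\<bar>\<Phi> (l * y) - \<Phi> (l * x)\<bar> \<le> L * l * (y - x)"
          using l \<open>x \<le> y\<close> by (simp add: abs_mult flip: right_diff_distrib)
        have 2: "\<bar>\<Phi> (l * y) - \<Phi> (l * x)\<bar> \<le> 1"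
          using D(3,4)[of "l * x"] D(3,4)[of "l * y"] by linarith
        show "\<bar>\<Phi> (l * y) - \<Phi> (l * x)\<bar> \<le> (1 + L * l) * min 1 (y - x)"
        proof (cases "y - x \<le> 1")
          case True
          then show ?thesis using 1 \<open>x \<le> y\<close> by (simp add: distrib_right)
        next
          case False
          have "0 \<le> L * l" using \<open>0 \<le> L\<close> l by simp
          then show ?thesis using 2 False by simp
        qed
      qed
      then have "\<bar>(1 / r) * ((\<integral>x. growth (power_kernel \<sigma>) (\<lambda>y. \<Phi> (l * y)) x \<partial>F)
          - (\<integral>x. growth (rescaled_kernel l) (\<lambda>y. \<Phi> (l * y)) x \<partial>F))\<bar> \<le> (1 / r) * (\<epsilon> * a)"
        unfolding abs_mult using \<open>0 < r\<close> by (intro mult_mono) auto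
      also have "\<dots> \<le> (1 / (a * T)) * (\<epsilon> * a)"
        using r aT \<open>0 < \<epsilon>\<close> \<open>0 < a\<close> by (intro mult_right_mono divide_left_mono) auto
      also have "\<dots> = \<epsilon> / T" using \<open>0 < a\<close> by simp
      finally show ?thesis
        using flow_mean_growth[OF \<open>0 < r\<close>, of \<Phi>] by (simp add: l_def right_diff_distrib)
    qed
    have "norm ((flow_mean \<Phi> t - p t) - (flow_mean \<Phi> s - p s)) \<le> \<epsilon> / T * norm (t - s)"
    proof (rule field_differentiable_bound[of "{s..t}" "\<lambda>r. flow_mean \<Phi> r - p r"
        "\<lambda>r. (1 / r) * (\<integral>x. growth (power_kernel \<sigma>) (\<lambda>y. \<Phi> (r powr \<mu> * y)) x \<partial>F) - flow_mean (growth G \<Phi>) r"])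
      fix r assume r: "r \<in> {s..t}"
      then have "0 < r" using st aT by auto
      have "(p has_real_derivative flow_mean (growth G \<Phi>) r) (at r within {s..t})"
        unfolding p_def by (rule integral_has_real_derivative[OF cont r])
      then show "((\<lambda>r. flow_mean \<Phi> r - p r) has_field_derivative
          (1 / r) * (\<integral>x. growth (power_kernel \<sigma>) (\<lambda>y. \<Phi> (r powr \<mu> * y)) x \<partial>F) - flow_mean (growth G \<Phi>) r)
          (at r within {s..t})"
        by (intro DERIV_diff has_field_derivative_at_within[OF flow_mean_derivative[OF \<Phi> g g0 der \<open>0 < r\<close>]])
      show "norm ((1 / r) * (\<integral>x. growth (power_kernel \<sigma>) (\<lambda>y. \<Phi> (r powr \<mu> * y)) x \<partial>F) - flow_mean (growth G \<Phi>) r) \<le> \<epsilon> / T"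
        using bound[of r] r st by simp
    qed (use st in auto)
    then show "\<bar>flow_mean \<Phi> t - flow_mean \<Phi> s - integral {s..t} (flow_mean (growth G \<Phi>))\<bar> \<le> \<epsilon> / T * (t - s)"
      using st by (simp add: p_def)
  qed
qed

end

context profile
begin

lemma flow_mean_diff_le:
  fixes \<phi> \<psi> :: "real \<Rightarrow> real"
  assumes [measurable]: "\<phi> \<in> borel_measurable borel" "\<psi> \<in> borel_measurable borel"
    and B: "\<And>x. \<bar>\<phi> x\<bar> \<le> B" "\<And>x. \<bar>\<psi> x\<bar> \<le> B'"
    and le: "\<And>x. 0 \<le> x \<Longrightarrow> \<bar>\<phi> x - \<psi> x\<bar> \<le> e"
  shows "\<bar>flow_mean \<phi> t - flow_mean \<psi> t\<bar> \<le> e"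
proof -
  have "\<bar>(\<integral>x. \<phi> (t powr \<mu> * x) \<partial>F) - (\<integral>x. \<psi> (t powr \<mu> * x) \<partial>F)\<bar> \<le> e"
  proof (rule integral_diff_le_on_nonneg[OF finite_measure_axioms _ support])
    show "integrable F (\<lambda>x. \<phi> (t powr \<mu> * x))" by (rule flow_mean_integrable[OF assms(1) B(1)])
    show "integrable F (\<lambda>x. \<psi> (t powr \<mu> * x))" by (rule flow_mean_integrable[OF assms(2) B(2)])
  qed (auto intro: le measure_F_le_1)
  then show ?thesis by (simp add: flow_mean_def)
qed

end

lemma integrable_decreasing_tests:
  assumes "finite_measure N" "sets N = sets borel" "\<phi> \<in> decreasing_tests M"
  shows "integrable N \<phi>"
proof -
  interpret finite_measure N by fact
  note D = decreasing_testsD[OF assms(3)]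
  have "\<phi> \<in> borel_measurable N" using D(6) assms(2) by simp
  moreover have "\<bar>\<phi> z\<bar> \<le> 1" for z using D(3,4)[of z] by simp
  ultimately show ?thesis by (intro integrable_const_bound[where B=1]) auto
qed

context flow
begin

lemma continuous_on_flow_mean_tests:
  assumes "\<phi> \<in> decreasing_tests M"
  shows "continuous_on {0<..} (flow_mean \<phi>)" "continuous_on {0<..} (flow_mean (growth G \<phi>))"
proof -
  note D = decreasing_testsD[OF assms]
  have B: "\<bar>\<phi> z\<bar> \<le> 1" for z using D(3,4)[of z] by simp
  show "continuous_on {0<..} (flow_mean \<phi>)"
    by (rule continuous_on_flow_mean[OF D(1) B])
  have "\<bar>growth G \<phi> x\<bar> \<le> 2 * 1 * rate M 1 * total" for x
    by (rule growth_tests_bound) (use D B in auto)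
  then show "continuous_on {0<..} (flow_mean (growth G \<phi>))"
    by (rule continuous_on_flow_mean[OF continuous_on_growth[OF D(1) B]])
qed

text \<open>Smoothness is removed by approximation at fixed T. The smooth estimate carries no
  derivative bound, and since G has finite total rate the growth term is continuous in the uniform
  norm on the test class. Its constant R depends on T, but the accuracy tends to 0 with T
  fixed.\<close>

lemma flow_consistency:
  assumes "0 \<le> M" "0 < a" "0 < \<epsilon>"
  obtains T\<^sub>0 where "0 < T\<^sub>0" "\<And>T \<phi> s t. T\<^sub>0 \<le> T \<Longrightarrow> \<phi> \<in> decreasing_tests (M * T powr \<mu>) \<Longrightarrow>
    a * T \<le> s \<Longrightarrow> s \<le> t \<Longrightarrow>
    \<bar>flow_mean \<phi> t - flow_mean \<phi> s - integral {s..t} (flow_mean (growth G \<phi>))\<bar> \<le> \<epsilon> / T * (t - s)"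
proof -
  from smooth_flow_consistency[OF assms] obtain T\<^sub>0 where T0: "0 < T\<^sub>0"
    "\<And>T \<Phi> g L s t. T\<^sub>0 \<le> T \<Longrightarrow> \<Phi> \<in> decreasing_tests (M * T powr \<mu>) \<Longrightarrow>
    continuous_on UNIV g \<Longrightarrow> (\<And>x. (\<Phi> has_real_derivative - g x) (at x)) \<Longrightarrow> (\<And>x. \<bar>g x\<bar> \<le> L) \<Longrightarrow>
    (\<And>x. x \<ge> M * T powr \<mu> \<Longrightarrow> g x = 0) \<Longrightarrow> a * T \<le> s \<Longrightarrow> s \<le> t \<Longrightarrow>
    \<bar>flow_mean \<Phi> t - flow_mean \<Phi> s - integral {s..t} (flow_mean (growth G \<Phi>))\<bar> \<le> \<epsilon> / T * (t - s)"
    by metis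
  show ?thesis
  proof (rule that[OF T0(1)])
    fix T \<phi> s t
    assume T: "T\<^sub>0 \<le> T" and \<phi>: "\<phi> \<in> decreasing_tests (M * T powr \<mu>)" and st: "a * T \<le> s" "s \<le> t"
    define N where "N = M * T powr \<mu>"
    define R where "R = rate N 1 * total"
    have "0 \<le> R" using total_nonneg by (simp add: R_def)
    have "0 < s" using T T0(1) st(1) \<open>0 < a\<close> by (intro less_le_trans[of 0 "a * T" s]) auto
    note D = decreasing_testsD[OF \<phi>, folded N_def]
    have B: "\<bar>\<phi> z\<bar> \<le> 1" for z using D(3,4)[of z] by simp
    show "\<bar>flow_mean \<phi> t - flow_mean \<phi> s - integral {s..t} (flow_mean (growth G \<phi>))\<bar> \<le> \<epsilon> / T * (t - s)"
    proof (rule field_le_epsilon)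
      fix e :: real assume "0 < e"
      \<comment> \<open>k collects the two end point errors and the accumulated growth error, so
        that accuracy e / k costs e in total.\<close>
      define k where "k = 2 + 2 * R * (t - s)"
      have k: "0 < k" unfolding k_def using \<open>0 \<le> R\<close> st by (intro add_pos_nonneg) auto
      define e' where "e' = e / k"
      have "0 < e'" using \<open>0 < e\<close> k by (simp add: e'_def)
      obtain \<Phi> g L where \<Phi>: "\<Phi> \<in> decreasing_tests (M * T powr \<mu>)" and g: "continuous_on UNIV g"
        "\<And>x. (\<Phi> has_real_derivative - g x) (at x)" "\<And>x. \<bar>g x\<bar> \<le> L" "\<And>x. x \<ge> M * T powr \<mu> \<Longrightarrow> g x = 0"
        and close: "\<And>x. 0 \<le> x \<Longrightarrow> \<bar>\<Phi> x - \<phi> x\<bar> \<le> e'"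
        using decreasing_tests_smooth_approx[OF \<phi> \<open>0 < e'\<close>] by metis
      note D' = decreasing_testsD[OF \<Phi>, folded N_def]
      have B': "\<bar>\<Phi> z\<bar> \<le> 1" for z using D'(3,4)[of z] by simp
      have mean: "\<bar>flow_mean \<Phi> r - flow_mean \<phi> r\<bar> \<le> e'" for r
        by (rule flow_mean_diff_le[OF D'(6) D(6) B' B close])
      have source: "\<bar>flow_mean (growth G \<Phi>) r - flow_mean (growth G \<phi>) r\<bar> \<le> 2 * R * e'" for r
      proof (rule flow_mean_diff_le)
        show "growth G \<Phi> \<in> borel_measurable borel" "growth G \<phi> \<in> borel_measurable borel"
          by (intro borel_measurable_continuous_onI continuous_on_growth[OF D'(1) B'] continuous_on_growth[OF D(1) B])+
        show "\<bar>growth G \<Phi> x\<bar> \<le> 2 * 1 * rate N 1 * total" for x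
          by (rule growth_tests_bound) (use D' B' in auto)
        show "\<bar>growth G \<phi> x\<bar> \<le> 2 * 1 * rate N 1 * total" for x
          by (rule growth_tests_bound) (use D B in auto)
        fix x :: real assume "0 \<le> x"
        have "growth G \<Phi> x - growth G \<phi> x = growth G (\<lambda>z. \<Phi> z - \<phi> z) x"
          by (rule growth_diff[OF D'(6) D(6) B' B, symmetric])
        also have "\<bar>\<dots>\<bar> \<le> 2 * e' * rate N 1 * total"
        proof (rule growth_tests_bound)
          show "(\<lambda>z. \<Phi> z - \<phi> z) \<in> borel_measurable borel" using D(6) D'(6) by measurable
        qed (use \<open>0 \<le> x\<close> close D(5) D'(5) in auto)
        finally show "\<bar>growth G \<Phi> x - growth G \<phi> x\<bar> \<le> 2 * R * e'" by (simp add: R_def mult_ac)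
      qed
      have cont: "continuous_on {s..t} (flow_mean (growth G \<Phi>))" "continuous_on {s..t} (flow_mean (growth G \<phi>))"
        using continuous_on_flow_mean_tests(2)[OF \<Phi>] continuous_on_flow_mean_tests(2)[OF \<phi>] \<open>0 < s\<close>
        by (auto intro: continuous_on_subset)
      have "integral {s..t} (flow_mean (growth G \<Phi>)) - integral {s..t} (flow_mean (growth G \<phi>)) =
          integral {s..t} (\<lambda>r. flow_mean (growth G \<Phi>) r - flow_mean (growth G \<phi>) r)"
        by (rule Henstock_Kurzweil_Integration.integral_diff[symmetric]) (intro integrable_continuous_real cont)+
      also have "\<bar>\<dots>\<bar> \<le> 2 * R * e' * (t - s)"
        using integral_bound[of s t "\<lambda>r. flow_mean (growth G \<Phi>) r - flow_mean (growth G \<phi>) r" "2 * R * e'"]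
          source st by (auto intro!: continuous_on_diff cont)
      finally have "\<bar>integral {s..t} (flow_mean (growth G \<Phi>)) - integral {s..t} (flow_mean (growth G \<phi>))\<bar>
          \<le> 2 * R * e' * (t - s)" .
      moreover have "\<bar>flow_mean \<Phi> t - flow_mean \<Phi> s - integral {s..t} (flow_mean (growth G \<Phi>))\<bar> \<le> \<epsilon> / T * (t - s)"
        by (rule T0(2)[OF T \<Phi> g st])
      ultimately have "\<bar>flow_mean \<phi> t - flow_mean \<phi> s - integral {s..t} (flow_mean (growth G \<phi>))\<bar>
          \<le> \<epsilon> / T * (t - s) + (e' + e' + 2 * R * e' * (t - s))"
        using mean[of t] mean[of s] by linarith
      also have "e' + e' + 2 * R * e' * (t - s) = e' * k" by (simp add: k_def algebra_simps)
      also have "e' * k = e" using k by (simp add: e'_def)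
      finally show "\<bar>flow_mean \<phi> t - flow_mean \<phi> s - integral {s..t} (flow_mean (growth G \<phi>))\<bar>
          \<le> \<epsilon> / T * (t - s) + e" .
    qed
  qed
qed

end

text \<open>The solution restricted to finite volumes. Total mass below 1 is allowed at positive
  times, since some mass could sit at infinity; at time 0 there is none.\<close>

locale evolution = flow +
  fixes m :: "real \<Rightarrow> real measure"
  assumes m_finite: "\<And>t. 0 \<le> t \<Longrightarrow> finite_measure (m t)"
    and m_sets: "\<And>t. sets (m t) = sets borel"
    and m_le_1: "\<And>t. 0 \<le> t \<Longrightarrow> measure (m t) UNIV \<le> 1"
    and m_support: "\<And>t. 0 \<le> t \<Longrightarrow> AE x in m t. 0 \<le> x"
    and m_mass: "measure (m 0) UNIV = 1"
    and m_continuous: "\<And>\<phi> M. \<phi> \<in> decreasing_tests M \<Longrightarrow> continuous_on {0..} (\<lambda>t. \<integral>x. \<phi> x \<partial>m t)"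
    and m_evolution: "\<And>\<phi> M T. \<phi> \<in> decreasing_tests M \<Longrightarrow> 0 \<le> T \<Longrightarrow>
      (\<integral>x. \<phi> x \<partial>m T) - (\<integral>x. \<phi> x \<partial>m 0) = integral {0..T} (\<lambda>t. \<integral>x. growth G \<phi> x \<partial>m t)"
begin

text \<open>The added 1 keeps the uniformization constant positive, which makes division by it
  safe.\<close>

definition rate_bound :: "real \<Rightarrow> real" where
  "rate_bound M = rate M 1 * total + 1"

lemma rate_bound_pos: "0 < rate_bound M" "rate M 1 * total \<le> rate_bound M"
  using total_nonneg by (auto simp: rate_bound_def add_nonneg_pos)

lemma smoothed_tests:
  "\<phi> \<in> decreasing_tests M \<Longrightarrow> smoothed (rate_bound M) \<phi> \<in> decreasing_tests M"
  by (rule smoothed_decreasing_tests) (use rate_bound_pos in auto)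

lemma growth_eq_smoothed: "growth G \<phi> x = rate_bound M * (smoothed (rate_bound M) \<phi> x - \<phi> x)"
  using rate_bound_pos(1)[of M] by (simp add: smoothed_def)

lemma integral_growth_m:
  assumes "\<phi> \<in> decreasing_tests M" "0 \<le> t"
  shows "(\<integral>x. growth G \<phi> x \<partial>m t) =
    rate_bound M * ((\<integral>x. smoothed (rate_bound M) \<phi> x \<partial>m t) - (\<integral>x. \<phi> x \<partial>m t))"
  unfolding growth_eq_smoothed[where M = M] integral_mult_right_zero
  by (subst Bochner_Integration.integral_diff)
    (rule refl integrable_decreasing_tests[OF m_finite[OF assms(2)] m_sets] smoothed_tests assms(1))+

lemma flow_mean_growth_smoothed:
  assumes "\<phi> \<in> decreasing_tests M"
  shows "flow_mean (growth G \<phi>) t =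
    rate_bound M * (flow_mean (smoothed (rate_bound M) \<phi>) t - flow_mean \<phi> t)"
proof -
  have int: "integrable F (\<lambda>x. \<psi> (t powr \<mu> * x))" if "\<psi> \<in> decreasing_tests M" for \<psi>
  proof (rule flow_mean_integrable)
    show "\<bar>\<psi> x\<bar> \<le> 1" for x using decreasing_testsD(3,4)[OF that, of x] by simp
  qed (rule decreasing_testsD[OF that])
  show ?thesis
    unfolding flow_mean_def growth_eq_smoothed[where M = M]
    by (subst integral_mult_right_zero, subst Bochner_Integration.integral_diff) (auto intro: int assms smoothed_tests)
qed

lemma continuous_on_growth_m:
  assumes "\<phi> \<in> decreasing_tests M"
  shows "continuous_on {0..} (\<lambda>t. \<integral>x. growth G \<phi> x \<partial>m t)"
proof -
  have "continuous_on {0..} (\<lambda>t. rate_bound M * ((\<integral>x. smoothed (rate_bound M) \<phi> x \<partial>m t) - (\<integral>x. \<phi> x \<partial>m t)))"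
    by (intro continuous_intros m_continuous[OF assms] m_continuous[OF smoothed_tests[OF assms]])
  then show ?thesis by (rule continuous_on_eq) (simp add: integral_growth_m[OF assms])
qed

lemma m_evolution_between:
  assumes \<phi>: "\<phi> \<in> decreasing_tests M" and st: "0 \<le> s" "s \<le> t"
  shows "(\<integral>x. \<phi> x \<partial>m t) - (\<integral>x. \<phi> x \<partial>m s) = integral {s..t} (\<lambda>t. \<integral>x. growth G \<phi> x \<partial>m t)"
proof -
  have "(\<lambda>t. \<integral>x. growth G \<phi> x \<partial>m t) integrable_on {0..t}"
    by (intro integrable_continuous_real continuous_on_subset[OF continuous_on_growth_m[OF \<phi>]]) auto
  from Henstock_Kurzweil_Integration.integral_combine[OF st this]
  show ?thesis using m_evolution[OF \<phi>, of s] m_evolution[OF \<phi>, of t] st by simp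
qed

text \<open>The sign sg covers both orderings, since the maximum principle bounds a discrepancy only
  from above. The clocks started at \<open>s\<^sub>0\<close> and \<open>s\<^sub>1\<close> run in
  parallel for the time \<tau>; their offset is the time shift.\<close>

lemma comparison_with_flow:
  fixes sg :: real
  assumes cons: "\<And>\<phi> s t. \<phi> \<in> decreasing_tests M \<Longrightarrow> s\<^sub>1 \<le> s \<Longrightarrow> s \<le> t \<Longrightarrow>
      \<bar>flow_mean \<phi> t - flow_mean \<phi> s - integral {s..t} (flow_mean (growth G \<phi>))\<bar> \<le> \<delta> * (t - s)"
    and "0 \<le> s\<^sub>0" "0 < s\<^sub>1" "0 \<le> \<tau>" "0 \<le> \<delta>" "0 \<le> \<delta>\<^sub>0" and sg: "sg = 1 \<or> sg = -1"
    and init: "\<And>\<phi>. \<phi> \<in> decreasing_tests M \<Longrightarrow> sg * ((\<integral>x. \<phi> x \<partial>m s\<^sub>0) - flow_mean \<phi> s\<^sub>1) \<le> \<delta>\<^sub>0"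
    and \<phi>: "\<phi> \<in> decreasing_tests M"
  shows "sg * ((\<integral>x. \<phi> x \<partial>m (s\<^sub>0 + \<tau>)) - flow_mean \<phi> (s\<^sub>1 + \<tau>)) \<le> \<delta>\<^sub>0 + \<delta> * \<tau>"
proof -
  define C where "C = rate_bound M"
  define d where "d \<psi> r = sg * ((\<integral>x. \<psi> x \<partial>m (s\<^sub>0 + r)) - flow_mean \<psi> (s\<^sub>1 + r))" for \<psi> r
  have cont: "continuous_on {0..\<tau>} (d \<psi>)" if "\<psi> \<in> decreasing_tests M" for \<psi>
    unfolding d_def
    by (intro continuous_intros continuous_on_compose2[OF m_continuous[OF that]]
      continuous_on_compose2[OF continuous_on_flow_mean_tests(1)[OF that]])
      (use \<open>0 \<le> s\<^sub>0\<close> \<open>0 < s\<^sub>1\<close> in auto)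
  have "d \<phi> \<tau> \<le> \<delta>\<^sub>0 + \<delta> * \<tau>"
  proof (rule comparison[where S = "decreasing_tests M" and U = "smoothed C" and C = C and T = \<tau> and d = d])
    show "0 \<le> C" using rate_bound_pos(1)[of M] by (simp add: C_def)
    show "smoothed C \<psi> \<in> decreasing_tests M" if "\<psi> \<in> decreasing_tests M" for \<psi>
      unfolding C_def using that by (rule smoothed_tests)
    show "continuous_on {0..\<tau>} (d \<psi>)" if "\<psi> \<in> decreasing_tests M" for \<psi> by (rule cont[OF that])
    show "d \<psi> 0 \<le> \<delta>\<^sub>0" if "\<psi> \<in> decreasing_tests M" for \<psi>
      using init[OF that] by (simp add: d_def)
    show "d \<psi> t \<le> 2" if \<psi>: "\<psi> \<in> decreasing_tests M" and t: "0 \<le> t" "t \<le> \<tau>" for \<psi> and t :: real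
    proof -
      note D = decreasing_testsD[OF \<psi>]
      have t0: "0 \<le> s\<^sub>0 + t" using t \<open>0 \<le> s\<^sub>0\<close> by simp
      interpret m: finite_measure "m (s\<^sub>0 + t)" by (rule m_finite[OF t0])
      have "(\<integral>x. \<psi> x \<partial>m (s\<^sub>0 + t)) \<le> (\<integral>x. 1 \<partial>m (s\<^sub>0 + t))"
        by (intro integral_mono integrable_decreasing_tests[OF m.finite_measure_axioms m_sets \<psi>]) (auto simp: D)
      also have "\<dots> \<le> 1" using m_le_1[OF t0] sets_eq_imp_space_eq[OF m_sets[of "s\<^sub>0 + t"]] by simp
      finally have 1: "(\<integral>x. \<psi> x \<partial>m (s\<^sub>0 + t)) \<le> 1" .
      have 2: "0 \<le> (\<integral>x. \<psi> x \<partial>m (s\<^sub>0 + t))" "0 \<le> flow_mean \<psi> (s\<^sub>1 + t)"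
        unfolding flow_mean_def using D(4) by (auto intro!: Bochner_Integration.integral_nonneg)
      have 3: "\<bar>flow_mean \<psi> (s\<^sub>1 + t) - flow_mean (\<lambda>_. 0) (s\<^sub>1 + t)\<bar> \<le> 1"
        by (rule flow_mean_diff_le[where B = 1 and B' = 0])
          (use D(3,4,6) in \<open>auto simp: abs_le_iff intro: order_trans[of "- \<psi> _" 0 1]\<close>)
      show ?thesis using 1 2 3 sg by (auto simp: d_def flow_mean_def)
    qed
    show "d \<psi> t - d \<psi> s \<le> integral {s..t} (\<lambda>r. C * (d (smoothed C \<psi>) r - d \<psi> r)) + \<delta> * (t - s)"
      if \<psi>: "\<psi> \<in> decreasing_tests M" and st: "0 \<le> s" "s \<le> t" "t \<le> \<tau>" for \<psi> s t
    proof -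
      define A where "A r = (\<integral>x. growth G \<psi> x \<partial>m r)" for r
      define B where "B = flow_mean (growth G \<psi>)"
      have contA: "continuous_on {s..t} (\<lambda>r. A (s\<^sub>0 + r))"
        unfolding A_def by (intro continuous_intros continuous_on_compose2[OF continuous_on_growth_m[OF \<psi>]])
          (use st \<open>0 \<le> s\<^sub>0\<close> in auto)
      have contB: "continuous_on {s..t} (\<lambda>r. B (s\<^sub>1 + r))"
        unfolding B_def by (intro continuous_intros continuous_on_compose2[OF continuous_on_flow_mean_tests(2)[OF \<psi>]])
          (use st \<open>0 < s\<^sub>1\<close> in auto)
      have eqA: "(\<integral>x. \<psi> x \<partial>m (s\<^sub>0 + t)) - (\<integral>x. \<psi> x \<partial>m (s\<^sub>0 + s)) = integral {s..t} (\<lambda>r. A (s\<^sub>0 + r))"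
        using m_evolution_between[OF \<psi>, of "s\<^sub>0 + s" "s\<^sub>0 + t"] st \<open>0 \<le> s\<^sub>0\<close>
          integral_shift_Icc_real[of s t A s\<^sub>0] by (simp add: A_def[abs_def] comp_def add.commute)
      have eqB: "integral {s\<^sub>1 + s..s\<^sub>1 + t} B = integral {s..t} (\<lambda>r. B (s\<^sub>1 + r))"
        using integral_shift_Icc_real[of s t B s\<^sub>1] by (simp add: comp_def add.commute)
      have "\<bar>flow_mean \<psi> (s\<^sub>1 + t) - flow_mean \<psi> (s\<^sub>1 + s) - integral {s..t} (\<lambda>r. B (s\<^sub>1 + r))\<bar> \<le> \<delta> * (t - s)"
        using cons[OF \<psi>, of "s\<^sub>1 + s" "s\<^sub>1 + t"] st unfolding B_def[symmetric] eqB by simp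
      then have "d \<psi> t - d \<psi> s \<le> sg * (integral {s..t} (\<lambda>r. A (s\<^sub>0 + r)) - integral {s..t} (\<lambda>r. B (s\<^sub>1 + r))) + \<delta> * (t - s)"
        using sg eqA by (auto simp: d_def)
      also have "integral {s..t} (\<lambda>r. A (s\<^sub>0 + r)) - integral {s..t} (\<lambda>r. B (s\<^sub>1 + r)) =
          integral {s..t} (\<lambda>r. A (s\<^sub>0 + r) - B (s\<^sub>1 + r))"
        by (rule Henstock_Kurzweil_Integration.integral_diff[symmetric]) (intro integrable_continuous_real contA contB)+
      also have "sg * integral {s..t} (\<lambda>r. A (s\<^sub>0 + r) - B (s\<^sub>1 + r)) =
          integral {s..t} (\<lambda>r. sg * (A (s\<^sub>0 + r) - B (s\<^sub>1 + r)))"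
        by simp
      \<comment> \<open>Both growth terms have the form C (U - 1) with the same U, so the equation
        for d closes up to the consistency error.\<close>
      also have "\<dots> = integral {s..t} (\<lambda>r. C * (d (smoothed C \<psi>) r - d \<psi> r))"
      proof (rule Henstock_Kurzweil_Integration.integral_cong)
        fix r assume "r \<in> {s..t}"
        then have "0 \<le> s\<^sub>0 + r" using st \<open>0 \<le> s\<^sub>0\<close> by simp
        then show "sg * (A (s\<^sub>0 + r) - B (s\<^sub>1 + r)) = C * (d (smoothed C \<psi>) r - d \<psi> r)"
          unfolding A_def B_def C_def d_def
          by (simp add: integral_growth_m[OF \<psi>] flow_mean_growth_smoothed[OF \<psi>] algebra_simps)
      qed
      finally show ?thesis .
    qed
  qed (use assms in auto)
  then show ?thesis by (simp add: d_def)
qed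

end

subsection \<open>Convergence on decreasing test functions\<close>

lemma decreasing_tests_mono: "M \<le> N \<Longrightarrow> decreasing_tests M \<subseteq> decreasing_tests N"
  by (auto simp: decreasing_tests_def)

lemma decreasing_tests_scale:
  assumes "\<phi> \<in> decreasing_tests M" "0 < l"
  shows "(\<lambda>x. \<phi> (x / l)) \<in> decreasing_tests (M * l)"
proof -
  note D = decreasing_testsD[OF assms(1)]
  have "continuous_on UNIV (\<lambda>x. \<phi> (x / l))"
    by (intro continuous_on_compose2[OF D(1)] continuous_intros) (use assms in auto)
  moreover have "antimono (\<lambda>x. \<phi> (x / l))"
    using assms(2) by (intro antimonoI D(2) divide_right_mono) auto
  moreover have "\<phi> (x / l) = 0" if "M * l \<le> x" for x
    using that assms(2) by (intro D(5)) (simp add: pos_le_divide_eq)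
  ultimately show ?thesis using D(3) by (simp add: decreasing_tests_def)
qed

text \<open>R separates the measures when N1 has little mass below it and N2 little above. Then a
  decreasing \<phi> is at most \<phi> R for most of N1 and at least \<phi> R for most of N2. The
  bound is uniform in \<phi>, as the initial condition of the comparison demands.\<close>

lemma tests_integral_diff_le:
  assumes N1: "finite_measure N1" "sets N1 = sets borel" "measure N1 UNIV \<le> 1"
    and N2: "finite_measure N2" "sets N2 = sets borel" "measure N2 UNIV \<le> 1"
    and \<phi>: "\<phi> \<in> decreasing_tests M"
  shows "(\<integral>x. \<phi> x \<partial>N1) - (\<integral>x. \<phi> x \<partial>N2) \<le> measure N1 {..R} + (1 - measure N2 {..R})"
proof -
  interpret N1: finite_measure N1 by fact
  interpret N2: finite_measure N2 by fact
  note D = decreasing_testsD[OF \<phi>]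
  note sp = sets_eq_imp_space_eq[OF N1(2)] sets_eq_imp_space_eq[OF N2(2)]
  have "(\<integral>x. \<phi> x \<partial>N1) \<le> (\<integral>x. indicator {..R} x + \<phi> R \<partial>N1)"
  proof (rule integral_mono)
    show "integrable N1 (\<lambda>x. indicator {..R} x + \<phi> R)"
      by (intro Bochner_Integration.integrable_add integrable_real_indicator) (auto simp: N1(2) less_top[symmetric])
    show "\<phi> x \<le> indicator {..R} x + \<phi> R" for x
      using D(3)[of x] D(4)[of R] D(2)[of R x] by (cases "x \<le> R") auto
  qed (rule integrable_decreasing_tests[OF N1(1,2) \<phi>])
  also have "\<dots> = measure N1 {..R} + \<phi> R * measure N1 UNIV"
    by (subst Bochner_Integration.integral_add) (auto simp: N1(2) sp less_top[symmetric])
  also have "\<dots> \<le> measure N1 {..R} + \<phi> R * 1"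
    using N1(3) D(4) by (intro add_left_mono mult_left_mono) auto
  finally have 1: "(\<integral>x. \<phi> x \<partial>N1) \<le> measure N1 {..R} + \<phi> R" by simp
  have "(\<integral>x. \<phi> R * indicator {..R} x \<partial>N2) \<le> (\<integral>x. \<phi> x \<partial>N2)"
  proof (rule integral_mono)
    show "integrable N2 (\<lambda>x. \<phi> R * indicator {..R} x)"
      by (intro integrable_mult_right integrable_real_indicator) (auto simp: N2(2) less_top[symmetric])
    show "\<phi> R * indicator {..R} x \<le> \<phi> x" for x
      using D(4)[of x] D(2)[of x R] by (cases "x \<le> R") auto
  qed (rule integrable_decreasing_tests[OF N2(1,2) \<phi>])
  then have 2: "\<phi> R * measure N2 {..R} \<le> (\<integral>x. \<phi> x \<partial>N2)" by (simp add: sp)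
  have "measure N2 {..R} \<le> 1"
    using N2.finite_measure_mono[of "{..R}" UNIV] N2 by simp
  then have "\<phi> R * (1 - measure N2 {..R}) \<le> 1 * (1 - measure N2 {..R})"
    using D(3)[of R] by (intro mult_right_mono) auto
  then show ?thesis using 1 2 by (simp add: right_diff_distrib)
qed

lemma finite_measure_atMost_tendsto:
  fixes N :: "real measure"
  assumes "finite_measure N" "sets N = sets borel"
  shows "((\<lambda>R. measure N {..R}) \<longlongrightarrow> measure N UNIV) at_top"
proof -
  interpret finite_measure N by fact
  have "(\<lambda>n. measure N {..real n}) \<longlonglongrightarrow> measure N (\<Union>n. {..real n})"
    by (rule finite_Lim_measure_incseq) (auto simp: assms incseq_def)
  also have "(\<Union>n. {..real n}) = UNIV" using real_arch_simple by auto
  finally have lim: "(\<lambda>n. measure N {..real n}) \<longlonglongrightarrow> measure N UNIV" .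
  show ?thesis
  proof (rule order_tendstoI)
    fix a assume "a < measure N UNIV"
    then obtain n where n: "a < measure N {..real n}"
      using order_tendstoD(1)[OF lim] by (auto simp: eventually_sequentially)
    show "\<forall>\<^sub>F R in at_top. a < measure N {..R}"
      using eventually_ge_at_top[of "real n"]
    proof eventually_elim
      case (elim R)
      then have "measure N {..real n} \<le> measure N {..R}"
        by (intro finite_measure_mono) (auto simp: assms)
      then show ?case using n by simp
    qed
  next
    fix a assume "measure N UNIV < a"
    moreover have "measure N {..R} \<le> measure N UNIV" for R
      by (intro finite_measure_mono) (auto simp: assms)
    ultimately show "\<forall>\<^sub>F R in at_top. measure N {..R} < a"
      by (intro always_eventually allI) (rule le_less_trans)
  qed
qed

definition cutoff :: "real \<Rightarrow> real \<Rightarrow> real" where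
  "cutoff x y = max 0 (min 1 (2 - y / x))"

lemma cutoff_tests:
  assumes "x > 0"
  shows "cutoff x \<in> decreasing_tests (2 * x)"
proof -
  have "continuous_on UNIV (cutoff x)"
    unfolding cutoff_def using assms by (intro continuous_intros) auto
  moreover have "antimono (cutoff x)"
    unfolding cutoff_def using assms
    by (intro antimonoI max.mono min.mono diff_mono divide_right_mono) auto
  ultimately show ?thesis using assms by (simp add: decreasing_tests_def cutoff_def field_simps)
qed

lemma cutoff_eq_1: "x > 0 \<Longrightarrow> y \<le> x \<Longrightarrow> cutoff x y = 1"
  by (simp add: cutoff_def field_simps)

context profile
begin

lemma flow_mean_distr:
  assumes "0 < t" and [measurable]: "\<phi> \<in> borel_measurable borel"
  shows "flow_mean \<phi> t = (\<integral>x. \<phi> x \<partial>distr F borel (\<lambda>x. t powr \<mu> * x))"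
    and "measure (distr F borel (\<lambda>x. t powr \<mu> * x)) {..R} = measure F {..R / t powr \<mu>}"
    and "finite_measure (distr F borel (\<lambda>x. t powr \<mu> * x))"
    and "measure (distr F borel (\<lambda>x. t powr \<mu> * x)) UNIV \<le> 1"
proof -
  show "flow_mean \<phi> t = (\<integral>x. \<phi> x \<partial>distr F borel (\<lambda>x. t powr \<mu> * x))"
    unfolding flow_mean_def by (subst integral_distr) auto
  have "(\<lambda>x. t powr \<mu> * x) -` {..R} \<inter> space F = {..R / t powr \<mu>}"
    using assms sets_eq_imp_space_eq[OF sets_F] by (auto simp: field_simps)
  then show "measure (distr F borel (\<lambda>x. t powr \<mu> * x)) {..R} = measure F {..R / t powr \<mu>}"
    by (subst measure_distr) auto
  show "finite_measure (distr F borel (\<lambda>x. t powr \<mu> * x))"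
    by (rule finite_measure_distr) simp
  show "measure (distr F borel (\<lambda>x. t powr \<mu> * x)) UNIV \<le> 1"
    by (subst measure_distr) (auto intro: measure_F_le_1)
qed

lemma flow_mean_scaled:
  assumes "0 < T" "0 < b"
  shows "flow_mean (\<lambda>x. \<phi> (x / T powr \<mu>)) (b * T) = flow_mean \<phi> b"
  using assms by (simp add: flow_mean_def powr_mult)

lemma no_mass_near_zero: "((\<lambda>x. measure F {..x}) \<longlongrightarrow> 0) (at_right 0)"
proof -
  obtain K where K: "K \<ge> 0" "\<And>x. x > 0 \<Longrightarrow> measure F {..x} \<le> K * x powr (\<sigma> - 5/3)"
    using decay[of 1] by auto
  have "((\<lambda>x. K * x powr (\<sigma> - 5/3)) \<longlongrightarrow> K * 0 powr (\<sigma> - 5/3)) (at_right 0)"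
    using sigma by (intro tendsto_intros) (auto simp: eventually_at_filter)
  then have "((\<lambda>x. K * x powr (\<sigma> - 5/3)) \<longlongrightarrow> 0) (at_right 0)" by simp
  then show ?thesis
    by (rule tendsto_sandwich[OF _ _ tendsto_const, rotated 2])
      (auto simp: eventually_at_filter intro!: always_eventually K(2))
qed

end

section \<open>Escape of the solution from small volumes\<close>

context evolution
begin

text \<open>The time-dependent analogue of \<open>decay_step\<close>. For large x the tail of G
  exceeds v^(-\<sigma>) / 2 from x on, so volumes up to x jump beyond 2 x at rate at least \<kappa>,
  of order x^(5/3 - \<sigma>). The smoothed mass q below x/2 is nonincreasing in time, so by time t
  at least \<kappa> t q(t) has been drained from a total of at most 1.\<close>

lemma no_mass_near_zero_m:
  obtains x\<^sub>0 where "x\<^sub>0 > 0"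
    "\<And>x t. x\<^sub>0 \<le> x \<Longrightarrow> 0 < t \<Longrightarrow> measure (m t) {..x / 2} \<le> 4 * (4 * x) powr (\<sigma> - 5/3) / t"
proof -
  have "\<forall>\<^sub>F v in at_top. 1 / 2 < v powr \<sigma> * G v"
    by (rule order_tendstoD(1)[OF G_limit]) simp
  then obtain v\<^sub>0 where v0: "\<And>v. v\<^sub>0 \<le> v \<Longrightarrow> 1 / 2 < v powr \<sigma> * G v"
    by (auto simp: eventually_at_top_linorder)
  have G_ge: "1 / 2 * v powr (-\<sigma>) \<le> G v" if "max 1 v\<^sub>0 \<le> v" for v
    using v0[of v] that by (simp add: powr_minus field_simps)
  show ?thesis
  proof (rule that[of "max 1 v\<^sub>0"])
    fix x t :: real
    assume x: "max 1 v\<^sub>0 \<le> x" and "0 < t"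
    then have "0 < x" by simp
    note D = decreasing_testsD[OF cutoff_tests[OF \<open>0 < x\<close>]]
    have B: "\<bar>cutoff x z\<bar> \<le> 1" for z using D(3,4)[of z] by simp
    have int: "integrable lborel (\<lambda>v. G v * rate y v * (cutoff x (y + v) - cutoff x y))" for y
      by (rule growth_integrable[OF D(6), where B = 1]) (rule B)
    have le0: "G v * rate y v * (cutoff x (y + v) - cutoff x y) \<le> 0" for v y
      using D(2)[of y "y + v"] by (cases "v \<le> 0") (auto simp: G_zero intro!: mult_nonneg_nonpos)
    \<comment> \<open>The length 2 x of the jump interval [2 x, 4 x] times the lower bound (4
      x)^(2/3 - \<sigma>) / 2 for the jump density on it.\<close>
    define \<kappa> where "\<kappa> = (4 * x) powr (5/3 - \<sigma>) / 4"
    have "0 < \<kappa>" using \<open>0 < x\<close> by (simp add: \<kappa>_def)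
    \<comment> \<open>Two cutoffs are used because wherever \<open>cutoff (x / 2)\<close> is nonzero
      one has y \<le> x, where \<open>cutoff x\<close> equals 1 and its full drop is
      available.\<close>
    have drift: "growth G (cutoff x) y \<le> - (\<kappa> * cutoff (x / 2) y)" if "0 \<le> y" for y
    proof (cases "y \<le> x")
      case True
      have "2 * x * (1 / 2 * (4 * x) powr (2/3 - \<sigma>)) = (4 * x) * (4 * x) powr (2/3 - \<sigma>) / 4" by simp
      also have "\<dots> = \<kappa>"
        using \<open>0 < x\<close> powr_mult_base[of "4 * x" "2/3 - \<sigma>"] by (simp add: \<kappa>_def)
      finally have "\<kappa> = (\<integral>v. indicator {2 * x..4 * x} v * (1 / 2 * (4 * x) powr (2/3 - \<sigma>)) \<partial>lborel)"
        using \<open>0 < x\<close> by simp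
      also have "\<dots> \<le> (\<integral>v. - (G v * rate y v * (cutoff x (y + v) - cutoff x y)) \<partial>lborel)"
      proof (rule integral_mono)
        show "integrable lborel (\<lambda>v. indicator {2 * x..4 * x} v * (1 / 2 * (4 * x) powr (2/3 - \<sigma>)))"
          using \<open>0 < x\<close> by (intro integrable_mult_left integrable_real_indicator) (auto simp: ennreal_less_top)
        show "integrable lborel (\<lambda>v. - (G v * rate y v * (cutoff x (y + v) - cutoff x y)))"
          by (intro Bochner_Integration.integrable_minus int)
        fix v
        show "indicator {2 * x..4 * x} v * (1 / 2 * (4 * x) powr (2/3 - \<sigma>)) \<le>
          - (G v * rate y v * (cutoff x (y + v) - cutoff x y))"
        proof (cases "v \<in> {2 * x..4 * x}")
          case in_int: True
          have "(4 * x) powr (2/3 - \<sigma>) \<le> v powr (2/3 - \<sigma>)"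
            using in_int \<open>0 < x\<close> sigma by (intro powr_mono2') auto
          also have "\<dots> = v powr (-\<sigma>) * v powr (2/3)"
            using in_int \<open>0 < x\<close> by (simp flip: powr_add)
          finally have "1 / 2 * (4 * x) powr (2/3 - \<sigma>) \<le> (1 / 2 * v powr (-\<sigma>)) * v powr (2/3)" by simp
          also have "\<dots> \<le> G v * rate y v"
            using in_int x by (intro mult_mono G_ge rate_ge) auto
          finally have "1 / 2 * (4 * x) powr (2/3 - \<sigma>) \<le> G v * rate y v" .
          moreover have "cutoff x (y + v) = 0" using in_int that by (intro D(5)) auto
          moreover have "cutoff x y = 1" by (rule cutoff_eq_1[OF \<open>0 < x\<close> True])
          ultimately show ?thesis using in_int by simp
        next
          case False
          then show ?thesis using le0[of v y] by simp
        qed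
      qed
      also have "\<dots> = - growth G (cutoff x) y" by (simp add: growth_def)
      finally have "growth G (cutoff x) y \<le> - \<kappa>" by simp
      moreover have "\<kappa> * cutoff (x / 2) y \<le> \<kappa> * 1"
        using \<open>0 < \<kappa>\<close> by (intro mult_left_mono) (auto simp: cutoff_def)
      ultimately show ?thesis by simp
    next
      case False
      have "0 \<le> (\<integral>v. - (G v * rate y v * (cutoff x (y + v) - cutoff x y)) \<partial>lborel)"
        by (rule Bochner_Integration.integral_nonneg) (use le0 in simp)
      then have "growth G (cutoff x) y \<le> 0" by (simp add: growth_def)
      moreover have "cutoff (x / 2) y = 0" using False \<open>0 < x\<close> by (simp add: cutoff_def field_simps)
      ultimately show ?thesis by simp
    qed
    have tests: "cutoff x \<in> decreasing_tests (2 * x)" "cutoff (x / 2) \<in> decreasing_tests x"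
      using cutoff_tests[of x] cutoff_tests[of "x / 2"] \<open>0 < x\<close> by auto
    define q where "q r = (\<integral>y. cutoff (x / 2) y \<partial>m r)" for r
    have growth_int: "integrable (m r) (growth G \<phi>)" if "\<phi> \<in> decreasing_tests M" "0 \<le> r" for \<phi> M r
      unfolding growth_eq_smoothed[where M = M, abs_def]
      by (intro integrable_mult_right Bochner_Integration.integrable_diff
        integrable_decreasing_tests[OF m_finite[OF that(2)] m_sets, where M = M] smoothed_tests that)
    have drift_m: "(\<integral>y. growth G (cutoff x) y \<partial>m r) \<le> - (\<kappa> * q r)" if "0 \<le> r" for r
    proof -
      have "(\<integral>y. growth G (cutoff x) y \<partial>m r) \<le> (\<integral>y. - (\<kappa> * cutoff (x / 2) y) \<partial>m r)"
      proof (rule integral_mono_AE)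
        show "integrable (m r) (growth G (cutoff x))" by (rule growth_int[OF tests(1) that])
        show "integrable (m r) (\<lambda>y. - (\<kappa> * cutoff (x / 2) y))"
          by (intro Bochner_Integration.integrable_minus integrable_mult_right
            integrable_decreasing_tests[OF m_finite[OF that] m_sets tests(2)])
        show "AE y in m r. growth G (cutoff x) y \<le> - (\<kappa> * cutoff (x / 2) y)"
          using m_support[OF that] by eventually_elim (rule drift)
      qed
      then show ?thesis by (simp add: q_def)
    qed
    have q_mono: "q t \<le> q r" if "0 \<le> r" "r \<le> t" for r
    proof -
      note D2 = decreasing_testsD[OF tests(2)]
      have "growth G (cutoff (x / 2)) y \<le> 0" for y
      proof -
        have "0 \<le> - (G v * rate y v * (cutoff (x / 2) (y + v) - cutoff (x / 2) y))" for v
          using D2(2)[of y "y + v"] by (cases "v \<le> 0") (auto simp: G_zero intro!: mult_nonneg_nonpos)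
        then have "0 \<le> (\<integral>v. - (G v * rate y v * (cutoff (x / 2) (y + v) - cutoff (x / 2) y)) \<partial>lborel)"
          by (rule Bochner_Integration.integral_nonneg)
        then show ?thesis by (simp add: growth_def)
      qed
      then have "0 \<le> (\<integral>y. - growth G (cutoff (x / 2)) y \<partial>m u)" for u
        by (intro Bochner_Integration.integral_nonneg) simp
      then have "integral {r..t} (\<lambda>u. \<integral>y. growth G (cutoff (x / 2)) y \<partial>m u) \<le> integral {r..t} (\<lambda>u. 0)"
        by (intro integral_le integrable_continuous_real continuous_on_subset[OF continuous_on_growth_m[OF tests(2)]])
          (use that in auto)
      then show ?thesis
        using m_evolution_between[OF tests(2) that] by (simp add: q_def)
    qed
    have "(\<integral>y. cutoff x y \<partial>m t) - (\<integral>y. cutoff x y \<partial>m 0) = integral {0..t} (\<lambda>r. \<integral>y. growth G (cutoff x) y \<partial>m r)"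
      using m_evolution[OF tests(1), of t] \<open>0 < t\<close> by simp
    also have "\<dots> \<le> integral {0..t} (\<lambda>r. - (\<kappa> * q t))"
    proof (rule integral_le)
      show "(\<lambda>r. \<integral>y. growth G (cutoff x) y \<partial>m r) integrable_on {0..t}"
        by (intro integrable_continuous_real continuous_on_subset[OF continuous_on_growth_m[OF tests(1)]]) auto
      fix r assume r: "r \<in> {0..t}"
      then have "\<kappa> * q t \<le> \<kappa> * q r" using \<open>0 < \<kappa>\<close> by (intro mult_left_mono q_mono) auto
      then show "(\<integral>y. growth G (cutoff x) y \<partial>m r) \<le> - (\<kappa> * q t)" using drift_m[of r] r by simp
    qed auto
    also have "\<dots> = - (\<kappa> * q t * t)" using \<open>0 < t\<close> by simp
    finally have "\<kappa> * q t * t \<le> (\<integral>y. cutoff x y \<partial>m 0) - (\<integral>y. cutoff x y \<partial>m t)" by simp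
    also have "\<dots> \<le> 1 - 0"
    proof (rule diff_mono)
      interpret m0: finite_measure "m 0" by (rule m_finite) simp
      have "(\<integral>y. cutoff x y \<partial>m 0) \<le> (\<integral>y. 1 \<partial>m 0)"
        by (intro integral_mono integrable_decreasing_tests[OF m0.finite_measure_axioms m_sets tests(1)]) (auto simp: D)
      then show "(\<integral>y. cutoff x y \<partial>m 0) \<le> 1"
        using m_mass sets_eq_imp_space_eq[OF m_sets[of 0]] by simp
    qed (auto intro!: Bochner_Integration.integral_nonneg D)
    finally have "q t \<le> 1 / (\<kappa> * t)"
      using \<open>0 < \<kappa>\<close> \<open>0 < t\<close> by (simp add: pos_le_divide_eq mult_ac)
    moreover have "measure (m t) {..x / 2} \<le> q t"
    proof -
      interpret mt: finite_measure "m t" by (rule m_finite) (use \<open>0 < t\<close> in simp)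
      have "(\<integral>y. indicator {..x / 2} y \<partial>m t) \<le> q t"
        unfolding q_def
      proof (rule integral_mono)
        show "integrable (m t) (indicat_real {..x / 2})"
          by (rule integrable_real_indicator) (auto simp: m_sets less_top[symmetric])
        show "integrable (m t) (cutoff (x / 2))"
          by (rule integrable_decreasing_tests[OF mt.finite_measure_axioms m_sets tests(2)])
        show "indicat_real {..x / 2} y \<le> cutoff (x / 2) y" for y
          using cutoff_eq_1[of "x / 2" y] \<open>0 < x\<close> decreasing_testsD(4)[OF tests(2), of y]
          by (cases "y \<le> x / 2") auto
      qed
      then show ?thesis by (simp add: sets_eq_imp_space_eq[OF m_sets])
    qed
    moreover have "1 / (\<kappa> * t) = 4 * (4 * x) powr (\<sigma> - 5/3) / t"
      using powr_minus_divide[of "4 * x" "\<sigma> - 5/3"] by (simp add: \<kappa>_def)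
    ultimately show "measure (m t) {..x / 2} \<le> 4 * (4 * x) powr (\<sigma> - 5/3) / t" by linarith
  qed simp
qed

end

lemma filterlim_powr_at_top:
  fixes p :: real
  assumes "0 < p"
  shows "filterlim (\<lambda>x. x powr p) at_top at_top"
  unfolding filterlim_at_top
proof
  fix Z :: real
  show "\<forall>\<^sub>F x in at_top. Z \<le> x powr p"
    using eventually_ge_at_top[of "max Z 0 powr (1 / p)"]
  proof eventually_elim
    case (elim x)
    then have "(max Z 0 powr (1 / p)) powr p \<le> x powr p" using assms by (intro powr_mono2) auto
    then show ?case using assms by (simp add: powr_powr)
  qed
qed

section \<open>The two one-sided bounds for the rescaled solution\<close>

context evolution
begin

text \<open>Most of the initial mass stays below a fixed R, while the self-similar law at time a T
  is mostly above R, its scale (a T)^\<mu> being unbounded. Running both for the time T ends at (1 +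
  a) T for the self-similar law, and continuity of \<open>flow_mean \<phi>\<close> at 1 pays for the
  shift.\<close>

lemma rescaled_lower:
  assumes \<phi>: "\<phi> \<in> decreasing_tests M" and "0 \<le> M" "0 < \<eta>"
  shows "\<forall>\<^sub>F T in at_top. flow_mean \<phi> 1 - \<eta> \<le> (\<integral>x. \<phi> (x / T powr \<mu>) \<partial>m T)"
proof -
  have "isCont (flow_mean \<phi>) 1"
    using continuous_on_flow_mean_tests(1)[OF \<phi>] by (simp add: continuous_on_eq_continuous_at)
  then obtain d where d: "d > 0" "\<And>b. dist b 1 < d \<Longrightarrow> dist (flow_mean \<phi> b) (flow_mean \<phi> 1) < \<eta> / 4"
    unfolding continuous_at_eps_delta using \<open>0 < \<eta>\<close> by (metis zero_less_divide_iff zero_less_numeral)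
  define a where "a = d / 2"
  have a: "0 < a" "a < d" using d by (auto simp: a_def)
  have near: "flow_mean \<phi> 1 - \<eta> / 4 \<le> flow_mean \<phi> (1 + a)"
  proof -
    have "dist (flow_mean \<phi> (1 + a)) (flow_mean \<phi> 1) < \<eta> / 4"
      using a by (intro d(2)) (simp add: dist_real_def)
    then show ?thesis unfolding dist_real_def by linarith
  qed
  obtain T\<^sub>0 where T0: "0 < T\<^sub>0" "\<And>T \<phi> s t. T\<^sub>0 \<le> T \<Longrightarrow> \<phi> \<in> decreasing_tests (M * T powr \<mu>) \<Longrightarrow>
    a * T \<le> s \<Longrightarrow> s \<le> t \<Longrightarrow>
    \<bar>flow_mean \<phi> t - flow_mean \<phi> s - integral {s..t} (flow_mean (growth G \<phi>))\<bar> \<le> \<eta> / 4 / T * (t - s)"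
    using flow_consistency[OF \<open>0 \<le> M\<close> a(1), of "\<eta> / 4"] \<open>0 < \<eta>\<close> by (metis zero_less_divide_iff zero_less_numeral)
  have fin0: "finite_measure (m 0)" by (rule m_finite) simp
  have "\<forall>\<^sub>F R in at_top. 1 - \<eta> / 8 < measure (m 0) {..R}"
    using order_tendstoD(1)[OF finite_measure_atMost_tendsto[OF fin0 m_sets], of "1 - \<eta> / 8"] m_mass \<open>0 < \<eta>\<close> by simp
  then obtain R\<^sub>0 where R0: "\<forall>R'\<ge>R\<^sub>0. 1 - \<eta> / 8 < measure (m 0) {..R'}"
    unfolding eventually_at_top_linorder by blast
  define R where "R = max 1 R\<^sub>0"
  have R: "0 < R" "1 - \<eta> / 8 < measure (m 0) {..R}"
    using R0 by (auto simp: R_def)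
  have "filterlim (\<lambda>T. R / (a * T) powr \<mu>) (at_right 0) at_top"
    unfolding filterlim_at
  proof
    have "filterlim (\<lambda>T. (a * T) powr \<mu>) at_top at_top"
      using a mu_pos by (intro filterlim_compose[OF filterlim_powr_at_top] filterlim_tendsto_pos_mult_at_top[OF tendsto_const _ filterlim_ident])
    then show "((\<lambda>T. R / (a * T) powr \<mu>) \<longlongrightarrow> 0) at_top"
      by (rule real_tendsto_divide_at_top[OF tendsto_const])
    show "\<forall>\<^sub>F T in at_top. R / (a * T) powr \<mu> \<in> {0<..} \<and> R / (a * T) powr \<mu> \<noteq> 0"
      using eventually_gt_at_top[of 0] by eventually_elim (use R a in simp)
  qed
  from order_tendstoD(2)[OF filterlim_compose[OF no_mass_near_zero this], of "\<eta> / 8"]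
  have "\<forall>\<^sub>F T in at_top. measure F {..R / (a * T) powr \<mu>} < \<eta> / 8" using \<open>0 < \<eta>\<close> by simp
  then show ?thesis
    using eventually_ge_at_top[of T\<^sub>0]
  proof eventually_elim
    case (elim T)
    have "0 < T" using elim T0(1) by simp
    define \<psi> where "\<psi> x = \<phi> (x / T powr \<mu>)" for x
    have \<psi>: "\<psi> \<in> decreasing_tests (M * T powr \<mu>)"
      unfolding \<psi>_def[abs_def] using \<open>0 < T\<close> by (intro decreasing_tests_scale \<phi>) simp
    have aT: "0 < a * T" using a \<open>0 < T\<close> by simp
    have "-1 * ((\<integral>x. \<psi> x \<partial>m (0 + T)) - flow_mean \<psi> (a * T + T)) \<le> \<eta> / 4 + \<eta> / 4 / T * T"
    proof (rule comparison_with_flow[OF _ _ aT _ _ _ _ _ \<psi>])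
      show "\<bar>flow_mean \<phi> t - flow_mean \<phi> s - integral {s..t} (flow_mean (growth G \<phi>))\<bar> \<le> \<eta> / 4 / T * (t - s)"
        if "\<phi> \<in> decreasing_tests (M * T powr \<mu>)" "a * T \<le> s" "s \<le> t" for \<phi> s t
        by (rule T0(2)) (use that elim in auto)
      \<comment> \<open>Two tails of size \<eta>/8 make up the initial discrepancy; consistency and
        the time shift add \<eta>/4 each.\<close>
      show "-1 * ((\<integral>x. \<phi> x \<partial>m 0) - flow_mean \<phi> (a * T)) \<le> \<eta> / 4"
        if \<phi>: "\<phi> \<in> decreasing_tests (M * T powr \<mu>)" for \<phi>
      proof -
        note fd = flow_mean_distr[OF aT decreasing_testsD(6)[OF \<phi>]]
        have "flow_mean \<phi> (a * T) - (\<integral>x. \<phi> x \<partial>m 0) \<le> measure F {..R / (a * T) powr \<mu>} + (1 - measure (m 0) {..R})"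
          unfolding fd(1) fd(2)[symmetric]
          by (rule tests_integral_diff_le[OF fd(3) _ fd(4) fin0 m_sets _ \<phi>]) (auto intro: m_le_1)
        then show ?thesis using R elim by simp
      qed
    qed (use \<open>0 < T\<close> \<open>0 < \<eta>\<close> in auto)
    then have "flow_mean \<psi> ((1 + a) * T) \<le> (\<integral>x. \<psi> x \<partial>m T) + \<eta> / 2"
      using \<open>0 < T\<close> by (simp add: algebra_simps)
    moreover have "flow_mean \<psi> ((1 + a) * T) = flow_mean \<phi> (1 + a)"
      unfolding \<psi>_def using \<open>0 < T\<close> a by (intro flow_mean_scaled) auto
    ultimately show ?case using near \<open>0 < \<eta>\<close> by (simp add: \<psi>_def)
  qed
qed

text \<open>The waiting time s T lets the solution leave the region below \<rho> T^\<mu>, where the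
  initial mass sits for large T, while the self-similar law at time \<kappa> T is mostly still
  inside it. Running both for (1 - s) T ends at the times T and (1 - s + \<kappa>) T.\<close>

lemma rescaled_upper:
  assumes \<phi>: "\<phi> \<in> decreasing_tests M" and "0 \<le> M" "0 < \<eta>"
  shows "\<forall>\<^sub>F T in at_top. (\<integral>x. \<phi> (x / T powr \<mu>) \<partial>m T) \<le> flow_mean \<phi> 1 + \<eta>"
proof -
  have "isCont (flow_mean \<phi>) 1"
    using continuous_on_flow_mean_tests(1)[OF \<phi>] by (simp add: continuous_on_eq_continuous_at)
  then obtain d where d: "d > 0" "\<And>b. dist b 1 < d \<Longrightarrow> dist (flow_mean \<phi> b) (flow_mean \<phi> 1) < \<eta> / 4"
    unfolding continuous_at_eps_delta using \<open>0 < \<eta>\<close> by (metis zero_less_divide_iff zero_less_numeral)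
  define s where "s = min d 1 / 2"
  have s: "0 < s" "s < d" "s < 1" using d by (auto simp: s_def)
  define \<gamma> where "\<gamma> = \<sigma> - 5/3"
  have \<gamma>: "0 < \<gamma>" "\<mu> * \<gamma> = 1" using sigma mu_pos by (auto simp: \<gamma>_def)
  \<comment> \<open>Solves 4 (8 \<rho>)^\<gamma> / s = \<eta> / 8, using 1 / \<gamma> = \<mu>. The
    left side is the bound of \<open>no_mass_near_zero_m\<close> at x = 2 \<rho> T^\<mu> and time s
    T, in which T^(\<mu> \<gamma>) = T cancels.\<close>
  define \<rho> where "\<rho> = (s * \<eta> / 32) powr \<mu> / 8"
  have "0 < \<rho>" using s \<open>0 < \<eta>\<close> by (simp add: \<rho>_def)
  have \<rho>: "4 * (8 * \<rho>) powr \<gamma> / s = \<eta> / 8"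
    using s \<open>0 < \<eta>\<close> \<gamma> by (simp add: \<rho>_def powr_powr)
  have "\<forall>\<^sub>F R in at_top. 1 - \<eta> / 8 < measure F {..R}"
    using order_tendstoD(1)[OF finite_measure_atMost_tendsto[OF finite_measure_axioms sets_F], of "1 - \<eta> / 8"]
      mass \<open>0 < \<eta>\<close> by simp
  then obtain R\<^sub>0 where R0: "\<forall>R'\<ge>R\<^sub>0. 1 - \<eta> / 8 < measure F {..R'}"
    unfolding eventually_at_top_linorder by blast
  define R where "R = max 1 R\<^sub>0"
  have R: "0 < R" "\<And>R'. R \<le> R' \<Longrightarrow> 1 - \<eta> / 8 < measure F {..R'}"
    using R0 by (auto simp: R_def)
  \<comment> \<open>The second entry gives R \<kappa>^\<mu> \<le> \<rho>, so that \<rho> T^\<mu> is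
    at least R in units of the scale (\<kappa> T)^\<mu>; the first keeps the time shift s - \<kappa>
    in [0, d).\<close>
  define \<kappa> where "\<kappa> = min s ((\<rho> / R) powr \<gamma>)"
  have \<kappa>: "0 < \<kappa>" "\<kappa> \<le> s" using s R \<open>0 < \<rho>\<close> by (auto simp: \<kappa>_def)
  have "\<kappa> powr \<mu> \<le> ((\<rho> / R) powr \<gamma>) powr \<mu>"
    using \<kappa> mu_pos by (intro powr_mono2) (auto simp: \<kappa>_def)
  also have "\<dots> = \<rho> / R" using R \<open>0 < \<rho>\<close> \<gamma> by (simp add: powr_powr mult.commute)
  finally have R_le: "R \<le> \<rho> / \<kappa> powr \<mu>" using R \<kappa> by (simp add: field_simps)
  have near: "flow_mean \<phi> (1 - s + \<kappa>) \<le> flow_mean \<phi> 1 + \<eta> / 4"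
  proof -
    have "dist (flow_mean \<phi> (1 - s + \<kappa>)) (flow_mean \<phi> 1) < \<eta> / 4"
      using s \<kappa> by (intro d(2)) (simp add: dist_real_def)
    then show ?thesis unfolding dist_real_def by linarith
  qed
  obtain T\<^sub>0 where T0: "0 < T\<^sub>0" "\<And>T \<phi> s t. T\<^sub>0 \<le> T \<Longrightarrow> \<phi> \<in> decreasing_tests (M * T powr \<mu>) \<Longrightarrow>
    \<kappa> * T \<le> s \<Longrightarrow> s \<le> t \<Longrightarrow>
    \<bar>flow_mean \<phi> t - flow_mean \<phi> s - integral {s..t} (flow_mean (growth G \<phi>))\<bar> \<le> \<eta> / 4 / T * (t - s)"
    using flow_consistency[OF \<open>0 \<le> M\<close> \<kappa>(1), of "\<eta> / 4"] \<open>0 < \<eta>\<close> by (metis zero_less_divide_iff zero_less_numeral)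
  obtain x\<^sub>0 where x0: "x\<^sub>0 > 0"
    "\<And>x t. x\<^sub>0 \<le> x \<Longrightarrow> 0 < t \<Longrightarrow> measure (m t) {..x / 2} \<le> 4 * (4 * x) powr \<gamma> / t"
    using no_mass_near_zero_m unfolding \<gamma>_def by metis
  have "filterlim (\<lambda>T. T powr \<mu>) at_top at_top" using mu_pos by (intro filterlim_powr_at_top)
  then have "\<forall>\<^sub>F T in at_top. x\<^sub>0 / (2 * \<rho>) \<le> T powr \<mu>" by (simp add: filterlim_at_top)
  then show ?thesis
    using eventually_ge_at_top[of T\<^sub>0]
  proof eventually_elim
    case (elim T)
    have "0 < T" using elim T0(1) by simp
    define \<psi> where "\<psi> x = \<phi> (x / T powr \<mu>)" for x
    have \<psi>: "\<psi> \<in> decreasing_tests (M * T powr \<mu>)"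
      unfolding \<psi>_def[abs_def] using \<open>0 < T\<close> by (intro decreasing_tests_scale \<phi>) simp
    have kT: "0 < \<kappa> * T" using \<kappa> \<open>0 < T\<close> by simp
    have "1 * ((\<integral>x. \<psi> x \<partial>m (s * T + (1 - s) * T)) - flow_mean \<psi> (\<kappa> * T + (1 - s) * T))
        \<le> \<eta> / 4 + \<eta> / 4 / T * ((1 - s) * T)"
    proof (rule comparison_with_flow[OF _ _ kT _ _ _ _ _ \<psi>])
      show "\<bar>flow_mean \<phi> t - flow_mean \<phi> r - integral {r..t} (flow_mean (growth G \<phi>))\<bar> \<le> \<eta> / 4 / T * (t - r)"
        if "\<phi> \<in> decreasing_tests (M * T powr \<mu>)" "\<kappa> * T \<le> r" "r \<le> t" for \<phi> r t
        by (rule T0(2)) (use that elim in auto)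
      show "1 * ((\<integral>x. \<phi> x \<partial>m (s * T)) - flow_mean \<phi> (\<kappa> * T)) \<le> \<eta> / 4"
        if \<phi>: "\<phi> \<in> decreasing_tests (M * T powr \<mu>)" for \<phi>
      proof -
        note fd = flow_mean_distr[OF kT decreasing_testsD(6)[OF \<phi>]]
        define Q where "Q = \<rho> * T powr \<mu>"
        have sT: "0 < s * T" "0 \<le> s * T" using s \<open>0 < T\<close> by auto
        have "(\<integral>x. \<phi> x \<partial>m (s * T)) - flow_mean \<phi> (\<kappa> * T) \<le> measure (m (s * T)) {..Q} + (1 - measure F {..Q / (\<kappa> * T) powr \<mu>})"
          unfolding fd(1) fd(2)[symmetric]
          by (rule tests_integral_diff_le[OF m_finite[OF sT(2)] m_sets m_le_1[OF sT(2)] fd(3) _ fd(4) \<phi>]) simp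
        moreover have "measure (m (s * T)) {..Q} \<le> \<eta> / 8"
        proof -
          have "x\<^sub>0 \<le> 2 * Q" using elim \<open>0 < \<rho>\<close> by (simp add: Q_def field_simps)
          from x0(2)[OF this sT(1)] have "measure (m (s * T)) {..Q} \<le> 4 * (8 * Q) powr \<gamma> / (s * T)" by simp
          also have "(8 * Q) powr \<gamma> = (8 * \<rho>) powr \<gamma> * T"
            using \<open>0 < \<rho>\<close> \<open>0 < T\<close> \<gamma> by (simp add: Q_def powr_mult powr_powr)
          also have "4 * ((8 * \<rho>) powr \<gamma> * T) / (s * T) = 4 * (8 * \<rho>) powr \<gamma> / s"
            using \<open>0 < T\<close> by simp
          finally show ?thesis unfolding \<rho> .
        qed
        moreover have "1 - \<eta> / 8 < measure F {..Q / (\<kappa> * T) powr \<mu>}"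
        proof (rule R(2))
          have "Q / (\<kappa> * T) powr \<mu> = \<rho> / \<kappa> powr \<mu>" using \<open>0 < T\<close> \<kappa> by (simp add: Q_def powr_mult)
          then show "R \<le> Q / (\<kappa> * T) powr \<mu>" using R_le by simp
        qed
        ultimately show ?thesis by simp
      qed
    qed (use \<open>0 < T\<close> \<open>0 < \<eta>\<close> s in auto)
    moreover have "s * T + (1 - s) * T = T" "\<kappa> * T + (1 - s) * T = (1 - s + \<kappa>) * T"
      by (auto simp: algebra_simps)
    moreover have "\<eta> / 4 / T * ((1 - s) * T) \<le> \<eta> / 4"
      using \<open>0 < T\<close> \<open>0 < \<eta>\<close> s by (simp add: mult_left_le)
    moreover have "flow_mean \<psi> ((1 - s + \<kappa>) * T) = flow_mean \<phi> (1 - s + \<kappa>)"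
      unfolding \<psi>_def using \<open>0 < T\<close> s \<kappa> by (intro flow_mean_scaled) auto
    ultimately show ?case using near \<open>0 < \<eta>\<close> by (simp add: \<psi>_def)
  qed
qed

theorem rescaled_tests_tendsto:
  assumes "\<phi> \<in> decreasing_tests M"
  shows "((\<lambda>T. \<integral>x. \<phi> (x / T powr \<mu>) \<partial>m T) \<longlongrightarrow> (\<integral>x. \<phi> x \<partial>F)) at_top"
proof -
  have \<phi>: "\<phi> \<in> decreasing_tests (max M 0)"
    using assms decreasing_tests_mono[of M "max M 0"] by auto
  have eq: "flow_mean \<phi> 1 = (\<integral>x. \<phi> x \<partial>F)" by (simp add: flow_mean_def)
  show ?thesis
  proof (rule tendstoI)
    fix e :: real assume "0 < e"
    then have "0 < e / 2" by simp
    from rescaled_lower[OF \<phi> _ this] rescaled_upper[OF \<phi> _ this]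
    have "\<forall>\<^sub>F T in at_top. flow_mean \<phi> 1 - e / 2 \<le> (\<integral>x. \<phi> (x / T powr \<mu>) \<partial>m T)"
      "\<forall>\<^sub>F T in at_top. (\<integral>x. \<phi> (x / T powr \<mu>) \<partial>m T) \<le> flow_mean \<phi> 1 + e / 2" by auto
    then show "\<forall>\<^sub>F T in at_top. dist (\<integral>x. \<phi> (x / T powr \<mu>) \<partial>m T) (\<integral>x. \<phi> x \<partial>F) < e"
    proof eventually_elim
      case (elim T)
      then show ?case using \<open>0 < e\<close> unfolding eq dist_real_def by linarith
    qed
  qed
qed

end

subsection \<open>Smooth test functions\<close>

text \<open>\<open>vderiv\<close> is built on the choice-based \<open>vector_derivative\<close>; an
  explicit tower of derivatives lets its values be identified for all orders by one
  induction.\<close>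

definition derivative_sequence :: "(nat \<Rightarrow> real \<Rightarrow> real) \<Rightarrow> bool" where
  "derivative_sequence D \<longleftrightarrow> (\<forall>k x. (D k has_real_derivative D (Suc k) x) (at x))"

lemma derivative_sequenceD: "derivative_sequence D \<Longrightarrow> (D k has_real_derivative D (Suc k) x) (at x)"
  by (simp add: derivative_sequence_def)

text \<open>
  The polynomial is evaluated at \<open>1/y\<close>, which makes the family closed under differentiation for
  each fixed \<open>n\<close>.
\<close>

definition flat :: "nat \<Rightarrow> real poly \<Rightarrow> real \<Rightarrow> real" where
  "flat n P y = (if 0 < y then y ^ n * poly P (1 / y) * exp (- (1 / y)) else 0)"

text \<open>With u = 1/y, the derivative of y^n P(u) exp(-u) is y^n exp(-u) times n u P(u) + u^2
  (P(u) - P'(u)).\<close>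

definition flat_step :: "nat \<Rightarrow> real poly \<Rightarrow> real poly" where
  "flat_step n P = smult (real n) (pCons 0 P) + pCons 0 (pCons 0 (P - pderiv P))"

lemma tendsto_poly_mult_exp_minus: "((\<lambda>u. poly P u * exp (- u)) \<longlongrightarrow> (0::real)) at_top"
proof -
  have "((\<lambda>u. \<Sum>i\<le>degree P. coeff P i * (u ^ i / exp u)) \<longlongrightarrow> (\<Sum>i\<le>degree P. coeff P i * 0)) at_top"
    by (intro tendsto_sum tendsto_mult tendsto_const tendsto_power_div_exp_0)
  moreover have "(\<Sum>i\<le>degree P. coeff P i * (u ^ i / exp u)) = poly P u * exp (- u)" for u :: real
    by (simp add: poly_altdef sum_distrib_right exp_minus divide_inverse mult.assoc)
  ultimately show ?thesis by simp
qed

lemma flat_tendsto_at_right: "((\<lambda>y. poly P (1 / y) * exp (- (1 / y))) \<longlongrightarrow> (0::real)) (at_right 0)"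
  using filterlim_compose[OF tendsto_poly_mult_exp_minus filterlim_inverse_at_top_right]
  by (simp add: inverse_eq_divide)

lemma flat_derivative: "(flat n P has_real_derivative flat n (flat_step n P) y) (at y)"
proof -
  consider "y < 0" | "y = 0" | "0 < y" by linarith
  then show ?thesis
  proof cases
    case 1
    have "((\<lambda>_. 0) has_real_derivative 0) (at y)" by simp
    then have "(flat n P has_real_derivative 0) (at y)"
      by (rule has_field_derivative_transform_within_open[of _ _ _ "{..<0}"]) (use 1 in \<open>auto simp: flat_def\<close>)
    then show ?thesis using 1 by (simp add: flat_def)
  next
    case 2
    \<comment> \<open>Dividing by y in the difference quotient at 0 multiplies P by u = 1/y, and
      exp(-u) still wins as u grows.\<close>
    have "((\<lambda>y. y ^ n * (poly (pCons 0 P) (1 / y) * exp (- (1 / y)))) \<longlongrightarrow> 0 ^ n * 0) (at_right (0::real))"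
      by (intro tendsto_intros flat_tendsto_at_right)
    then have "((\<lambda>y. y ^ n * (poly (pCons 0 P) (1 / y) * exp (- (1 / y)))) \<longlongrightarrow> 0) (at_right (0::real))" by simp
    then have "((\<lambda>y. (flat n P y - flat n P 0) / (y - 0)) \<longlongrightarrow> 0) (at_right 0)"
      by (rule Lim_transform_eventually) (auto simp: flat_def eventually_at_filter)
    moreover have "((\<lambda>y. (flat n P y - flat n P 0) / (y - 0)) \<longlongrightarrow> 0) (at_left 0)"
      by (rule tendsto_eventually) (auto simp: flat_def eventually_at_filter)
    ultimately have "((\<lambda>y. (flat n P y - flat n P 0) / (y - 0)) \<longlongrightarrow> 0) (at 0)"
      by (simp add: filterlim_split_at)
    then show ?thesis using 2 by (simp add: has_field_derivative_iff flat_def)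
  next
    case 3
    have inv: "((\<lambda>y. 1 / y) has_real_derivative - (1 / y) * (1 / y)) (at y)"
      using DERIV_inverse[of y UNIV] 3 by (simp add: divide_inverse power2_eq_square)
    have pow: "((\<lambda>y. y ^ n) has_real_derivative real n * (y ^ n * (1 / y))) (at y)"
    proof (cases n)
      case (Suc k)
      then show ?thesis using DERIV_pow[of n y UNIV] 3 by simp
    qed simp
    have pol: "((\<lambda>y. poly P (1 / y)) has_real_derivative poly (pderiv P) (1 / y) * (- (1 / y) * (1 / y))) (at y)"
      by (rule DERIV_chain2[OF poly_DERIV inv])
    have expo: "((\<lambda>y. exp (- (1 / y))) has_real_derivative exp (- (1 / y)) * - (- (1 / y) * (1 / y))) (at y)"
      by (rule DERIV_chain2[OF DERIV_exp DERIV_minus[OF inv]])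
    have "((\<lambda>y. y ^ n * poly P (1 / y) * exp (- (1 / y))) has_real_derivative
        (real n * (y ^ n * (1 / y)) * poly P (1 / y) + poly (pderiv P) (1 / y) * (- (1 / y) * (1 / y)) * y ^ n) * exp (- (1 / y))
        + exp (- (1 / y)) * - (- (1 / y) * (1 / y)) * (y ^ n * poly P (1 / y))) (at y)"
      by (rule DERIV_mult[OF DERIV_mult[OF pow pol] expo])
    also have "(real n * (y ^ n * (1 / y)) * poly P (1 / y) + poly (pderiv P) (1 / y) * (- (1 / y) * (1 / y)) * y ^ n) * exp (- (1 / y))
        + exp (- (1 / y)) * - (- (1 / y) * (1 / y)) * (y ^ n * poly P (1 / y)) = flat n (flat_step n P) y"
    proof -
      define u where "u = 1 / y"
      have eq: "poly (flat_step n P) u = real n * (u * poly P u) + u * (u * (poly P u - poly (pderiv P) u))"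
        by (simp add: flat_step_def algebra_simps)
      show ?thesis using 3 unfolding flat_def u_def[symmetric] eq by (simp add: algebra_simps)
    qed
    finally show ?thesis
      by (rule has_field_derivative_transform_within_open[of _ _ _ "{0<..}"]) (use 3 in \<open>auto simp: flat_def\<close>)
  qed
qed

text \<open>Reflect to y = M + 1 - x and divide by exp(-1/y). Since h vanishes for y \<le> 1, the
  divisor may be truncated there, which keeps the quotient continuous. A polynomial approximates the
  quotient, and multiplying back by exp(-1/y) \<le> 1 makes the result smooth across x = M + 1
  without enlarging the error.\<close>

lemma smooth_compact_approx:
  fixes h :: "real \<Rightarrow> real"
  assumes h: "continuous_on UNIV h" "\<And>x. x \<ge> M \<Longrightarrow> h x = 0" and "0 \<le> M" "0 < e"
  obtains D where "derivative_sequence D" "\<And>x. x \<ge> M + 1 \<Longrightarrow> D 0 x = 0" "\<And>x. 0 \<le> x \<Longrightarrow> \<bar>D 0 x - h x\<bar> \<le> e"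
proof -
  define k where "k y = h (M + 1 - y) * exp (1 / max 1 y)" for y
  have "continuous_on {0..M + 1} k"
    unfolding k_def by (intro continuous_intros continuous_on_compose2[OF h(1)]) auto
  then obtain p where p: "real_polynomial_function p" "\<And>y. y \<in> {0..M + 1} \<Longrightarrow> \<bar>k y - p y\<bar> < e"
    using Stone_Weierstrass_real_polynomial_function[of "{0..M + 1}" k e] \<open>0 < e\<close> by auto
  obtain a N where p_eq: "p = (\<lambda>y. \<Sum>i\<le>N. a i * y ^ i)"
    using p(1) by (auto simp: real_polynomial_function_iff_sum)
  \<comment> \<open>The sign (-1)^j comes from the reflection: every derivative in x contributes a
    factor -1.\<close>
  define D where "D j x = (\<Sum>i\<le>N. a i * ((-1) ^ j * flat i ((flat_step i ^^ j) 1) (M + 1 - x)))" for j :: nat and x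
  have D0: "D 0 x = (if x < M + 1 then p (M + 1 - x) * exp (- (1 / (M + 1 - x))) else 0)" for x
    by (simp add: D_def flat_def p_eq sum_distrib_right mult.assoc)
  show ?thesis
  proof (rule that[of D])
    show "derivative_sequence D"
      unfolding derivative_sequence_def
    proof (intro allI)
      fix j x
      have "((\<lambda>x. (-1) ^ j * flat i ((flat_step i ^^ j) 1) (M + 1 - x)) has_real_derivative
          (-1) ^ j * (flat i (flat_step i ((flat_step i ^^ j) 1)) (M + 1 - x) * (0 - 1))) (at x)" for i
        by (intro DERIV_cmult DERIV_chain2[OF flat_derivative] DERIV_diff DERIV_const DERIV_ident)
      note term_deriv = this
      have "(D j has_real_derivative
          (\<Sum>i\<le>N. a i * ((-1) ^ j * (flat i (flat_step i ((flat_step i ^^ j) 1)) (M + 1 - x) * (0 - 1))))) (at x)"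
        unfolding D_def[abs_def] by (rule DERIV_sum) (rule DERIV_cmult, rule term_deriv)
      then show "(D j has_real_derivative D (Suc j) x) (at x)" by (simp add: D_def)
    qed
    show "D 0 x = 0" if "x \<ge> M + 1" for x using that by (simp add: D0)
    show "\<bar>D 0 x - h x\<bar> \<le> e" if "0 \<le> x" for x
    proof (cases "x < M + 1")
      case True
      define y where "y = M + 1 - x"
      have y: "0 < y" "y \<in> {0..M + 1}" "x = M + 1 - y" using True that by (auto simp: y_def)
      have hx: "h x = k y * exp (- (1 / y))"
      proof (cases "1 \<le> y")
        case True
        then show ?thesis using y by (simp add: k_def max_def flip: exp_add)
      next
        case False
        then show ?thesis using h(2)[of x] y by (simp add: k_def)
      qed
      have "\<bar>D 0 x - h x\<bar> = \<bar>k y - p y\<bar> * exp (- (1 / y))"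
        using True by (simp add: D0 hx y_def[symmetric] abs_mult abs_minus_commute flip: left_diff_distrib)
      also have "\<dots> \<le> e * 1" using p(2)[OF y(2)] y(1) by (intro mult_mono) auto
      finally show ?thesis by simp
    next
      case False
      then show ?thesis using h(2)[of x] \<open>0 < e\<close> by (simp add: D0)
    qed
  qed
qed

text \<open>The case distinction is needed because \<^term>\<open>enn2real \<infinity>\<close> is \<open>0\<close>.\<close>

definition extend :: "(real \<Rightarrow> real) \<Rightarrow> ennreal \<Rightarrow> real" where
  "extend \<phi> V = (if V = \<infinity> then 0 else \<phi> (enn2real V))"

lemma extend_ennreal [simp]: "0 \<le> x \<Longrightarrow> extend \<phi> (ennreal x) = \<phi> x"
  by (simp add: extend_def)

text \<open>\<open>enn2real\<close> is discontinuous at infinity. Clamping V at N keeps the argument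
  finite and changes nothing, because \<phi> vanishes from M on.\<close>

lemma continuous_on_extend:
  assumes \<phi>: "continuous_on UNIV \<phi>" "\<And>x. x \<ge> M \<Longrightarrow> \<phi> x = 0"
  shows "continuous_on UNIV (extend \<phi>)"
proof -
  define N where "N = max M 0"
  have eq: "extend \<phi> = (\<lambda>V. \<phi> (enn2real (min V (ennreal N))))"
  proof
    fix V :: ennreal
    show "extend \<phi> V = \<phi> (enn2real (min V (ennreal N)))"
    proof (cases "V \<le> ennreal N")
      case True
      then have "V \<noteq> \<infinity>" by (auto simp: top_unique)
      then show ?thesis unfolding extend_def min_def using True by (simp only: if_True if_False)
    next
      case False
      then have "min V (ennreal N) = ennreal N" by (simp add: min_def)
      moreover have "\<phi> N = 0" by (rule \<phi>(2)) (simp add: N_def)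
      moreover have "\<phi> (enn2real V) = 0" if "V \<noteq> \<infinity>"
      proof (rule \<phi>(2))
        have "N \<le> enn2real V" using False that by (cases V) (auto simp: N_def ennreal_le_iff2)
        then show "M \<le> enn2real V" by (simp add: N_def)
      qed
      ultimately show ?thesis by (simp add: extend_def N_def)
    qed
  qed
  have "continuous_on UNIV (\<lambda>V. enn2real (min V (ennreal N)))"
  proof (simp add: continuous_on_def, intro allI)
    fix V :: ennreal
    have "((\<lambda>V. min V (ennreal N)) \<longlongrightarrow> min V (ennreal N)) (at V)"
      by (intro tendsto_intros)
    moreover have "min V (ennreal N) = ennreal (enn2real (min V (ennreal N)))"
      by (rule ennreal_enn2real[symmetric], rule le_less_trans[OF min.cobounded2]) simp
    ultimately show "((\<lambda>V. enn2real (min V (ennreal N))) \<longlongrightarrow> enn2real (min V (ennreal N))) (at V)"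
      by (intro tendsto_enn2real) auto
  qed
  then show ?thesis unfolding eq by (rule continuous_on_compose2[OF \<phi>(1)]) auto
qed

text \<open>One-sided derivatives are unique because the filter \<open>at x within {0..}\<close> is
  nontrivial at every x \<ge> 0, including 0; this identifies each \<open>vderiv\<close> in
  turn.\<close>

lemma vderiv_eq:
  assumes D: "derivative_sequence D" and eq: "\<And>x. 0 \<le> x \<Longrightarrow> \<psi> (ennreal x) = D 0 x"
  shows "0 \<le> x \<Longrightarrow> vderiv k \<psi> x = D k x"
    and "0 \<le> x \<Longrightarrow> (vderiv k \<psi> has_vector_derivative D (Suc k) x) (at x within {0..})"
proof -
  have all: "(\<forall>x\<ge>0. vderiv k \<psi> x = D k x) \<and>
      (\<forall>x\<ge>0. (vderiv k \<psi> has_vector_derivative D (Suc k) x) (at x within {0..}))" for k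
  proof (induction k)
    case 0
    have "((\<lambda>v. \<psi> (ennreal v)) has_vector_derivative D (Suc 0) x) (at x within {0..})" if "0 \<le> x" for x
    proof (rule has_vector_derivative_transform)
      show "(D 0 has_vector_derivative D (Suc 0) x) (at x within {0..})"
        using derivative_sequenceD[OF D, of 0 x]
        by (auto simp: has_real_derivative_iff_has_vector_derivative intro: has_vector_derivative_at_within)
    qed (use that eq in auto)
    then show ?case using eq by simp
  next
    case (Suc k)
    have val: "vderiv (Suc k) \<psi> x = D (Suc k) x" if "0 \<le> x" for x
    proof -
      have "at_right x \<le> at x within {0..}" using that by (intro at_le) auto
      then have "at x within {0..} \<noteq> bot"
        using trivial_limit_at_right_real[of x] by (auto simp: bot_unique)
      then show ?thesis using Suc.IH that by (simp add: vector_derivative_within)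
    qed
    have "(vderiv (Suc k) \<psi> has_vector_derivative D (Suc (Suc k)) x) (at x within {0..})" if "0 \<le> x" for x
    proof (rule has_vector_derivative_transform)
      show "(D (Suc k) has_vector_derivative D (Suc (Suc k)) x) (at x within {0..})"
        using derivative_sequenceD[OF D, of "Suc k" x]
        by (auto simp: has_real_derivative_iff_has_vector_derivative intro: has_vector_derivative_at_within)
    qed (use that val in auto)
    then show ?case using val by blast
  qed
  show "0 \<le> x \<Longrightarrow> vderiv k \<psi> x = D k x"
    and "0 \<le> x \<Longrightarrow> (vderiv k \<psi> has_vector_derivative D (Suc k) x) (at x within {0..})"
    using all[of k] by auto
qed

lemma C_inf_of_derivative_sequence:
  assumes D: "derivative_sequence D" and eq: "\<And>x. 0 \<le> x \<Longrightarrow> \<psi> (ennreal x) = D 0 x"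
    and cont: "continuous_on UNIV \<psi>" and const: "\<And>x. x \<ge> M \<Longrightarrow> D 0 x = c"
  shows "\<psi> \<in> C_inf"
proof -
  have tail: "D (Suc k) x = 0" if "x > M" for k x
    using that
  proof (induction k arbitrary: x)
    case 0
    have "((\<lambda>_. c) has_real_derivative 0) (at x)" by simp
    then have "(D 0 has_real_derivative 0) (at x)"
      by (rule has_field_derivative_transform_within_open[of _ _ _ "{M<..}"]) (use 0 const in auto)
    then show ?case using DERIV_unique[OF derivative_sequenceD[OF D, of 0 x]] by simp
  next
    case (Suc k)
    have "((\<lambda>_. 0) has_real_derivative 0) (at x)" by simp
    then have "(D (Suc k) has_real_derivative 0) (at x)"
      by (rule has_field_derivative_transform_within_open[of _ _ _ "{M<..}"]) (use Suc in auto)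
    then show ?case using DERIV_unique[OF derivative_sequenceD[OF D, of "Suc k" x]] by simp
  qed
  have "\<exists>l. (vderiv k \<psi> \<longlongrightarrow> l) at_top" for k
  proof -
    have "\<exists>l. \<forall>x>M. D k x = l" by (cases k) (use const tail in auto)
    then obtain l where l: "\<And>x. x > M \<Longrightarrow> D k x = l" by auto
    have "\<forall>\<^sub>F x in at_top. vderiv k \<psi> x = l"
      using eventually_gt_at_top[of "max 0 M"]
      by eventually_elim (use l in \<open>simp add: vderiv_eq(1)[OF D eq]\<close>)
    then show ?thesis by (blast intro: tendsto_eventually)
  qed
  moreover have "vderiv k \<psi> differentiable (at v within {0..})" if "0 \<le> v" for k v
    using vderiv_eq(2)[OF D eq that] by (auto simp: has_vector_derivative_def intro: differentiableI)
  ultimately show ?thesis using cont by (simp add: C_inf_def)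
qed

lemma extend_test_function:
  assumes D: "derivative_sequence D" and zero: "\<And>x. x \<ge> M \<Longrightarrow> D 0 x = 0" and "0 < M"
  shows "extend (D 0) \<in> C_inf \<inter> X_space M" "0 \<le> x \<Longrightarrow> vderiv 1 (extend (D 0)) x = D 1 x"
proof -
  have "continuous_on UNIV (D 0)"
    using derivative_sequenceD[OF D] by (meson DERIV_isCont continuous_at_imp_continuous_on)
  then have cont: "continuous_on UNIV (extend (D 0))" using zero by (rule continuous_on_extend)
  moreover have "extend (D 0) V = 0" if "ennreal M \<le> V" for V
  proof (cases "V = \<infinity>")
    case False
    then have "M \<le> enn2real V" using that \<open>0 < M\<close> by (cases V) (auto simp: ennreal_le_iff2)
    then show ?thesis using zero False by (simp add: extend_def)
  qed (simp add: extend_def)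
  ultimately show "extend (D 0) \<in> C_inf \<inter> X_space M"
    using C_inf_of_derivative_sequence[OF D _ cont zero] by (auto simp: X_space_def constant_on_def)
  show "0 \<le> x \<Longrightarrow> vderiv 1 (extend (D 0)) x = D 1 x"
    by (rule vderiv_eq(1)[OF D]) auto
qed

text \<open>Mass at infinity is dropped and the rest moved to the real line. Functions extended by 0
  at infinity have the same integrals, so the tests do not see the loss.\<close>

definition finite_part :: "ennreal measure \<Rightarrow> real measure" where
  "finite_part N = distr (restrict_space N {V. V < \<infinity>}) borel enn2real"

lemma finite_part_props:
  assumes N: "N \<in> radon_measures"
  shows "finite_measure (finite_part N)" "sets (finite_part N) = sets borel"
    "AE x in finite_part N. 0 \<le> x"
    "measure (finite_part N) UNIV = measure N {V. V < \<infinity>}"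
    "\<phi> \<in> borel_measurable borel \<Longrightarrow> (\<integral>x. \<phi> x \<partial>finite_part N) = (\<integral>V. extend \<phi> V \<partial>N)"
proof -
  interpret finite_measure N using N by (simp add: radon_measures_def)
  have sN: "sets N = sets borel" using N by (simp add: radon_measures_def)
  note [measurable_cong] = sN
  have spN: "space N = UNIV" using sets_eq_imp_space_eq[OF sN] by simp
  have "{..<(\<infinity>::ennreal)} \<in> sets N" unfolding sN by (rule borel_open[OF open_lessThan])
  then have \<Omega>: "{V. V < \<infinity>} \<in> sets N" unfolding lessThan_def .
  then have \<Omega>': "{V. V < \<infinity>} \<inter> space N \<in> sets N" by (simp add: spN)
  have meas: "enn2real \<in> borel_measurable (restrict_space N {V. V < \<infinity>})"
    by (rule measurable_restrict_space1) measurable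
  show "finite_measure (finite_part N)"
    unfolding finite_part_def
    by (intro finite_measure.finite_measure_distr finite_measure_restrict_space meas finite_measure_axioms \<Omega>)
  show "sets (finite_part N) = sets borel" by (simp add: finite_part_def)
  show "AE x in finite_part N. 0 \<le> x"
    unfolding finite_part_def by (subst AE_distr_iff[OF meas]) auto
  show "measure (finite_part N) UNIV = measure N {V. V < \<infinity>}"
    unfolding finite_part_def by (subst measure_distr[OF meas])
      (auto simp: space_restrict_space spN measure_restrict_space \<Omega>')
  assume [measurable]: "\<phi> \<in> borel_measurable borel"
  have "(\<integral>x. \<phi> x \<partial>finite_part N) = (\<integral>V. \<phi> (enn2real V) \<partial>restrict_space N {V. V < \<infinity>})"
    unfolding finite_part_def by (rule integral_distr[OF meas]) simp
  also have "\<dots> = (\<integral>V. indicator {V. V < \<infinity>} V *\<^sub>R \<phi> (enn2real V) \<partial>N)"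
    by (rule integral_restrict_space[OF \<Omega>'])
  also have "\<dots> = (\<integral>V. extend \<phi> V \<partial>N)"
    by (intro Bochner_Integration.integral_cong) (auto simp: extend_def indicator_def less_top)
  finally show "(\<integral>x. \<phi> x \<partial>finite_part N) = (\<integral>V. extend \<phi> V \<partial>N)" .
qed

text \<open>Moves the generator from the compactified half-line to the real line. G is only Lebesgue
  measurable, so it is exchanged on a null set for the Borel function H, and the integral passes
  from \<open>lebesgue\<close> to \<open>lborel\<close>.\<close>

lemma growth_op_extend:
  assumes Gm: "(\<lambda>v. indicator {0<..} v *\<^sub>R G v) \<in> borel_measurable lebesgue"
    and GH: "AE v in lborel. 0 < v \<longrightarrow> G v = H v" and H0: "\<And>v. v \<le> 0 \<Longrightarrow> H v = 0"
    and [measurable]: "H \<in> borel_measurable borel" "\<phi> \<in> borel_measurable borel"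
  shows "growth_op G (extend \<phi>) = extend (growth H \<phi>)"
proof
  fix V :: ennreal
  show "growth_op G (extend \<phi>) V = extend (growth H \<phi>) V"
  proof (cases "V = \<infinity>")
    case False
    then obtain x where x: "0 \<le> x" "V = ennreal x" by (cases V) auto
    define k where "k v = rate x v * (\<phi> (x + v) - \<phi> x)" for v
    have [measurable]: "k \<in> borel_measurable borel" unfolding k_def[abs_def] by measurable
    have eq: "indicator {0<..} v *\<^sub>R (G v * (enn2real V powr (1/3) + v powr (1/3))\<^sup>2 *
        (extend \<phi> (V + ennreal v) - extend \<phi> V)) = (indicator {0<..} v *\<^sub>R G v) * k v" for v
    proof (cases "0 < v")
      case True
      have "V + ennreal v = ennreal (x + v)" using x True by (simp add: ennreal_plus)
      then have "extend \<phi> (V + ennreal v) = \<phi> (x + v)" using x True by (metis extend_ennreal add_nonneg_nonneg less_imp_le)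
      moreover have "extend \<phi> V = \<phi> x" "enn2real V = x" using x by simp_all
      ultimately show ?thesis using True x(1) by (simp add: k_def rate_def)
    qed simp
    have "AE v in lebesgue. 0 < v \<longrightarrow> G v = H v" using GH by (rule AE_completion)
    then have ae: "AE v in lebesgue. (indicator {0<..} v *\<^sub>R G v) * k v = H v * k v"
      by eventually_elim (auto simp: H0 indicator_def)
    have km: "k \<in> borel_measurable lebesgue" "(\<lambda>v. H v * k v) \<in> borel_measurable lebesgue"
      by (rule measurable_completion; simp)+
    have "growth_op G (extend \<phi>) V = (\<integral>v. (indicator {0<..} v *\<^sub>R G v) * k v \<partial>lebesgue)"
      using False by (simp only: growth_op_def set_lebesgue_integral_def eq if_False)
    also have "\<dots> = (\<integral>v. H v * k v \<partial>lebesgue)"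
      by (rule integral_cong_AE[OF borel_measurable_times[OF Gm km(1)] km(2) ae])
    also have "\<dots> = (\<integral>v. H v * k v \<partial>lborel)"
      by (rule integral_completion) simp
    also have "\<dots> = growth H \<phi> x"
      by (simp add: growth_def k_def mult.assoc)
    finally show ?thesis using x by simp
  qed (simp add: growth_op_def extend_def)
qed

subsection \<open>From the profile and the weak solution to the real line\<close>

text \<open>The derivative is controlled on [0, \<infinity>) only, so arguments are clamped to
  [0, N]. Clamped points differ by at most y - x and by at most N, whence the factor N + 1.\<close>

lemma lipschitz_of_derivative:
  fixes \<Theta> g :: "real \<Rightarrow> real"
  assumes der: "\<And>x. (\<Theta> has_real_derivative - g x) (at x)" and L: "\<And>x. 0 \<le> x \<Longrightarrow> \<bar>g x\<bar> \<le> L"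
    and zero: "\<And>x. x \<ge> N \<Longrightarrow> \<Theta> x = 0" and "0 \<le> N" "x \<le> y"
  shows "\<bar>\<Theta> (max 0 y) - \<Theta> (max 0 x)\<bar> \<le> L * (N + 1) * min 1 (y - x)"
proof -
  define c where "c z = min (max 0 z) N" for z
  have eq: "\<Theta> (max 0 z) = \<Theta> (c z)" for z
    using zero[of "max 0 z"] zero[of N] by (auto simp: c_def min_def)
  have "0 \<le> L" using L[of 0] by simp
  have "norm (\<Theta> (c y) - \<Theta> (c x)) \<le> L * norm (c y - c x)"
  proof (rule field_differentiable_bound[of "{0..}" \<Theta> "\<lambda>x. - g x"])
    fix z :: real assume "z \<in> {0..}"
    then show "norm (- g z) \<le> L" using L[of z] by simp
  qed (use \<open>0 \<le> N\<close> der in \<open>auto simp: c_def intro: has_field_derivative_at_within\<close>)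
  also have "norm (c y - c x) \<le> (N + 1) * min 1 (y - x)"
  proof (cases "y - x \<le> 1")
    case True
    have "norm (c y - c x) \<le> y - x" using \<open>x \<le> y\<close> by (auto simp: c_def)
    also have "\<dots> \<le> (N + 1) * (y - x)" using \<open>x \<le> y\<close> \<open>0 \<le> N\<close> by (intro mult_right_mono[of 1 "N + 1" "y - x", simplified]) auto
    finally show ?thesis using True by simp
  next
    case False
    then show ?thesis using \<open>0 \<le> N\<close> by (auto simp: c_def)
  qed
  finally show ?thesis using \<open>0 \<le> L\<close> by (simp add: eq mult.assoc mult_left_mono)
qed

text \<open>Only values to the right of x \<ge> 0 enter, so \<Theta> may be replaced by its version
  clamped at 0, which has a global Lipschitz bound.\<close>

lemma power_growth_of_derivative:
  fixes \<Theta> g :: "real \<Rightarrow> real"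
  assumes \<sigma>: "5/3 < \<sigma>" "\<sigma> < 2" and der: "\<And>x. (\<Theta> has_real_derivative - g x) (at x)"
    and L: "\<And>x. 0 \<le> x \<Longrightarrow> \<bar>g x\<bar> \<le> L" and zero: "\<And>x. x \<ge> N \<Longrightarrow> \<Theta> x = 0" and "0 \<le> N" "0 \<le> x"
  shows "integrable lborel (\<lambda>v. power_kernel \<sigma> v * rate x v * (\<Theta> (x + v) - \<Theta> x))"
    and "\<bar>growth (power_kernel \<sigma>) \<Theta> x\<bar> \<le> L * (N + 1) * rate N 1 * (\<integral>v. weight \<sigma> 1 v \<partial>lborel)"
proof -
  define \<Xi> where "\<Xi> x = \<Theta> (max 0 x)" for x
  have "continuous_on UNIV \<Theta>"
    by (rule continuous_on_of_DERIV(1)[OF der])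
  then have "continuous_on UNIV \<Xi>"
    unfolding \<Xi>_def by (rule continuous_on_compose2) (auto intro!: continuous_intros)
  then have m: "\<Xi> \<in> borel_measurable borel" by (rule borel_measurable_continuous_onI)
  have lip: "\<bar>\<Xi> y - \<Xi> x\<bar> \<le> L * (N + 1) * min 1 (y - x)" if "x \<le> y" for x y
    unfolding \<Xi>_def by (rule lipschitz_of_derivative[OF der L zero \<open>0 \<le> N\<close> that])
  have z: "\<Xi> x = 0" if "x \<ge> N" for x using that \<open>0 \<le> N\<close> zero[of "max 0 x"] by (simp add: \<Xi>_def)
  have "0 \<le> L * (N + 1)" using L[of 0] \<open>0 \<le> N\<close> by simp
  have eq: "power_kernel \<sigma> v * rate x v * (\<Xi> (x + v) - \<Xi> x) = power_kernel \<sigma> v * rate x v * (\<Theta> (x + v) - \<Theta> x)" for v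
    using \<open>0 \<le> x\<close> by (cases "v > 0") (auto simp: \<Xi>_def power_kernel_def)
  have 1: "integrable lborel (\<lambda>v. power_kernel \<sigma> v * rate x v * (\<Xi> (x + v) - \<Xi> x))"
    by (rule power_growth_bounded(1)[OF \<sigma> m lip z \<open>0 \<le> L * (N + 1)\<close>])
  have 2: "\<bar>growth (power_kernel \<sigma>) \<Xi> x\<bar> \<le> L * (N + 1) * rate N 1 * (\<integral>v. weight \<sigma> 1 v \<partial>lborel)"
    by (rule power_growth_bounded(2)[OF \<sigma> m lip z \<open>0 \<le> L * (N + 1)\<close>])
  show "integrable lborel (\<lambda>v. power_kernel \<sigma> v * rate x v * (\<Theta> (x + v) - \<Theta> x))"
    using 1 unfolding eq .
  show "\<bar>growth (power_kernel \<sigma>) \<Theta> x\<bar> \<le> L * (N + 1) * rate N 1 * (\<integral>v. weight \<sigma> 1 v \<partial>lborel)"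
    using 2 unfolding growth_def eq .
qed

lemma extend_cong: "(\<And>x. 0 \<le> x \<Longrightarrow> \<phi> x = \<psi> x) \<Longrightarrow> extend \<phi> = extend \<psi>"
  by (auto simp: extend_def fun_eq_iff)

lemma self_similar_profile_test:
  assumes F: "self_similar_profile \<sigma> \<mu> F" and D: "derivative_sequence D"
    and zero: "\<And>x. x \<ge> N \<Longrightarrow> D 0 x = 0" and "0 < N"
  shows "\<mu> * (\<integral>x. x * D 1 x \<partial>finite_part F) = (\<integral>x. growth (power_kernel \<sigma>) (D 0) x \<partial>finite_part F)"
proof -
  have FR: "F \<in> radon_measures" using F by (simp add: self_similar_profile_def)
  have D_meas [measurable]: "D k \<in> borel_measurable borel" for k
  proof (rule borel_measurable_continuous_onI)
    show "continuous_on UNIV (D k)"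
      by (rule continuous_on_of_DERIV(1)[OF derivative_sequenceD[OF D]])
  qed
  have "extend (D 0) \<in> C_inf \<inter> X_union"
    using extend_test_function(1)[OF D zero \<open>0 < N\<close>] \<open>0 < N\<close> by (auto simp: X_union_def)
  then have "\<mu> * (\<integral>\<xi>. enn2real \<xi> * vderiv 1 (extend (D 0)) (enn2real \<xi>) \<partial>F) =
      (\<integral>\<xi>. growth_op (\<lambda>\<eta>. \<eta> powr (-\<sigma>)) (extend (D 0)) \<xi> \<partial>F)"
    using F unfolding self_similar_profile_def by blast
  also have "(\<lambda>\<xi>. enn2real \<xi> * vderiv 1 (extend (D 0)) (enn2real \<xi>)) = extend (\<lambda>x. x * D 1 x)"
  proof
    fix \<xi> :: ennreal
    show "enn2real \<xi> * vderiv 1 (extend (D 0)) (enn2real \<xi>) = extend (\<lambda>x. x * D 1 x) \<xi>"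
      using extend_test_function(2)[OF D zero \<open>0 < N\<close>, of "enn2real \<xi>"]
      by (simp only: enn2real_nonneg) (simp add: extend_def)
  qed
  also have "growth_op (\<lambda>\<eta>. \<eta> powr (-\<sigma>)) (extend (D 0)) = extend (growth (power_kernel \<sigma>) (D 0))"
  proof (rule growth_op_extend)
    show "(\<lambda>v. indicator {0<..} v *\<^sub>R v powr - \<sigma>) \<in> borel_measurable lebesgue"
      by (rule measurable_completion) measurable
  qed (auto simp: power_kernel_def D_meas)
  finally show ?thesis
    by (subst (1 2) finite_part_props(5)[OF FR]) auto
qed

text \<open>The main point is the passage from smooth to C^1 test functions. The derivative g is
  approximated uniformly, rather than \<Phi> itself, because the power kernel needs Lipschitz
  control of the error. The defect X of the equation is then at most a constant times the accuracy
  e.\<close>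

lemma profile_of_self_similar:
  assumes \<sigma>: "5/3 < \<sigma>" "\<sigma> < 2" and \<mu>: "\<mu> = inverse (\<sigma> - 5/3)" and F: "self_similar_profile \<sigma> \<mu> F"
  shows "profile (finite_part F) \<sigma> \<mu>"
proof -
  have FR: "F \<in> radon_measures" and F1: "emeasure F UNIV = 1" and Finf: "emeasure F {\<infinity>} = 0"
    using F by (auto simp: self_similar_profile_def)
  define R where "R = finite_part F"
  note P = finite_part_props[OF FR, folded R_def]
  interpret FM: finite_measure F using FR by (simp add: radon_measures_def)
  have sF: "sets F = sets borel" using FR by (simp add: radon_measures_def)
  interpret R: finite_measure R by (rule P)
  note [measurable_cong] = P(2)
  have mass: "measure R UNIV = 1"
  proof -
    have "{V. V < (\<infinity>::ennreal)} = UNIV - {\<infinity>}" by (auto simp: less_top)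
    then have "measure R UNIV = measure F UNIV - measure F {\<infinity>}"
      unfolding P(4) by (simp add: FM.finite_measure_Diff sF)
    then show ?thesis using F1 Finf by (simp add: measure_def)
  qed
  have spR: "space R = UNIV" using sets_eq_imp_space_eq[OF P(2)] by simp
  have "\<mu> * (\<integral>x. x * g x \<partial>R) = (\<integral>x. - growth (power_kernel \<sigma>) \<Phi> x \<partial>R)"
    if g: "continuous_on UNIV g" "\<And>x. x \<ge> M \<Longrightarrow> g x = 0"
      and der: "\<And>x. (\<Phi> has_real_derivative - g x) (at x)" and \<Phi>0: "\<And>x. x \<ge> M \<Longrightarrow> \<Phi> x = 0" for g \<Phi> M
  proof -
    define N where "N = max M 0 + 1"
    have N: "0 < N" "0 \<le> N" "M \<le> N" "0 \<le> max M 0" by (auto simp: N_def)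
    define I where "I = rate N 1 * (\<integral>v. weight \<sigma> 1 v \<partial>lborel)"
    have "0 \<le> I" by (simp add: I_def)
    have cont\<Phi>: "continuous_on UNIV \<Phi>"
      by (rule continuous_on_of_DERIV(1)[OF der])
    have [measurable]: "g \<in> borel_measurable borel" "\<Phi> \<in> borel_measurable borel"
      by (rule borel_measurable_continuous_onI, fact)+
    have "bounded (g ` {0..N})"
      by (intro compact_imp_bounded compact_continuous_image continuous_on_subset[OF g(1)]) auto
    then obtain L where "\<forall>x\<in>{0..N}. \<bar>g x\<bar> \<le> L" unfolding bounded_iff by auto
    then have L: "\<bar>g x\<bar> \<le> max L 0" if "0 \<le> x" for x
      using g(2)[of x] that N(3) by (cases "x \<le> N") (auto simp: le_max_iff_disj)
    have \<Phi>N: "\<Phi> x = 0" "g x = 0" if "x \<ge> N" for x using \<Phi>0 g(2) that N(3) by auto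
    note PG = power_growth_of_derivative[OF \<sigma> der L \<Phi>N(1) N(2)]
    have intx: "integrable R (\<lambda>x. x * h x)"
      if [measurable]: "h \<in> borel_measurable borel" and h: "\<And>x. 0 \<le> x \<Longrightarrow> \<bar>h x\<bar> \<le> K" "\<And>x. x \<ge> N \<Longrightarrow> h x = 0" for h K
    proof (rule R.integrable_const_bound[where B = "N * K"])
      show "AE x in R. norm (x * h x) \<le> N * K"
        using P(3)
      proof eventually_elim
        case (elim x)
        have "0 \<le> K" using h(1)[of 0] by simp
        show ?case
        proof (cases "x \<le> N")
          case True
          then show ?thesis unfolding real_norm_def abs_mult using elim h(1)[of x] by (intro mult_mono) auto
        next
          case False
          then show ?thesis using h(2)[of x] N \<open>0 \<le> K\<close> by simp
        qed
      qed
    qed measurable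
    have intg: "integrable R (growth (power_kernel \<sigma>) \<Theta>)"
      if der\<Theta>: "\<And>x. (\<Theta> has_real_derivative - h x) (at x)" and h: "\<And>x. 0 \<le> x \<Longrightarrow> \<bar>h x\<bar> \<le> K"
        and \<Theta>: "\<And>x. x \<ge> N \<Longrightarrow> \<Theta> x = 0" for \<Theta> h K
    proof (rule R.integrable_const_bound)
      show "AE x in R. norm (growth (power_kernel \<sigma>) \<Theta> x) \<le> K * (N + 1) * rate N 1 * (\<integral>v. weight \<sigma> 1 v \<partial>lborel)"
        using P(3)
      proof eventually_elim
        case (elim x)
        show ?case using power_growth_of_derivative(2)[OF \<sigma> der\<Theta> h \<Theta> N(2) elim] by simp
      qed
      have "continuous_on UNIV \<Theta>"
        by (rule continuous_on_of_DERIV(1)[OF der\<Theta>])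
      then have [measurable]: "\<Theta> \<in> borel_measurable borel" by (rule borel_measurable_continuous_onI)
      show "growth (power_kernel \<sigma>) \<Theta> \<in> borel_measurable R" by measurable
    qed
    define X where "X = \<mu> * (\<integral>x. x * g x \<partial>R) + (\<integral>x. growth (power_kernel \<sigma>) \<Phi> x \<partial>R)"
    have mu0: "0 < \<mu>" using \<sigma> \<mu> by simp
    have "\<bar>X\<bar> \<le> e * (\<mu> * N + (N + 1) * I)" if "0 < e" for e
    proof -
      obtain Dg where Dg: "derivative_sequence Dg" "\<And>x. x \<ge> N \<Longrightarrow> Dg 0 x = 0"
        "\<And>x. 0 \<le> x \<Longrightarrow> \<bar>Dg 0 x - g x\<bar> \<le> e"
      proof (rule smooth_compact_approx[OF g(1) _ N(4) \<open>0 < e\<close>])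
        show "g x = 0" if "max M 0 \<le> x" for x using that g(2) by simp
      qed (auto simp: N_def)
      have contD: "continuous_on UNIV (Dg 0)"
        by (rule continuous_on_of_DERIV(1)[OF derivative_sequenceD[OF Dg(1)]])
      then have [measurable]: "Dg 0 \<in> borel_measurable borel" by (rule borel_measurable_continuous_onI)
      obtain \<Psi> where \<Psi>: "\<And>x. (\<Psi> has_real_derivative - Dg 0 x) (at x)" "\<And>x. x \<ge> N \<Longrightarrow> \<Psi> x = 0"
        by (rule antiderivative_vanishing[OF contD Dg(2)]) blast+
      \<comment> \<open>The tower of derivatives of \<Psi>: the tower \<open>Dg\<close> shifted by
        one, with the sign from \<Psi>' = -\<open>Dg 0\<close>.\<close>
      define D where "D k = (case k of 0 \<Rightarrow> \<Psi> | Suc j \<Rightarrow> \<lambda>x. - Dg j x)" for k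
      have "derivative_sequence D"
        unfolding derivative_sequence_def
      proof (intro allI)
        fix k x
        show "(D k has_real_derivative D (Suc k) x) (at x)"
          using \<Psi>(1) derivative_sequenceD[OF Dg(1)] by (cases k) (auto simp: D_def intro!: DERIV_minus)
      qed
      from self_similar_profile_test[OF F this, of N] \<Psi>(2) N(1)
      have "\<mu> * (\<integral>x. x * - Dg 0 x \<partial>R) = (\<integral>x. growth (power_kernel \<sigma>) \<Psi> x \<partial>R)"
        by (simp add: D_def R_def)
      then have eq: "\<mu> * (\<integral>x. x * Dg 0 x \<partial>R) + (\<integral>x. growth (power_kernel \<sigma>) \<Psi> x \<partial>R) = 0" by simp
      have KD: "\<bar>Dg 0 x\<bar> \<le> max L 0 + e" if "0 \<le> x" for x using L[OF that] Dg(3)[OF that] by linarith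
      have "\<bar>(\<integral>x. x * g x \<partial>R) - (\<integral>x. x * Dg 0 x \<partial>R)\<bar> \<le> N * e"
      proof (rule integral_diff_le_on_nonneg[OF P(1) _ P(3)])
        show "integrable R (\<lambda>x. x * g x)" by (rule intx[OF _ L \<Phi>N(2)]) measurable
        show "integrable R (\<lambda>x. x * Dg 0 x)" by (rule intx[OF _ KD Dg(2)]) measurable
        show "\<bar>x * g x - x * Dg 0 x\<bar> \<le> N * e" if "0 \<le> x" for x
        proof (cases "x \<le> N")
          case True
          have "\<bar>x * g x - x * Dg 0 x\<bar> = x * \<bar>Dg 0 x - g x\<bar>"
            using that by (simp add: abs_mult abs_minus_commute flip: right_diff_distrib)
          also have "\<dots> \<le> N * e" using True that Dg(3)[OF that] by (intro mult_mono) auto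
          finally show ?thesis .
        next
          case False
          then show ?thesis using \<Phi>N(2)[of x] Dg(2)[of x] N(2) \<open>0 < e\<close> by simp
        qed
      qed (simp add: spR mass)
      then have "\<bar>\<mu> * (\<integral>x. x * g x \<partial>R) - \<mu> * (\<integral>x. x * Dg 0 x \<partial>R)\<bar> \<le> \<mu> * (N * e)"
        using mu0 by (simp add: abs_mult flip: right_diff_distrib)
      moreover have "\<bar>(\<integral>x. growth (power_kernel \<sigma>) \<Phi> x \<partial>R) - (\<integral>x. growth (power_kernel \<sigma>) \<Psi> x \<partial>R)\<bar>
          \<le> e * (N + 1) * rate N 1 * (\<integral>v. weight \<sigma> 1 v \<partial>lborel)"
      proof (rule integral_diff_le_on_nonneg[OF P(1) _ P(3)])
        show "integrable R (growth (power_kernel \<sigma>) \<Phi>)" by (rule intg[OF der L \<Phi>N(1)])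
        show "integrable R (growth (power_kernel \<sigma>) \<Psi>)" by (rule intg[OF \<Psi>(1) KD \<Psi>(2)])
        fix x :: real assume "0 \<le> x"
        have i1: "integrable lborel (\<lambda>v. power_kernel \<sigma> v * rate x v * (\<Phi> (x + v) - \<Phi> x))"
          by (rule power_growth_of_derivative(1)[OF \<sigma> der L \<Phi>N(1) N(2) \<open>0 \<le> x\<close>])
        have i2: "integrable lborel (\<lambda>v. power_kernel \<sigma> v * rate x v * (\<Psi> (x + v) - \<Psi> x))"
          by (rule power_growth_of_derivative(1)[OF \<sigma> \<Psi>(1) KD \<Psi>(2) N(2) \<open>0 \<le> x\<close>])
        have "growth (power_kernel \<sigma>) \<Phi> x - growth (power_kernel \<sigma>) \<Psi> x =
            growth (power_kernel \<sigma>) (\<lambda>x. \<Phi> x - \<Psi> x) x"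
          unfolding growth_def Bochner_Integration.integral_diff[OF i1 i2, symmetric]
          by (intro Bochner_Integration.integral_cong refl) (simp add: algebra_simps)
        also have "\<bar>\<dots>\<bar> \<le> e * (N + 1) * rate N 1 * (\<integral>v. weight \<sigma> 1 v \<partial>lborel)"
        proof (rule power_growth_of_derivative(2)[OF \<sigma> _ _ _ N(2) \<open>0 \<le> x\<close>])
          show "((\<lambda>x. \<Phi> x - \<Psi> x) has_real_derivative - (g x - Dg 0 x)) (at x)" for x
            using DERIV_diff[OF der[of x] \<Psi>(1)[of x]] by simp
          show "\<bar>g x - Dg 0 x\<bar> \<le> e" if "0 \<le> x" for x
            using Dg(3)[OF that] by (simp add: abs_minus_commute)
        qed (simp add: \<Phi>N \<Psi>)
        finally show "\<bar>growth (power_kernel \<sigma>) \<Phi> x - growth (power_kernel \<sigma>) \<Psi> x\<bar>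
            \<le> e * (N + 1) * rate N 1 * (\<integral>v. weight \<sigma> 1 v \<partial>lborel)" .
      qed (simp add: spR mass)
      ultimately have "\<bar>X\<bar> \<le> \<mu> * (N * e) + e * (N + 1) * rate N 1 * (\<integral>v. weight \<sigma> 1 v \<partial>lborel)"
        unfolding X_def using eq by linarith
      also have "\<dots> = e * (\<mu> * N + (N + 1) * I)" by (simp add: I_def algebra_simps)
      finally show ?thesis .
    qed
    moreover have K: "0 < \<mu> * N + (N + 1) * I"
      using mu0 N \<open>0 \<le> I\<close> by (intro add_pos_nonneg) auto
    ultimately have "\<bar>X\<bar> \<le> 0 + e" if "0 < e" for e
      using that divide_pos_pos[OF that K] K by (metis add_0 nonzero_eq_divide_eq less_irrefl)
    then have "\<bar>X\<bar> \<le> 0" by (rule field_le_epsilon)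
    then show ?thesis by (simp add: X_def)
  qed
  then show ?thesis
    unfolding R_def[symmetric]
    by unfold_locales (use \<sigma> \<mu> P mass in auto)
qed

text \<open>
  On the null set where \<open>G\<close> has to be changed, the value \<open>v\<^bsup>-\<sigma>\<^esup>\<close> respects the pointwise bound,
  since \<open>C\<^sub>0 \<ge> 1\<close>.
\<close>

lemma borel_kernel:
  assumes \<sigma>: "5/3 < \<sigma>" "\<sigma> < 2"
    and G0: "\<And>v. v > 0 \<Longrightarrow> G v \<ge> 0" and Gint: "set_integrable lebesgue {0<..} G"
    and Gle: "\<And>v. v > 0 \<Longrightarrow> G v \<le> C\<^sub>0 * v powr (-\<sigma>)"
    and lim: "((\<lambda>v. v powr \<sigma> * G v) \<longlongrightarrow> 1) at_top"
  obtains H where "integrable_jump_kernel \<sigma> C\<^sub>0 H" "AE v in lborel. 0 < v \<longrightarrow> G v = H v"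
    "((\<lambda>v. v powr \<sigma> * H v) \<longlongrightarrow> 1) at_top"
proof -
  have Gm: "(\<lambda>v. indicator {0<..} v *\<^sub>R G v) \<in> borel_measurable lebesgue"
    using Gint by (auto simp: set_integrable_def)
  then obtain G' where G': "G' \<in> borel_measurable lborel" "AE v in lborel. indicator {0<..} v *\<^sub>R G v = G' v"
    using completion_ex_borel_measurable_real by blast
  then obtain N where N: "N \<in> null_sets lborel" "{v \<in> space lborel. \<not> indicator {0<..} v *\<^sub>R G v = G' v} \<subseteq> N"
    by (auto simp: eventually_ae_filter)
  have [measurable]: "N \<in> sets borel" "G' \<in> borel_measurable borel" using N G' by auto
  define H where "H v = (if v > 0 then if v \<in> N then v powr (-\<sigma>) else G' v else 0)" for v
  have [measurable]: "H \<in> borel_measurable borel" unfolding H_def[abs_def] by measurable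
  have HG: "H v = G v" if "v > 0" "v \<notin> N" for v
  proof -
    have "indicator {0<..} v *\<^sub>R G v = G' v" using that(2) N(2) by auto
    then show ?thesis using that by (simp add: H_def)
  qed
  have HN: "H v = v powr (-\<sigma>)" if "v > 0" "v \<in> N" for v using that by (simp add: H_def)
  have C1: "1 \<le> C\<^sub>0"
  proof (rule tendsto_upperbound[OF lim])
    show "\<forall>\<^sub>F v in at_top. v powr \<sigma> * G v \<le> C\<^sub>0"
      using eventually_gt_at_top[of 0]
    proof eventually_elim
      case (elim v)
      have "v powr \<sigma> * G v \<le> v powr \<sigma> * (C\<^sub>0 * v powr (-\<sigma>))" using Gle[OF elim] by (intro mult_left_mono) auto
      also have "\<dots> = C\<^sub>0" using elim by (simp add: powr_minus)
      finally show ?case .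
    qed
  qed simp
  have ae: "AE v in lborel. 0 < v \<longrightarrow> G v = H v"
    using AE_not_in[OF N(1)] by eventually_elim (auto simp: HG)
  have "integrable lebesgue H"
  proof (rule integrable_cong_AE_imp)
    show "integrable lebesgue (\<lambda>v. indicator {0<..} v *\<^sub>R G v)" using Gint by (simp add: set_integrable_def)
    show "H \<in> borel_measurable lebesgue" by (rule measurable_completion) simp
    show "AE v in lebesgue. indicator {0<..} v *\<^sub>R G v = H v"
      using AE_completion[OF ae] by eventually_elim (auto simp: H_def indicator_def)
  qed
  then have Hint: "integrable lborel H" by (subst (asm) integrable_completion) auto
  have "integrable_jump_kernel \<sigma> C\<^sub>0 H"
  proof
    show "0 \<le> H v" for v
      using HG[of v] HN[of v] G0[of v] by (cases "v > 0"; cases "v \<in> N") (auto simp: H_def)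
    show "H v \<le> C\<^sub>0 * power_kernel \<sigma> v" for v
    proof (cases "v > 0")
      case True
      have "1 * v powr (-\<sigma>) \<le> C\<^sub>0 * v powr (-\<sigma>)" using C1 by (intro mult_right_mono) auto
      then show ?thesis
        using HG[OF True] HN[OF True] Gle[OF True] True by (cases "v \<in> N") (auto simp: power_kernel_def)
    qed (simp add: H_def power_kernel_def)
  qed (use \<sigma> Hint in \<open>auto simp: H_def\<close>)
  moreover have "((\<lambda>v. v powr \<sigma> * H v) \<longlongrightarrow> 1) at_top"
  proof (rule tendstoI)
    fix e :: real assume "0 < e"
    show "\<forall>\<^sub>F v in at_top. dist (v powr \<sigma> * H v) 1 < e"
      using tendstoD[OF lim \<open>0 < e\<close>] eventually_gt_at_top[of 0]
    proof eventually_elim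
      case (elim v)
      then show ?case
        using HG[of v] HN[of v] \<open>0 < e\<close> by (cases "v \<in> N") (auto simp: powr_minus)
    qed
  qed
  ultimately show ?thesis using ae that by blast
qed

section \<open>Consequences of the weak formulation\<close>

lemma weak_solution_const_test:
  assumes w: "weak_solution G f\<^sub>0 f" and \<psi>: "\<psi> \<in> C_inf \<inter> X_space M" and "0 < M" "0 < T"
  shows "(LINT V|f T. \<psi> V) - (LINT V|f 0. \<psi> V) =
    (LINT t:{0..T}|lebesgue. (LINT V|f t. growth_op G \<psi> V))"
proof -
  have "(\<lambda>_. 0 :: real) \<in> C_inf"
    by (rule C_inf_of_derivative_sequence[of "\<lambda>_ _. 0" _ 0 0]) (auto simp: derivative_sequence_def)
  then have "(\<lambda>_. 0) \<in> C_inf \<inter> X_space M" by (auto simp: X_space_def constant_on_def)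
  then have "C1_test_function T (\<lambda>_. \<psi>) (\<lambda>_ _. 0)"
    using \<psi> \<open>0 < M\<close> by (auto simp: C1_test_function_def C_inf_tendsto_def intro!: exI[of _ M] uniform_limit_const)
  then have "(LINT V|f T. \<psi> V) - (LINT V|f 0. \<psi> V) - (LINT t:{0..T}|lebesgue. (LINT V|f t. (0::real))) =
    (LINT t:{0..T}|lebesgue. (LINT V|f t. growth_op G \<psi> V))"
    using w \<open>0 < T\<close> unfolding weak_solution_def by blast
  then show ?thesis by (simp add: set_lebesgue_integral_def)
qed

lemma weak_solution_continuous:
  fixes \<psi> :: "ennreal \<Rightarrow> real"
  assumes w: "weak_solution G f\<^sub>0 f" and \<psi>: "continuous_on UNIV \<psi>"
  shows "continuous_on {0..} (\<lambda>t. LINT V|f t. \<psi> V)"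
  unfolding continuous_on_def
proof
  fix t :: real assume "t \<in> {0..}"
  then have t: "0 \<le> t" "0 < t + 1" "t \<in> {0..t + 1}" by auto
  have "weakly_continuous_on {0..t + 1} f" using w t(2) by (simp add: weak_solution_def)
  then have "((\<lambda>s. LINT V|f s. \<psi> V) \<longlongrightarrow> (LINT V|f t. \<psi> V)) (at t within {0..t + 1})"
    using t(3) \<psi> unfolding weakly_continuous_on_def weakly_tendsto_def by blast
  moreover have "at t within {0..t + 1} = at t within {0..}"
    by (rule at_within_nhd[of _ "{..<t + 1}"]) auto
  ultimately show "((\<lambda>s. LINT V|f s. \<psi> V) \<longlongrightarrow> (LINT V|f t. \<psi> V)) (at t within {0..})" by simp
qed

text \<open>The constant 1 is an admissible test function with zero growth, so mass on all of
  [0, \<infinity>], the point at infinity included, is conserved.\<close>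

lemma weak_solution_mass:
  assumes w: "weak_solution G f\<^sub>0 f" and "emeasure f\<^sub>0 UNIV = 1" and "0 \<le> t"
  shows "measure (f t) UNIV = 1"
proof -
  have R: "f s \<in> radon_measures" if "0 \<le> s" for s using w that by (simp add: weak_solution_def)
  have mass: "(LINT V|f s. (1::real)) = measure (f s) UNIV" if "0 \<le> s" for s
    using R[OF that] sets_eq_imp_space_eq[of "f s" borel] by (simp add: radon_measures_def)
  have "f 0 = f\<^sub>0" using w by (simp add: weak_solution_def)
  then have 0: "measure (f 0) UNIV = 1" using assms(2) by (simp add: measure_def)
  show ?thesis
  proof (cases "t = 0")
    case False
    then have "0 < t" using \<open>0 \<le> t\<close> by simp
    have "(\<lambda>_. 1 :: real) \<in> C_inf"
      by (rule C_inf_of_derivative_sequence[of "\<lambda>k _. if k = 0 then 1 else 0" _ 0 1])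
        (auto simp: derivative_sequence_def)
    then have "(\<lambda>_. 1) \<in> C_inf \<inter> X_space 1" by (auto simp: X_space_def constant_on_def)
    moreover have "growth_op G (\<lambda>_. 1) = (\<lambda>_. 0)"
      by (simp add: growth_op_def set_lebesgue_integral_def fun_eq_iff)
    ultimately have "(LINT V|f t. (1::real)) - (LINT V|f 0. (1::real)) = 0"
      using weak_solution_const_test[OF w _ _ \<open>0 < t\<close>, of "\<lambda>_. 1" 1]
      by (simp add: set_lebesgue_integral_def del: lebesgue_integral_const)
    then show ?thesis
      unfolding mass[OF \<open>0 \<le> t\<close>] mass[OF order_refl] using 0 by simp
  qed (simp add: 0)
qed

text \<open>Smooth tests approximate \<phi> uniformly on [0, \<infinity>), and the finite total rate
  of H makes the growth term continuous in that norm; the power kernel has no such continuity.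
  Continuity in time turns the Lebesgue time integral into \<open>integral\<close>.\<close>

lemma weak_solution_evolution:
  assumes w: "weak_solution G f\<^sub>0 f" and mass: "emeasure f\<^sub>0 UNIV = 1"
    and Gm: "(\<lambda>v. indicator {0<..} v *\<^sub>R G v) \<in> borel_measurable lebesgue"
    and H: "integrable_jump_kernel \<sigma> C\<^sub>0 H" and GH: "AE v in lborel. 0 < v \<longrightarrow> G v = H v"
    and \<phi>: "\<phi> \<in> decreasing_tests M" and "0 \<le> T"
  shows "(\<integral>x. \<phi> x \<partial>finite_part (f T)) - (\<integral>x. \<phi> x \<partial>finite_part (f 0)) =
    integral {0..T} (\<lambda>t. \<integral>x. growth H \<phi> x \<partial>finite_part (f t))"
proof (cases "T = 0")
  case False
  then have "0 < T" using \<open>0 \<le> T\<close> by simp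
  interpret K: integrable_jump_kernel \<sigma> C\<^sub>0 H by fact
  have R: "f s \<in> radon_measures" if "0 \<le> s" for s using w that by (simp add: weak_solution_def)
  define m where "m t = finite_part (f t)" for t
  have m: "finite_measure (m t)" "sets (m t) = sets borel" "AE x in m t. 0 \<le> x" "measure (m t) (space (m t)) \<le> 1"
    if "0 \<le> t" for t
  proof -
    note P = finite_part_props[OF R[OF that], folded m_def]
    show "finite_measure (m t)" "sets (m t) = sets borel" "AE x in m t. 0 \<le> x" by (rule P)+
    interpret finite_measure "f t" using R[OF that] by (simp add: radon_measures_def)
    have "measure (m t) UNIV \<le> measure (f t) UNIV"
      unfolding P(4) using bounded_measure sets_eq_imp_space_eq[of "f t" borel] R[OF that]
      by (simp add: radon_measures_def)
    then show "measure (m t) (space (m t)) \<le> 1"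
      using weak_solution_mass[OF w mass that] sets_eq_imp_space_eq[OF P(2)] by simp
  qed
  define N where "N = max M 0"
  have N: "0 \<le> N" "M \<le> N" "0 < N + 1" by (auto simp: N_def)
  note D\<phi> = decreasing_testsD[OF \<phi>]
  have B\<phi>: "\<bar>\<phi> z\<bar> \<le> 1" for z using D\<phi>(3,4)[of z] by simp
  have \<phi>N: "\<phi> x = 0" if "x \<ge> N" for x using D\<phi>(5) that N(2) by simp
  define S where "S = rate (N + 1) 1 * K.total"
  have "0 \<le> S" using K.total_nonneg by (simp add: S_def)
  have mean_continuous: "continuous_on {0..} (\<lambda>t. \<integral>x. \<theta> x \<partial>m t)"
    if \<theta>: "continuous_on UNIV \<theta>" "\<And>x. x \<ge> N + 1 \<Longrightarrow> \<theta> x = 0" for \<theta> :: "real \<Rightarrow> real"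
  proof -
    have "continuous_on {0..} (\<lambda>t. LINT V|f t. extend \<theta> V)"
      by (rule weak_solution_continuous[OF w continuous_on_extend[OF \<theta>]])
    then show ?thesis
      by (rule continuous_on_eq)
        (simp add: m_def finite_part_props(5)[OF R borel_measurable_continuous_onI[OF \<theta>(1)]])
  qed
  define X where "X = (\<integral>x. \<phi> x \<partial>m T) - (\<integral>x. \<phi> x \<partial>m 0) - integral {0..T} (\<lambda>t. \<integral>x. growth H \<phi> x \<partial>m t)"
  have "\<bar>X\<bar> \<le> e * (2 + 2 * S * T)" if "0 < e" for e
  proof -
    obtain D where D: "derivative_sequence D" "\<And>x. x \<ge> N + 1 \<Longrightarrow> D 0 x = 0"
      "\<And>x. 0 \<le> x \<Longrightarrow> \<bar>D 0 x - \<phi> x\<bar> \<le> e"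
      using smooth_compact_approx[OF D\<phi>(1) \<phi>N N(1) \<open>0 < e\<close>] by metis
    \<comment> \<open>\<open>D 0\<close> is close to \<phi> only on [0, \<infinity>) and may be
      large to the left; clamping gives a globally bounded function with the same extension.\<close>
    define \<theta> where "\<theta> x = D 0 (max 0 x)" for x
    have "continuous_on UNIV (D 0)"
      by (rule continuous_on_of_DERIV(1)[OF derivative_sequenceD[OF D(1)]])
    then have \<theta>c: "continuous_on UNIV \<theta>"
      unfolding \<theta>_def by (rule continuous_on_compose2) (auto intro!: continuous_intros)
    then have \<theta>m: "\<theta> \<in> borel_measurable borel" by (rule borel_measurable_continuous_onI)
    have \<theta>0: "\<theta> x = 0" if "x \<ge> N + 1" for x using that N D(2)[of "max 0 x"] by (simp add: \<theta>_def)
    have \<theta>close: "\<bar>\<theta> x - \<phi> x\<bar> \<le> e" if "0 \<le> x" for x using D(3)[OF that] that by (simp add: \<theta>_def)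
    have \<theta>B: "\<bar>\<theta> x\<bar> \<le> 1 + e" for x
      using D(3)[of "max 0 x"] B\<phi>[of "max 0 x"] by (simp add: \<theta>_def)
    have ext: "extend \<theta> = extend (D 0)" by (rule extend_cong) (simp add: \<theta>_def)
    have gop: "growth_op G (extend \<theta>) = extend (growth H \<theta>)"
      by (rule growth_op_extend[OF Gm GH K.G_zero K.G_measurable \<theta>m])
    have g\<theta>: "continuous_on UNIV (growth H \<theta>)" "\<And>x. x \<ge> N + 1 \<Longrightarrow> growth H \<theta> x = 0"
      using K.continuous_on_growth[OF \<theta>c \<theta>B] K.growth_eq_0[OF \<theta>0] by auto
    have g\<phi>: "continuous_on UNIV (growth H \<phi>)" "\<And>x. x \<ge> N + 1 \<Longrightarrow> growth H \<phi> x = 0"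
      using K.continuous_on_growth[OF D\<phi>(1) B\<phi>] K.growth_eq_0[OF \<phi>N] by auto
    note c\<theta> = mean_continuous[OF g\<theta>]
    note c\<phi> = mean_continuous[OF g\<phi>]
    have "(LINT V|f T. extend \<theta> V) - (LINT V|f 0. extend \<theta> V) =
        (LINT t:{0..T}|lebesgue. (LINT V|f t. growth_op G (extend \<theta>) V))"
      using extend_test_function(1)[OF D(1,2) N(3)] ext
      by (intro weak_solution_const_test[OF w _ N(3) \<open>0 < T\<close>]) simp
    also have "\<dots> = (LINT t:{0..T}|lebesgue. (\<integral>x. growth H \<theta> x \<partial>m t))"
      unfolding gop m_def
      by (intro set_lebesgue_integral_cong) 
        (auto simp: finite_part_props(5)[OF R borel_measurable_continuous_onI[OF g\<theta>(1)]])
    also have "\<dots> = integral {0..T} (\<lambda>t. \<integral>x. growth H \<theta> x \<partial>m t)"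
      by (intro set_lebesgue_integral_eq_integral absolutely_integrable_continuous_real
        continuous_on_subset[OF c\<theta>]) auto
    finally have eq: "(\<integral>x. \<theta> x \<partial>m T) - (\<integral>x. \<theta> x \<partial>m 0) = integral {0..T} (\<lambda>t. \<integral>x. growth H \<theta> x \<partial>m t)"
      using \<open>0 < T\<close> by (simp add: m_def finite_part_props(5)[OF R \<theta>m])
    have int: "integrable (m t) p" if "0 \<le> t" and p: "continuous_on UNIV p" "\<And>x. \<bar>p x\<bar> \<le> B"
      for t B and p :: "real \<Rightarrow> real"
    proof -
      interpret finite_measure "m t" by (rule m(1)[OF that(1)])
      have "p \<in> borel_measurable (m t)"
        using borel_measurable_continuous_onI[OF p(1)] m(2)[OF that(1)] by simp
      then show ?thesis using p(2) by (intro integrable_const_bound[where B=B]) auto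
    qed
    have mean: "\<bar>(\<integral>x. \<theta> x \<partial>m t) - (\<integral>x. \<phi> x \<partial>m t)\<bar> \<le> e" if "0 \<le> t" for t
      by (rule integral_diff_le_on_nonneg[OF m(1)[OF that] m(4)[OF that] m(3)[OF that]
        int[OF that \<theta>c \<theta>B] int[OF that D\<phi>(1) B\<phi>] \<theta>close])
    have bg\<theta>: "\<bar>growth H \<theta> x\<bar> \<le> 2 * (1 + e) * rate (N + 1) 1 * K.total" for x
      by (rule K.growth_tests_bound[OF \<theta>m \<theta>B \<theta>0])
    have \<phi>N1: "\<phi> x = 0" if "x \<ge> N + 1" for x using \<phi>N that by simp
    have bg\<phi>: "\<bar>growth H \<phi> x\<bar> \<le> 2 * 1 * rate (N + 1) 1 * K.total" for x
      by (rule K.growth_tests_bound[OF D\<phi>(6) B\<phi> \<phi>N1])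
    have source: "\<bar>(\<integral>x. growth H \<theta> x \<partial>m t) - (\<integral>x. growth H \<phi> x \<partial>m t)\<bar> \<le> 2 * e * S" if t: "0 \<le> t" for t
    proof (rule integral_diff_le_on_nonneg[OF m(1)[OF t] m(4)[OF t] m(3)[OF t] int[OF t g\<theta>(1) bg\<theta>] int[OF t g\<phi>(1) bg\<phi>]])
      fix x :: real assume "0 \<le> x"
      have "growth H \<theta> x - growth H \<phi> x = growth H (\<lambda>z. \<theta> z - \<phi> z) x"
        by (rule K.growth_diff[OF \<theta>m D\<phi>(6) \<theta>B B\<phi>, symmetric])
      also have "\<bar>\<dots>\<bar> \<le> 2 * e * rate (N + 1) 1 * K.total"
        by (rule K.growth_tests_bound) (use \<theta>m D\<phi>(6) \<open>0 \<le> x\<close> \<theta>close \<theta>0 \<phi>N1 in auto)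
      finally show "\<bar>growth H \<theta> x - growth H \<phi> x\<bar> \<le> 2 * e * S" by (simp add: S_def mult.assoc)
    qed
    have cT: "continuous_on {0..T} (\<lambda>t. \<integral>x. growth H \<theta> x \<partial>m t)" "continuous_on {0..T} (\<lambda>t. \<integral>x. growth H \<phi> x \<partial>m t)"
      using continuous_on_subset[OF c\<theta>, of "{0..T}"] continuous_on_subset[OF c\<phi>, of "{0..T}"] by auto
    have "integral {0..T} (\<lambda>t. \<integral>x. growth H \<theta> x \<partial>m t) - integral {0..T} (\<lambda>t. \<integral>x. growth H \<phi> x \<partial>m t) =
        integral {0..T} (\<lambda>t. (\<integral>x. growth H \<theta> x \<partial>m t) - (\<integral>x. growth H \<phi> x \<partial>m t))"
      by (rule Henstock_Kurzweil_Integration.integral_diff[symmetric]) (intro integrable_continuous_real cT)+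
    also have "\<bar>\<dots>\<bar> \<le> 2 * e * S * (T - 0)"
      using integral_bound[OF \<open>0 \<le> T\<close> continuous_on_diff[OF cT], of "2 * e * S"] source by simp
    finally have "\<bar>integral {0..T} (\<lambda>t. \<integral>x. growth H \<theta> x \<partial>m t) - integral {0..T} (\<lambda>t. \<integral>x. growth H \<phi> x \<partial>m t)\<bar>
        \<le> 2 * e * S * T" by simp
    then have "\<bar>X\<bar> \<le> e + e + 2 * e * S * T"
      unfolding X_def using eq mean[OF \<open>0 \<le> T\<close>] mean[of 0] by linarith
    then show ?thesis by (simp add: algebra_simps)
  qed
  moreover have K: "0 < 2 + 2 * S * T"
    using \<open>0 \<le> S\<close> \<open>0 \<le> T\<close> by (intro add_pos_nonneg) auto
  ultimately have "\<bar>X\<bar> \<le> 0 + e" if "0 < e" for e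
    using that divide_pos_pos[OF that K] K by (metis add_0 nonzero_eq_divide_eq less_irrefl)
  then have "\<bar>X\<bar> \<le> 0" by (rule field_le_epsilon)
  then show ?thesis by (simp add: X_def m_def)
qed simp

text \<open>Stone-Weierstrass on the compact space [0, \<infinity>] for the algebra generated by
  u(V) = 1 / (1 + V). Positive powers of u decrease to 0 at infinity, hence are uniform limits of
  decreasing tests; the constants are covered by the equality of masses.\<close>

lemma weak_convergence_criterion:
  fixes N :: "real \<Rightarrow> ennreal measure"
  assumes N: "\<And>t. 0 < t \<Longrightarrow> N t \<in> radon_measures" "\<And>t. 0 < t \<Longrightarrow> measure (N t) UNIV = 1"
    and L: "L \<in> radon_measures" "measure L UNIV = 1"
    and tests: "\<And>\<phi> M. \<phi> \<in> decreasing_tests M \<Longrightarrow>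
      ((\<lambda>t. LINT V|N t. extend \<phi> V) \<longlongrightarrow> (LINT V|L. extend \<phi> V)) at_top"
  shows "weakly_tendsto N L at_top"
proof -
  define conv where "conv \<psi> \<longleftrightarrow> ((\<lambda>t. LINT V|N t. \<psi> V) \<longlongrightarrow> (LINT V|L. \<psi> V)) at_top" for \<psi> :: "ennreal \<Rightarrow> real"
  have int: "integrable Q \<psi>" if "Q \<in> radon_measures" "continuous_on UNIV \<psi>" for Q and \<psi> :: "ennreal \<Rightarrow> real"
  proof -
    interpret finite_measure Q using that by (simp add: radon_measures_def)
    have "bounded (range \<psi>)"
      by (intro compact_imp_bounded compact_continuous_image that compact_UNIV)
    then obtain B where "\<And>V. \<bar>\<psi> V\<bar> \<le> B" unfolding bounded_iff by auto
    moreover have "\<psi> \<in> borel_measurable Q"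
      using borel_measurable_continuous_onI[OF that(2)] that(1) by (simp add: radon_measures_def cong: measurable_cong_sets)
    ultimately show ?thesis by (intro integrable_const_bound[where B=B]) auto
  qed
  have close: "\<bar>(LINT V|Q. \<psi> V) - (LINT V|Q. \<psi>' V)\<bar> \<le> e"
    if Q: "Q \<in> radon_measures" "measure Q UNIV = 1" and c: "continuous_on UNIV \<psi>" "continuous_on UNIV \<psi>'"
      and le: "\<And>V. \<bar>\<psi> V - \<psi>' V\<bar> \<le> e" for Q e and \<psi> \<psi>' :: "ennreal \<Rightarrow> real"
  proof -
    interpret finite_measure Q using Q by (simp add: radon_measures_def)
    have "\<bar>(LINT V|Q. \<psi> V) - (LINT V|Q. \<psi>' V)\<bar> = \<bar>LINT V|Q. \<psi> V - \<psi>' V\<bar>"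
      by (simp add: Bochner_Integration.integral_diff[OF int[OF Q(1) c(1)] int[OF Q(1) c(2)]])
    also have "\<dots> \<le> (LINT V|Q. e)"
      by (intro integral_abs_bound[THEN order_trans] integral_mono integrable_abs
        Bochner_Integration.integrable_diff int[OF Q(1)] c le) simp
    also have "\<dots> = e" using Q sets_eq_imp_space_eq[of Q borel] by (simp add: radon_measures_def)
    finally show ?thesis .
  qed
  \<comment> \<open>Convergence is stable under uniform limits because all measures involved have
    mass 1.\<close>
  have approx: "conv \<psi>"
    if c: "continuous_on UNIV \<psi>" and ex: "\<And>e. 0 < e \<Longrightarrow> \<exists>\<psi>'. continuous_on UNIV \<psi>' \<and> conv \<psi>' \<and> (\<forall>V. \<bar>\<psi> V - \<psi>' V\<bar> \<le> e)"
    for \<psi> :: "ennreal \<Rightarrow> real"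
    unfolding conv_def
  proof (rule tendstoI)
    fix e :: real assume "0 < e"
    then have e3: "0 < e / 3" by simp
    obtain \<psi>' where \<psi>': "continuous_on UNIV \<psi>'" "conv \<psi>'" "\<And>V. \<bar>\<psi> V - \<psi>' V\<bar> \<le> e / 3"
      using ex[OF e3] by blast
    have cL: "\<bar>(LINT V|L. \<psi> V) - (LINT V|L. \<psi>' V)\<bar> \<le> e / 3" by (rule close[OF L c \<psi>'(1,3)])
    show "\<forall>\<^sub>F t in at_top. dist (LINT V|N t. \<psi> V) (LINT V|L. \<psi> V) < e"
      using tendstoD[OF \<psi>'(2)[unfolded conv_def] e3] eventually_gt_at_top[of 0]
    proof eventually_elim
      case (elim t)
      have "\<bar>(LINT V|N t. \<psi> V) - (LINT V|N t. \<psi>' V)\<bar> \<le> e / 3"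
        by (rule close[OF N(1)[OF elim(2)] N(2)[OF elim(2)] c \<psi>'(1,3)])
      then show ?case using elim(1) cL unfolding dist_real_def by linarith
    qed
  qed
  define u where "u V = enn2real (inverse (1 + V))" for V :: ennreal
  have inv_less: "inverse (1 + V) < top" for V :: ennreal
    by (simp add: less_top[symmetric] ennreal_inverse_eq_top_iff)
  have cu: "continuous_on UNIV u"
  proof (simp add: continuous_on_def u_def, intro allI)
    fix V :: ennreal
    have "continuous_on UNIV (\<lambda>V::ennreal. inverse (1 + V))" by (intro continuous_intros)
    then have "((\<lambda>V. inverse (1 + V)) \<longlongrightarrow> inverse (1 + V)) (at V)" by (simp add: continuous_on_def)
    then have "((\<lambda>V. inverse (1 + V)) \<longlongrightarrow> ennreal (enn2real (inverse (1 + V)))) (at V)"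
      using inv_less[of V] by simp
    then show "((\<lambda>V. enn2real (inverse (1 + V))) \<longlongrightarrow> enn2real (inverse (1 + V))) (at V)"
      by (intro tendsto_enn2real) auto
  qed
  have u_fin: "u (ennreal x) = 1 / (1 + x)" if "0 \<le> x" for x
  proof -
    have "1 + ennreal x = ennreal (1 + x)" using that by (simp add: ennreal_plus)
    then have "inverse (1 + ennreal x) = ennreal (inverse (1 + x))" using that by (simp only: inverse_ennreal)
    then show ?thesis using that by (simp add: u_def inverse_eq_divide)
  qed
  have u_top: "u \<infinity> = 0" by (simp add: u_def)
  have power: "conv (\<lambda>V. u V ^ i)" for i
  proof (cases i)
    case 0
    have one: "(LINT V|Q. (1::real)) = 1" if "Q \<in> radon_measures" "measure Q UNIV = 1" for Q
      using that sets_eq_imp_space_eq[of Q borel] by (simp add: radon_measures_def)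
    have "(LINT V|L. (1::real)) = 1" by (rule one[OF L])
    moreover have "\<forall>\<^sub>F t in at_top. (LINT V|N t. (1::real)) = 1"
      using eventually_gt_at_top[of 0]
    proof eventually_elim
      case (elim t)
      then show ?case by (intro one N)
    qed
    ultimately show ?thesis using 0 by (simp add: conv_def tendsto_eventually)
  next
    case (Suc j)
    show ?thesis
    proof (rule approx)
      show "continuous_on UNIV (\<lambda>V. u V ^ i)" by (intro continuous_intros cu)
      fix e :: real assume "0 < e"
      \<comment> \<open>Beyond this M the function u is at most e, so subtracting its i-th power at
        M and truncating at 0 changes that power by at most e.\<close>
      define M where "M = 1 / e"
      have M: "0 < M" "1 / (1 + M) \<le> e" using \<open>0 < e\<close> by (auto simp: M_def field_simps)
      define r where "r x = (1 / (1 + max 0 x)) ^ i" for x :: real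
      have r0: "0 \<le> r x" "r x \<le> 1" for x unfolding r_def by (auto intro: power_le_one)
      have r_anti: "r y \<le> r x" if "x \<le> y" for x y
        unfolding r_def using that by (intro power_mono divide_left_mono) auto
      have "r M \<le> (1 / (1 + M)) ^ 1"
        unfolding r_def using M Suc by (simp only: max_absorb2 less_imp_le) (rule power_decreasing, auto)
      then have rM: "r M \<le> e" using M by simp
      define \<phi> where "\<phi> x = max 0 (r x - r M)" for x
      have "continuous_on UNIV r" unfolding r_def by (intro continuous_intros) auto
      then have c\<phi>: "continuous_on UNIV \<phi>" unfolding \<phi>_def by (intro continuous_intros)
      have "antimono \<phi>" unfolding \<phi>_def by (intro antimonoI max.mono diff_mono r_anti) auto
      moreover have "\<phi> x = 0" if "x \<ge> M" for x using r_anti[OF that] by (simp add: \<phi>_def)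
      moreover have "\<phi> x \<le> 1" for x using r0(2)[of x] r0(1)[of M] by (simp add: \<phi>_def)
      ultimately have \<phi>: "\<phi> \<in> decreasing_tests M" using c\<phi> by (simp add: decreasing_tests_def)
      have "\<bar>u V ^ i - extend \<phi> V\<bar> \<le> e" for V
      proof (cases V)
        case (real x)
        then have "u V ^ i = r x" using u_fin[of x] by (simp add: r_def)
        then show ?thesis using real rM r0[of x] r0[of M] by (auto simp: \<phi>_def)
      next
        case top
        then show ?thesis using u_top Suc \<open>0 < e\<close> by (simp add: extend_def)
      qed
      moreover have "continuous_on UNIV (extend \<phi>)"
        by (rule continuous_on_extend[OF c\<phi>, of M]) (use decreasing_testsD(5)[OF \<phi>] in simp)
      moreover have "conv (extend \<phi>)" unfolding conv_def by (rule tests[OF \<phi>])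
      ultimately show "\<exists>\<psi>'. continuous_on UNIV \<psi>' \<and> conv \<psi>' \<and> (\<forall>V. \<bar>u V ^ i - \<psi>' V\<bar> \<le> e)" by blast
    qed
  qed
  have cpoly: "continuous_on UNIV (\<lambda>V. poly p (u V))" for p :: "real poly"
    by (intro continuous_intros cu)
  have poly_conv: "conv (\<lambda>V. poly p (u V))" for p :: "real poly"
  proof -
    have eq: "(LINT V|Q. poly p (u V)) = (\<Sum>i\<le>degree p. coeff p i * (LINT V|Q. u V ^ i))" if "Q \<in> radon_measures" for Q
      unfolding poly_altdef
      by (subst Bochner_Integration.integral_sum)
        (auto intro!: integrable_mult_right int[OF that] continuous_intros cu)
    have "((\<lambda>t. \<Sum>i\<le>degree p. coeff p i * (LINT V|N t. u V ^ i)) \<longlongrightarrow> (\<Sum>i\<le>degree p. coeff p i * (LINT V|L. u V ^ i))) at_top"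
      using power by (intro tendsto_intros) (auto simp: conv_def)
    moreover have "\<forall>\<^sub>F t in at_top. (\<Sum>i\<le>degree p. coeff p i * (LINT V|N t. u V ^ i)) = (LINT V|N t. poly p (u V))"
      using eventually_gt_at_top[of 0] by eventually_elim (simp add: eq N(1))
    ultimately show ?thesis
      unfolding conv_def eq[OF L(1)] by (rule Lim_transform_eventually)
  qed
  \<comment> \<open>Separation of points; the value 0 is taken at infinity only.\<close>
  have u_inj: "u x \<noteq> u y" if "x \<noteq> y" for x y
  proof -
    have pos: "0 < 1 / (1 + z)" if "0 \<le> z" for z :: real using that by simp
    show ?thesis
    proof (cases x; cases y)
      fix a b assume "x = ennreal a" "0 \<le> a" "y = ennreal b" "0 \<le> b"
      then show ?thesis using that by (auto simp: u_fin field_simps)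
    qed (use that pos u_fin u_top in \<open>auto simp: less_le\<close>)
  qed
  have "conv \<psi>" if c: "continuous_on UNIV \<psi>" for \<psi>
  proof (rule approx[OF c])
    fix e :: real assume "0 < e"
    have "\<exists>g. (\<exists>p. g = (\<lambda>V. poly p (u V))) \<and> (\<forall>V\<in>UNIV. \<bar>\<psi> V - g V\<bar> < e)"
    proof (rule Stone_Weierstrass_HOL[OF compact_UNIV _ _ _ _ _ c \<open>0 < e\<close>])
      show "\<exists>p. (\<lambda>_. k) = (\<lambda>V. poly p (u V))" for k by (rule exI[of _ "[:k:]"]) simp
      show "continuous_on UNIV g" if "\<exists>p. g = (\<lambda>V. poly p (u V))" for g using that cpoly by auto
      show "\<exists>p. (\<lambda>V. f V + g V) = (\<lambda>V. poly p (u V))"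
        if fg: "(\<exists>p. f = (\<lambda>V. poly p (u V))) \<and> (\<exists>p. g = (\<lambda>V. poly p (u V)))" for f g
      proof -
        obtain p q where "f = (\<lambda>V. poly p (u V))" "g = (\<lambda>V. poly q (u V))" using fg by blast
        then show ?thesis by (intro exI[of _ "p + q"]) simp
      qed
      show "\<exists>p. (\<lambda>V. f V * g V) = (\<lambda>V. poly p (u V))"
        if fg: "(\<exists>p. f = (\<lambda>V. poly p (u V))) \<and> (\<exists>p. g = (\<lambda>V. poly p (u V)))" for f g
      proof -
        obtain p q where "f = (\<lambda>V. poly p (u V))" "g = (\<lambda>V. poly q (u V))" using fg by blast
        then show ?thesis by (intro exI[of _ "p * q"]) simp
      qed
      show "\<exists>g. (\<exists>p. g = (\<lambda>V. poly p (u V))) \<and> g x \<noteq> g y" if "x \<in> UNIV \<and> y \<in> UNIV \<and> x \<noteq> y" for x y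
        using u_inj[of x y] that by (intro exI[of _ u]) (auto intro: exI[of _ "[:0, 1:]"])
    qed
    then obtain p where "\<And>V. \<bar>\<psi> V - poly p (u V)\<bar> < e" by auto
    then show "\<exists>\<psi>'. continuous_on UNIV \<psi>' \<and> conv \<psi>' \<and> (\<forall>V. \<bar>\<psi> V - \<psi>' V\<bar> \<le> e)"
      using cpoly[of p] poly_conv[of p] by (intro exI[of _ "\<lambda>V. poly p (u V)"]) (auto intro: less_imp_le)
  qed
  then show ?thesis by (simp add: weakly_tendsto_def conv_def)
qed

theorem theorem2p5:
  fixes \<sigma> \<mu> C\<^sub>0 :: real
    and G :: "real \<Rightarrow> real"
    and f\<^sub>0 F :: "ennreal measure"
    and f :: "real \<Rightarrow> ennreal measure"
  assumes "5/3 < \<sigma>" and "\<sigma> < 2"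
    and "\<mu> = inverse (\<sigma> - 5/3)"
    and "\<And>v. v > 0 \<Longrightarrow> G v \<ge> 0"
    and "set_integrable lebesgue {0<..} G"
    and "C\<^sub>0 > 0"
    and "\<And>v. v > 0 \<Longrightarrow> G v \<le> C\<^sub>0 * v powr (-\<sigma>)"
    and "((\<lambda>v. v powr \<sigma> * G v) \<longlongrightarrow> 1) at_top"
    and "f\<^sub>0 \<in> radon_measures"
    and "emeasure f\<^sub>0 UNIV = 1"
    and "emeasure f\<^sub>0 {\<infinity>} = 0"
    and "weak_solution G f\<^sub>0 f"
    and "self_similar_profile \<sigma> \<mu> F"
  shows "weakly_tendsto (rescaled \<mu> f) F at_top"
proof -
  note w = \<open>weak_solution G f\<^sub>0 f\<close> and Gint = \<open>set_integrable lebesgue {0<..} G\<close>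
  \<comment> \<open>G is replaced by a Borel version agreeing almost everywhere; the weak
    formulation sees G only through integrals.\<close>
  obtain H where H: "integrable_jump_kernel \<sigma> C\<^sub>0 H" "AE v in lborel. 0 < v \<longrightarrow> G v = H v"
    "((\<lambda>v. v powr \<sigma> * H v) \<longlongrightarrow> 1) at_top"
    by (rule borel_kernel[OF assms(1,2,4,5,7,8)])
  interpret integrable_jump_kernel \<sigma> C\<^sub>0 H by fact
  interpret profile "finite_part F" \<sigma> \<mu>
    by (rule profile_of_self_similar[OF assms(1,2,3,13)])
  interpret flow "finite_part F" \<sigma> \<mu> C\<^sub>0 H
    by unfold_locales (rule H(3))
  have R: "f t \<in> radon_measures" if "0 \<le> t" for t using w that by (simp add: weak_solution_def)
  have f1: "measure (f t) UNIV = 1" if "0 \<le> t" for t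
    by (rule weak_solution_mass[OF w assms(10) that])
  have FR: "F \<in> radon_measures" and F1: "measure F UNIV = 1"
    using assms(13) by (auto simp: self_similar_profile_def measure_def)
  have f0: "f 0 = f\<^sub>0" using w by (simp add: weak_solution_def)
  interpret evolution "finite_part F" \<sigma> \<mu> C\<^sub>0 H "\<lambda>t. finite_part (f t)"
  proof (intro evolution.intro evolution_axioms.intro)
    show "flow (finite_part F) \<sigma> \<mu> C\<^sub>0 H" by (rule flow_axioms)
    show "sets (finite_part (f t)) = sets borel" for t by (simp add: finite_part_def)
    fix t :: real assume t: "0 \<le> t"
    note P = finite_part_props[OF R[OF t]]
    show "finite_measure (finite_part (f t))" "AE x in finite_part (f t). 0 \<le> x" by (rule P)+
    interpret ft: finite_measure "f t" using R[OF t] by (simp add: radon_measures_def)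
    show "measure (finite_part (f t)) UNIV \<le> 1"
      unfolding P(4) using ft.bounded_measure f1[OF t] sets_eq_imp_space_eq[of "f t" borel] R[OF t]
      by (simp add: radon_measures_def)
  next
    interpret f0: finite_measure f\<^sub>0 using assms(9) by (simp add: radon_measures_def)
    have s0: "sets f\<^sub>0 = sets borel" using assms(9) by (simp add: radon_measures_def)
    \<comment> \<open>The absence of an atom of the initial measure at infinity enters here: its
      finite part carries the full mass 1.\<close>
    have "{V. V < (\<infinity>::ennreal)} = UNIV - {\<infinity>}" by (auto simp: less_top)
    then have "measure f\<^sub>0 {V. V < \<infinity>} = measure f\<^sub>0 UNIV - measure f\<^sub>0 {\<infinity>}"
      by (simp add: f0.finite_measure_Diff s0)
    then show "measure (finite_part (f 0)) UNIV = 1"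
      using assms(10,11) finite_part_props(4)[OF R[of 0]] by (simp add: f0 measure_def)
  next
    fix \<phi> M assume \<phi>: "\<phi> \<in> decreasing_tests M"
    have "continuous_on {0..} (\<lambda>t. LINT V|f t. extend \<phi> V)"
      by (rule weak_solution_continuous[OF w continuous_on_extend[OF decreasing_testsD(1)[OF \<phi>], of M]])
        (use decreasing_testsD(5)[OF \<phi>] in simp)
    then show "continuous_on {0..} (\<lambda>t. \<integral>x. \<phi> x \<partial>finite_part (f t))"
      by (rule continuous_on_eq) (simp add: finite_part_props(5)[OF R decreasing_testsD(6)[OF \<phi>]])
  next
    fix \<phi> M and T :: real assume "\<phi> \<in> decreasing_tests M" "0 \<le> T"
    then show "(\<integral>x. \<phi> x \<partial>finite_part (f T)) - (\<integral>x. \<phi> x \<partial>finite_part (f 0)) =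
        integral {0..T} (\<lambda>t. \<integral>x. growth H \<phi> x \<partial>finite_part (f t))"
      using Gint by (intro weak_solution_evolution[OF w assms(10) _ H(1,2)]) (auto simp: set_integrable_def)
  qed
  show ?thesis
  proof (rule weak_convergence_criterion[OF _ _ FR F1])
    fix t :: real assume "0 < t"
    then have t: "0 \<le> t" by simp
    have sf: "sets (f t) = sets borel" "finite_measure (f t)" using R[OF t] by (auto simp: radon_measures_def)
    have mt [measurable]: "(\<lambda>V. ennreal (t powr (-\<mu>)) * V) \<in> borel_measurable (f t)"
      using sf(1) by (simp cong: measurable_cong_sets)
    show "rescaled \<mu> f t \<in> radon_measures"
      unfolding rescaled_def radon_measures_def
      using finite_measure.finite_measure_distr[OF sf(2) mt] by simp
    show "measure (rescaled \<mu> f t) UNIV = 1"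
      unfolding rescaled_def measure_distr[OF mt, of UNIV, simplified]
      using f1[OF t] sets_eq_imp_space_eq[OF sf(1)] by simp
  next
    fix \<phi> M assume \<phi>: "\<phi> \<in> decreasing_tests M"
    note D = decreasing_testsD[OF \<phi>]
    have ext: "extend \<phi> \<in> borel_measurable borel"
      by (rule borel_measurable_continuous_onI[OF continuous_on_extend[OF D(1), of M]]) (use D(5) in simp)
    have "(LINT V|rescaled \<mu> f t. extend \<phi> V) = (\<integral>x. \<phi> (x / t powr \<mu>) \<partial>finite_part (f t))" if "0 < t" for t
    proof -
      have sf: "sets (f t) = sets borel" using R[of t] that by (simp add: radon_measures_def)
      have "(LINT V|rescaled \<mu> f t. extend \<phi> V) = (LINT V|f t. extend \<phi> (ennreal (t powr (-\<mu>)) * V))"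
        unfolding rescaled_def by (rule integral_distr[OF _ ext]) (use sf in \<open>simp cong: measurable_cong_sets\<close>)
      \<comment> \<open>Dilation by a positive factor fixes infinity, so it commutes with extension
        by 0 there.\<close>
      also have "(\<lambda>V. extend \<phi> (ennreal (t powr (-\<mu>)) * V)) = extend (\<lambda>x. \<phi> (x / t powr \<mu>))"
      proof
        fix V :: ennreal
        show "extend \<phi> (ennreal (t powr (-\<mu>)) * V) = extend (\<lambda>x. \<phi> (x / t powr \<mu>)) V"
        proof (cases V)
          case (real x)
          have "ennreal (t powr (-\<mu>)) * V = ennreal (x / t powr \<mu>)"
            using real that by (simp add: powr_minus divide_inverse mult.commute flip: ennreal_mult')
          then show ?thesis using real by simp
        next
          case top
          then show ?thesis using that by (simp add: extend_def ennreal_mult_top)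
        qed
      qed
      also have "(LINT V|f t. extend (\<lambda>x. \<phi> (x / t powr \<mu>)) V) = (\<integral>x. \<phi> (x / t powr \<mu>) \<partial>finite_part (f t))"
        by (rule finite_part_props(5)[symmetric]) (use R that D(6) in auto)
      finally show ?thesis .
    qed
    then have "\<forall>\<^sub>F t in at_top. (\<integral>x. \<phi> (x / t powr \<mu>) \<partial>finite_part (f t)) = (LINT V|rescaled \<mu> f t. extend \<phi> V)"
      by (intro eventually_mono[OF eventually_gt_at_top[of 0]]) simp
    from Lim_transform_eventually[OF rescaled_tests_tendsto[OF \<phi>] this]
    show "((\<lambda>t. LINT V|rescaled \<mu> f t. extend \<phi> V) \<longlongrightarrow> (LINT V|F. extend \<phi> V)) at_top"
      by (simp add: finite_part_props(5)[OF FR D(6)])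
  qed
qed

end
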